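(* Let $F$ be a non-archimedean local field with finite residue field $\mathbb{F}_q$, $q$ odd, let $d\geq 3$ and $\mathcal{B}=\mathcal{B}_d(F)$. Let $\Gamma\le PGL_d(F)$ be a cocompact lattice preserving the type function of the vertices of $\mathcal{B}$, such that $X=\Gamma\backslash\mathcal{B}$ has injectivity radius $\geq 2$; so $X$ is a simplicial complex with a type function $\tau:X(0)\to\mathbb{Z}/d\mathbb{Z}=\{1,\dots,d\}$. For each $i$ let $V_i=\tau^{-1}(i)$. Then for any choice of subsets $W_i\subseteq V_i$, $i=1,\dots,d$, \[ \left|\frac{|E(W_1,\dots,W_d)|}{|X(d-1)|}-\prod_{i=1}^d\frac{|W_i|}{|V_i|}\right|\leq \frac{2d}{q^{1/2}}, \] where $X(d-1)$ is the set of $(d-1)$-dimensional cells of $X$ and $E(W_1,\dots,W_d)$ is the set of $(d-1)$-dimensional cells with exactly one vertex in each $W_i$.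
   Context: Let $F$ have discrete valuation $\nu:F^*\to\mathbb{Z}$, ring of integers $\mathcal{O}$, uniformizer $\pi$, residue field $\mathcal{O}/\pi\mathcal{O}$ of order $q$. A lattice is a free $\mathcal{O}$-submodule of $F^d$ of rank $d$; $L\sim\lambda L$ for $\lambda\in F^*$. The Bruhat–Tits building $\mathcal{B}_d(F)$ has as vertices the classes $[L]$, and a set of distinct vertices $\{[L_1],\dots,[L_k]\}$ is a face iff after renumbering there are representatives with $\pi L_1'\subsetneq L_k'\subsetneq\dots\subsetneq L_2'\subsetneq L_1'$. $G=PGL_d(F)$ acts on it; $K=PGL_d(\mathcal{O})$ stabilizes $x_0=[\mathcal{O}^d]$. The type of the vertex $g x_0$ is $\nu(\det g)\bmod d$; every facet has one vertex of each type, and $\Gamma$ preserves the type function iff $\nu(\det\gamma)\equiv 0\bmod d$ for all $\gamma\in\Gamma$. The injectivity radius of $X=\Gamma\backslash\mathcal{B}$ is the largest $r$ such that the covering map $\mathcal{B}\to X$ is injective on every ball of radius $r$ (graph distance in the 1-skeleton). *)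

theory Defs
  imports "HOL-Analysis.Analysis"
begin

text \<open>A normalized discrete valuation nu on the nonzero elements of a field (the value at 0 is
irrelevant), with uniformizer pi.\<close>
definition discrete_valuation :: "('a::field \<Rightarrow> int) \<Rightarrow> 'a \<Rightarrow> bool" where
  "discrete_valuation \<nu> \<pi> \<longleftrightarrow>
     (\<forall>x y. x \<noteq> 0 \<longrightarrow> y \<noteq> 0 \<longrightarrow> \<nu> (x * y) = \<nu> x + \<nu> y) \<and>
     (\<forall>x y. x \<noteq> 0 \<longrightarrow> y \<noteq> 0 \<longrightarrow> x + y \<noteq> 0 \<longrightarrow> \<nu> (x + y) \<ge> min (\<nu> x) (\<nu> y)) \<and>
     \<pi> \<noteq> 0 \<and> \<nu> \<pi> = 1"

definition val_ring :: "('a::field \<Rightarrow> int) \<Rightarrow> 'a set" where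
  "val_ring \<nu> = {x. x = 0 \<or> 0 \<le> \<nu> x}"

definition residue_rel :: "('a::field \<Rightarrow> int) \<Rightarrow> ('a \<times> 'a) set" where
  "residue_rel \<nu> = {(x, y). x \<in> val_ring \<nu> \<and> y \<in> val_ring \<nu> \<and> (x = y \<or> 1 \<le> \<nu> (x - y))}"

definition residue_field :: "('a::field \<Rightarrow> int) \<Rightarrow> 'a set set" where
  "residue_field \<nu> = val_ring \<nu> // residue_rel \<nu>"

definition val_complete :: "('a::field \<Rightarrow> int) \<Rightarrow> bool" where
  "val_complete \<nu> \<longleftrightarrow>
     (\<forall>s :: nat \<Rightarrow> 'a.
        (\<forall>N. \<exists>M. \<forall>m\<ge>M. \<forall>n\<ge>M. s m = s n \<or> \<nu> (s m - s n) \<ge> N) \<longrightarrow>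
        (\<exists>l. \<forall>N. \<exists>M. \<forall>n\<ge>M. s n = l \<or> \<nu> (s n - l) \<ge> N))"

definition nonarch_local_field :: "('a::field \<Rightarrow> int) \<Rightarrow> 'a \<Rightarrow> nat \<Rightarrow> bool" where
  "nonarch_local_field \<nu> \<pi> q \<longleftrightarrow>
     discrete_valuation \<nu> \<pi> \<and> val_complete \<nu> \<and>
     finite (residue_field \<nu>) \<and> card (residue_field \<nu>) = q"

definition scale_set :: "'a::field \<Rightarrow> ('a^'n) set \<Rightarrow> ('a^'n) set" where
  "scale_set c L = (\<lambda>x. c *s x) ` L"

definition is_lattice :: "('a::field \<Rightarrow> int) \<Rightarrow> ('a^'n::finite) set \<Rightarrow> bool" where
  "is_lattice \<nu> L \<longleftrightarrow>
     (\<exists>b :: 'n \<Rightarrow> 'a^'n.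
        (\<forall>c. (\<forall>i. c i \<in> val_ring \<nu>) \<longrightarrow> (\<Sum>i\<in>UNIV. c i *s b i) = 0 \<longrightarrow> (\<forall>i. c i = 0)) \<and>
        L = {(\<Sum>i\<in>UNIV. c i *s b i) | c. \<forall>i. c i \<in> val_ring \<nu>})"

definition std_lattice :: "('a::field \<Rightarrow> int) \<Rightarrow> ('a^'n::finite) set" where
  "std_lattice \<nu> = {x. \<forall>i. x $ i \<in> val_ring \<nu>}"

definition lat_class :: "('a::field^'n) set \<Rightarrow> ('a^'n) set set" where
  "lat_class L = {scale_set c L | c. c \<noteq> 0}"

definition bt_vertices :: "('a::field \<Rightarrow> int) \<Rightarrow> ('a^'n::finite) set set set" where
  "bt_vertices \<nu> = {lat_class L | L. is_lattice \<nu> L}"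

definition bt_face :: "('a::field \<Rightarrow> int) \<Rightarrow> 'a \<Rightarrow> ('a^'n::finite) set set set \<Rightarrow> bool" where
  "bt_face \<nu> \<pi> S \<longleftrightarrow>
     (\<exists>Ls. Ls \<noteq> [] \<and> (\<forall>L\<in>set Ls. is_lattice \<nu> L) \<and>
        distinct (map lat_class Ls) \<and> lat_class ` set Ls = S \<and>
        (\<forall>i. Suc i < length Ls \<longrightarrow> Ls ! Suc i \<subset> Ls ! i) \<and>
        scale_set \<pi> (Ls ! 0) \<subset> last Ls)"

definition bt_adj :: "('a::field \<Rightarrow> int) \<Rightarrow> 'a \<Rightarrow> (('a^'n::finite) set set \<times> ('a^'n) set set) set" where
  "bt_adj \<nu> \<pi> = {(v, w). v \<in> bt_vertices \<nu> \<and> w \<in> bt_vertices \<nu> \<and> v \<noteq> w \<and> bt_face \<nu> \<pi> {v, w}}"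

definition bt_ball :: "('a::field \<Rightarrow> int) \<Rightarrow> 'a \<Rightarrow> ('a^'n::finite) set set \<Rightarrow> nat \<Rightarrow> ('a^'n) set set set" where
  "bt_ball \<nu> \<pi> v r = {w. \<exists>n\<le>r. (v, w) \<in> (bt_adj \<nu> \<pi>) ^^ n}"

definition act_lat :: "'a::field^'n^'n \<Rightarrow> ('a^'n) set \<Rightarrow> ('a^'n) set" where
  "act_lat g L = (\<lambda>x. g *v x) ` L"

definition act_vert :: "'a::field^'n^'n \<Rightarrow> ('a^'n) set set \<Rightarrow> ('a^'n) set set" where
  "act_vert g v = act_lat g ` v"

definition vtype :: "('a::field \<Rightarrow> int) \<Rightarrow> ('a^'n::finite) set set \<Rightarrow> int" where
  "vtype \<nu> v = (SOME t. \<exists>g::'a^'n^'n. invertible g \<and> v = lat_class (act_lat g (std_lattice \<nu>))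
                   \<and> t = \<nu> (det g) mod int CARD('n))"

text \<open>Subgroups of PGL_d(F) are represented by their preimages in GL_d(F), i.e. subgroups of
  GL_d(F) containing all nonzero scalar matrices.\<close>
definition pgl_subgroup :: "('a::field^'n::finite^'n) set \<Rightarrow> bool" where
  "pgl_subgroup \<Gamma> \<longleftrightarrow> (\<forall>g\<in>\<Gamma>. invertible g) \<and> (\<forall>c. c \<noteq> 0 \<longrightarrow> mat c \<in> \<Gamma>) \<and>
     (\<forall>g\<in>\<Gamma>. \<forall>h\<in>\<Gamma>. g ** h \<in> \<Gamma>) \<and> (\<forall>g\<in>\<Gamma>. matrix_inv g \<in> \<Gamma>)"

definition pgl_class :: "'a::field^'n^'n \<Rightarrow> ('a^'n^'n) set" where
  "pgl_class g = {mat c ** g | c. c \<noteq> 0}"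

definition orbit_of :: "('a::field^'n^'n) set \<Rightarrow> ('a^'n) set set \<Rightarrow> ('a^'n) set set set" where
  "orbit_of \<Gamma> v = {act_vert \<gamma> v | \<gamma>. \<gamma> \<in> \<Gamma>}"

definition cocompact_lattice :: "('a::field \<Rightarrow> int) \<Rightarrow> ('a^'n::finite^'n) set \<Rightarrow> bool" where
  "cocompact_lattice \<nu> \<Gamma> \<longleftrightarrow> pgl_subgroup \<Gamma> \<and>
     (\<forall>v\<in>bt_vertices \<nu>. finite (pgl_class ` {\<gamma>\<in>\<Gamma>. act_vert \<gamma> v = v})) \<and>
     finite (orbit_of \<Gamma> ` bt_vertices \<nu>)"

definition type_preserving :: "('a::field \<Rightarrow> int) \<Rightarrow> ('a^'n::finite^'n) set \<Rightarrow> bool" where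
  "type_preserving \<nu> \<Gamma> \<longleftrightarrow> (\<forall>\<gamma>\<in>\<Gamma>. \<forall>v\<in>bt_vertices \<nu>. vtype \<nu> (act_vert \<gamma> v) = vtype \<nu> v)"

definition inj_radius_ge :: "('a::field \<Rightarrow> int) \<Rightarrow> 'a \<Rightarrow> ('a^'n::finite^'n) set \<Rightarrow> nat \<Rightarrow> bool" where
  "inj_radius_ge \<nu> \<pi> \<Gamma> r \<longleftrightarrow> (\<forall>v\<in>bt_vertices \<nu>. inj_on (orbit_of \<Gamma>) (bt_ball \<nu> \<pi> v r))"

definition X_vertices :: "('a::field \<Rightarrow> int) \<Rightarrow> ('a^'n::finite^'n) set \<Rightarrow> ('a^'n) set set set set" where
  "X_vertices \<nu> \<Gamma> = orbit_of \<Gamma> ` bt_vertices \<nu>"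

text \<open>Type of a vertex of X (well defined as Gamma is type preserving).\<close>
definition X_type :: "('a::field \<Rightarrow> int) \<Rightarrow> ('a^'n::finite) set set set \<Rightarrow> int" where
  "X_type \<nu> x = vtype \<nu> (SOME v. v \<in> x)"

definition X_top_cells :: "('a::field \<Rightarrow> int) \<Rightarrow> 'a \<Rightarrow> ('a^'n::finite^'n) set \<Rightarrow> ('a^'n) set set set set set" where
  "X_top_cells \<nu> \<pi> \<Gamma> = (\<lambda>C. orbit_of \<Gamma> ` C) ` {C. bt_face \<nu> \<pi> C \<and> card C = CARD('n)}"

definition X_E :: "('a::field \<Rightarrow> int) \<Rightarrow> 'a \<Rightarrow> ('a^'n::finite^'n) set \<Rightarrow> (int \<Rightarrow> ('a^'n) set set set set)
                   \<Rightarrow> ('a^'n) set set set set set" where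
  "X_E \<nu> \<pi> \<Gamma> W = {\<sigma> \<in> X_top_cells \<nu> \<pi> \<Gamma>. \<forall>i\<in>{0..<int CARD('n)}. card (\<sigma> \<inter> W i) = 1}"

end

theory Submission
  imports Defs
begin

text \<open>
  Let \<open>P i\<close> average a function of the top cells of \<open>X\<close> over the \<open>q + 1\<close> cells that differ at most in
  the vertex of type \<open>i\<close>. These are orthogonal projections; projections of non-adjacent types commute,
  and those of adjacent types satisfy the Hecke algebra relation
  \<open>P i P j P i - c P i = P j P i P j - c P j\<close> with \<open>c = q / (q + 1)^2\<close>, because the rank two residues are
  projective planes over the residue field. Hence the ranges of \<open>P i\<close> and \<open>P j\<close> meet at an angle of
  cosine at most \<open>sqrt c < 1 / sqrt q\<close>, and so do those of \<open>Q i = 1 - P i\<close> and \<open>Q j\<close>.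

  By gallery connectedness every \<open>f\<close> of mean zero is \<open>\<Sum>i. Q i z\<close> for some \<open>z\<close>. If \<open>f\<close> depends only on the
  vertex of type \<open>k\<close>, then \<open>Q i f = 0\<close> for \<open>i \<noteq> k\<close>, so \<open>\<parallel>f\<parallel>^2 = \<langle>Q k f, Q k z\<rangle>\<close>, while the small angles give
  \<open>\<parallel>f\<parallel>^2 \<ge> (1 - 4 c) \<parallel>Q k z\<parallel>^2\<close>; together \<open>\<parallel>P k f\<parallel> \<le> 2 \<parallel>f\<parallel> / sqrt q\<close>. Thus an event about the vertex of
  type \<open>k\<close> has covariance at most \<open>2 / sqrt q\<close> with any event about the other vertices, and removing
  the \<open>d\<close> types one at a time proves the theorem.
\<close>

section \<open>Systems of projections\<close>

text \<open>The rate q^(-1/2) hinges on how the angles are used. On the d-cycle of types, the crude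
  bound \<open>\<parallel>\<Sum>i. Q i z\<parallel>^2 \<ge> (1 - 2 sqrt c) (\<Sum>i. \<parallel>Q i
  z\<parallel>^2)\<close> would only give q^(-1/4). Since just the one term \<open>Q k z\<close> has
  to be controlled, the other squared norms can be spent entirely on the cross terms. This leaves
  \<open>(1 - 4 c) \<parallel>Q k z\<parallel>^2\<close>, with no dependence on d. The counting
  needs lattices, while X offers only orbits of vertices. Each cell is therefore lifted to a
  periodic chain of lattices indexed by all integers, the index being the valuation of the
  determinant. The index mod d is the type, and fixing it removes the ambiguity of a lattice class
  by scalars. The relations between averages are proved for chains and then carried to X: thanks to
  the injectivity radius, the cells of X at a vertex correspond to the chains through one fixed
  lattice over that vertex.\<close>

definition ip :: "'x set \<Rightarrow> ('x \<Rightarrow> real) \<Rightarrow> ('x \<Rightarrow> real) \<Rightarrow> real" where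
  "ip S f g = (\<Sum>x\<in>S. f x * g x)"

lemma ip_commute: "ip S f g = ip S g f"
  by (simp add: ip_def mult.commute)

lemma ip_nonneg: "ip S f f \<ge> 0"
  by (simp add: ip_def sum_nonneg)

lemma ip_diff_left: "ip S (\<lambda>x. u x - v x) g = ip S u g - ip S v g"
  by (simp add: ip_def algebra_simps sum_subtractf)

lemma ip_diff_right: "ip S g (\<lambda>x. u x - v x) = ip S g u - ip S g v"
  by (simp add: ip_def algebra_simps sum_subtractf)

lemma ip_mult_left: "ip S (\<lambda>x. a * u x) g = a * ip S u g"
  by (simp add: ip_def algebra_simps sum_distrib_left)

lemma ip_divide_left: "ip S (\<lambda>x. u x / a) g = ip S u g / a"
  using ip_mult_left[of S "1 / a" u g] by simp

lemma ip_sum_left: "ip S (\<lambda>x. \<Sum>i\<in>I. u i x) g = (\<Sum>i\<in>I. ip S (u i) g)"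
  unfolding ip_def by (subst sum.swap) (simp add: sum_distrib_right)

lemma ip_sum_right: "ip S g (\<lambda>x. \<Sum>i\<in>I. u i x) = (\<Sum>i\<in>I. ip S g (u i))"
  unfolding ip_def by (subst sum.swap) (simp add: sum_distrib_left)

lemma ip_cong: "(\<And>x. x \<in> S \<Longrightarrow> f x = f' x) \<Longrightarrow> (\<And>x. x \<in> S \<Longrightarrow> g x = g' x) \<Longrightarrow> ip S f g = ip S f' g'"
  by (simp add: ip_def)

lemma ip_Cauchy_Schwarz: "(ip S f g)\<^sup>2 \<le> ip S f f * ip S g g"
  using Cauchy_Schwarz_ineq_sum[of f g S] by (simp add: ip_def power2_eq_square)

definition linop :: "(('x \<Rightarrow> real) \<Rightarrow> 'x \<Rightarrow> real) \<Rightarrow> bool" where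
  "linop A \<longleftrightarrow> (\<forall>a b u v. A (\<lambda>x. a * u x + b * v x) = (\<lambda>x. a * A u x + b * A v x))"

lemma linop_comb: "linop A \<Longrightarrow> A (\<lambda>x. a * u x + b * v x) = (\<lambda>x. a * A u x + b * A v x)"
  by (simp add: linop_def)

lemma linop_diff: "linop A \<Longrightarrow> A (\<lambda>x. u x - v x) = (\<lambda>x. A u x - A v x)"
  using linop_comb[of A 1 u "-1" v] by simp

lemma linop_mult: "linop A \<Longrightarrow> A (\<lambda>x. a * u x) = (\<lambda>x. a * A u x)"
  using linop_comb[of A a u 0 u] by simp

lemma linop_divide: "linop A \<Longrightarrow> A (\<lambda>x. u x / a) = (\<lambda>x. A u x / a)"
  using linop_mult[of A "1 / a" u] by simp

text \<open>Stands in for the invertibility of a positive definite matrix. The induction eliminates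
  one point at a time and looks at \<open>T z\<close> only on the current set, so restrictions of
  \<open>T\<close> need no separate treatment.\<close>

lemma positive_linop_surj:
  assumes "finite S" and lin: "linop T"
    and pos: "\<And>z. (\<And>x. x \<notin> S \<Longrightarrow> z x = 0) \<Longrightarrow> \<exists>x\<in>S. z x \<noteq> 0 \<Longrightarrow> ip S z (T z) > 0"
  shows "\<exists>z. (\<forall>x. x \<notin> S \<longrightarrow> z x = 0) \<and> (\<forall>x\<in>S. T z x = f x)"
  using assms(1) pos
proof (induction S arbitrary: f)
  case empty
  show ?case by (intro exI[of _ "\<lambda>_. 0"]) simp
next
  case (insert a S)
  have pos: "ip S z (T z) > 0" if z: "\<And>x. x \<notin> S \<Longrightarrow> z x = 0" "\<exists>x\<in>S. z x \<noteq> 0" for z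
  proof -
    have "ip (insert a S) z (T z) > 0"
      using z by (intro insert.prems) auto
    then show ?thesis using z(1)[of a] insert.hyps by (simp add: ip_def)
  qed
  note IH = insert.IH[OF pos]
  define ea where "ea = (\<lambda>x. if x = a then 1 else (0::real))"
  obtain w where w: "\<forall>x. x \<notin> S \<longrightarrow> w x = 0" "\<forall>x\<in>S. T w x = f x"
    using IH by blast
  obtain u where u: "\<forall>x. x \<notin> S \<longrightarrow> u x = 0" "\<forall>x\<in>S. T u x = T ea x"
    using IH by blast
  \<comment> \<open>Schur complement: \<open>T y\<close> vanishes on \<open>S\<close> and
    \<open>y a = 1\<close>, so \<open>T y a\<close> is the value of the form at \<open>y\<close>,
    hence positive. A multiple of \<open>y\<close> then corrects \<open>T w\<close> at
    \<open>a\<close> without disturbing it on \<open>S\<close>.\<close>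
  define y where "y = (\<lambda>x. ea x - u x)"
  have Ty: "T y x = T ea x - T u x" for x
    unfolding y_def using linop_diff[OF lin, of ea u] by simp
  have ya: "y a = 1" using u(1) insert.hyps by (simp add: y_def ea_def)
  have "ip (insert a S) y (T y) > 0"
    using ya u(1) by (intro insert.prems) (auto simp: y_def ea_def)
  moreover have "ip S y (T y) = 0"
    unfolding ip_def using u(2) by (intro sum.neutral) (simp add: Ty)
  ultimately have s: "T y a > 0"
    using insert.hyps ya by (simp add: ip_def)
  define t where "t = (f a - T w a) / T y a"
  have "T (\<lambda>x. 1 * w x + t * y x) x = T w x + t * T y x" for x
    using linop_comb[OF lin, of 1 w t y] by simp
  then show ?case
    using w u s by (intro exI[of _ "\<lambda>x. 1 * w x + t * y x"] conjI ballI)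
      (simp add: y_def ea_def, auto simp: Ty t_def)
qed

text \<open>The braid relation lets \<open>p\<close> below be written with \<open>A\<close> or with
  \<open>B\<close> outermost, so both fix it. The common part contributes
  \<open>ip S z p \<ge> 0\<close>; only the remainders can make the inner product negative, and for
  them Cauchy-Schwarz gains a factor \<open>sqrt c\<close>.\<close>

lemma ip_two_projections:
  assumes A: "linop A" "\<And>u v. ip S (A u) v = ip S u (A v)" "\<And>u. A (A u) = A u"
    and B: "linop B" "\<And>u v. ip S (B u) v = ip S u (B v)" "\<And>u. B (B u) = B u"
    and braid: "\<And>u x. A (B (A u)) x - c * A u x = B (A (B u)) x - c * B u x"
    and c: "0 \<le> c" "c < 1"
  shows "ip S (A z) (B z) \<ge> - (sqrt c * sqrt (ip S (A z) (A z)) * sqrt (ip S (B z) (B z)))"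
proof -
  \<comment> \<open>\<open>p\<close> is the projection of \<open>z\<close> to the intersection of the two ranges; on its complement the two
    ranges meet at an angle of cosine \<open>sqrt c\<close>.\<close>
  define p where "p = (\<lambda>x. (A (B (A z)) x - c * A z x) / (1 - c))"
  have p': "p = (\<lambda>x. (B (A (B z)) x - c * B z x) / (1 - c))"
    unfolding p_def braid ..
  have Ap: "A p = p"
    unfolding p_def using A(3) by (simp add: linop_divide[OF A(1)] linop_mult[OF A(1)] linop_diff[OF A(1)])
  have Bp: "B p = p"
    unfolding p' using B(3) by (simp add: linop_divide[OF B(1)] linop_mult[OF B(1)] linop_diff[OF B(1)])
  have Azp: "ip S (A z) p = ip S z p" "ip S (B z) p = ip S z p"
    using A(2) B(2) Ap Bp by simp_all
  have ABA: "(1 - c) * ip S p g = ip S (A (B (A z))) g - c * ip S (A z) g" for g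
    unfolding p_def using c by (simp add: ip_divide_left ip_mult_left ip_diff_left)
  have "ip S (A (B (A z))) p = ip S z p"
    using A(2) B(2) Ap Bp by simp
  with ABA[of p] Azp have "(1 - c) * ip S p p = (1 - c) * ip S z p"
    by (simp add: algebra_simps)
  with c have pp: "ip S p p = ip S z p" by simp
  define a where "a = (\<lambda>x. A z x - p x)"
  define b where "b = (\<lambda>x. B z x - p x)"
  have Bb: "B b = b" unfolding b_def using Bp B(3) by (simp add: linop_diff[OF B(1)])
  have Ba: "B a = (\<lambda>x. B (A z) x - p x)" unfolding a_def using Bp by (simp add: linop_diff[OF B(1)])
  have pA: "ip S p (A z) = ip S z p" "ip S p (B z) = ip S z p"
    using Azp ip_commute[of S p] by simp_all
  have ab: "ip S a b = ip S (A z) (B z) - ip S z p"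
    unfolding a_def b_def by (simp add: ip_diff_left ip_diff_right Azp pA pp)
  have aa: "ip S a a = ip S (A z) (A z) - ip S z p"
    unfolding a_def by (simp add: ip_diff_left ip_diff_right Azp pA pp)
  have bb: "ip S b b = ip S (B z) (B z) - ip S z p"
    unfolding b_def by (simp add: ip_diff_left ip_diff_right Azp pA pp)
  have zp: "ip S z p \<ge> 0" using ip_nonneg[of S p] pp by simp
  have "ip S (B (A z)) (A z) = ip S (A (B (A z))) z" using A(2) by simp
  also have "\<dots> = (1 - c) * ip S z p + c * ip S (A z) (A z)"
    using ABA[of z] A(2)[of "A z" z] A(3)[of z] A(2)[of z "A z"] ip_commute[of S z p]
    by (simp add: ip_commute[of S z])
  finally have BAA: "ip S (B (A z)) (A z) = (1 - c) * ip S z p + c * ip S (A z) (A z)" .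
  have BAp: "ip S (B (A z)) p = ip S z p" using A(2) B(2) Ap Bp by simp
  \<comment> \<open>On the remainder \<open>A (B a)\<close> is \<open>c\<close> times
    \<open>a\<close>, by the definition of \<open>p\<close>, so \<open>B\<close> shrinks the squared
    norm of \<open>a\<close> by exactly \<open>c\<close>.\<close>
  have "ip S (B a) (B a) = ip S (B a) a"
    using B(2)[of "B a" a] B(3)[of a] by simp
  also have "\<dots> = ip S (\<lambda>x. B (A z) x - p x) (\<lambda>x. A z x - p x)"
    by (subst Ba) (simp add: a_def)
  also have "\<dots> = c * ip S a a"
    unfolding aa
    by (simp add: ip_diff_left ip_diff_right BAA BAp pA pp algebra_simps)
  finally have BB: "ip S (B a) (B a) = c * ip S a a" .
  have "ip S a b = ip S (B a) b" using B(2)[of a b] Bb by simp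
  then have "(ip S a b)\<^sup>2 \<le> c * ip S a a * ip S b b"
    using ip_Cauchy_Schwarz[of S "B a" b] BB by simp
  also have "\<dots> \<le> c * ip S (A z) (A z) * ip S (B z) (B z)"
    using zp c ip_nonneg[of S a] ip_nonneg[of S b] aa bb
    by (intro mult_mono) (auto intro!: mult_nonneg_nonneg)
  finally have "\<bar>ip S a b\<bar> \<le> sqrt (c * ip S (A z) (A z) * ip S (B z) (B z))"
    by (metis real_sqrt_abs real_sqrt_le_mono)
  then show ?thesis using ab zp by (simp add: real_sqrt_mult)
qed

text \<open>The quotient complex seen only through its averages. Writing
  \<open>P i = (T i + 1) / (q + 1)\<close>, the assumption \<open>braid\<close> is the relation
  \<open>T i T j T i = T j T i T j\<close> between Hecke algebra generators.
  \<open>invariant_const\<close> encodes connectedness, and \<open>degree\<close> bounds the valency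
  of the diagram \<open>adj\<close>.\<close>

locale projection_system =
  fixes S :: "'x set" and I :: "'i set" and P :: "'i \<Rightarrow> ('x \<Rightarrow> real) \<Rightarrow> 'x \<Rightarrow> real"
    and adj :: "'i \<Rightarrow> 'i \<Rightarrow> bool" and c :: real
  assumes finS: "finite S" and finI: "finite I"
    and lin: "i \<in> I \<Longrightarrow> linop (P i)"
    and sa: "i \<in> I \<Longrightarrow> ip S (P i u) v = ip S u (P i v)"
    and idem: "i \<in> I \<Longrightarrow> P i (P i u) = P i u"
    and comm: "i \<in> I \<Longrightarrow> j \<in> I \<Longrightarrow> i \<noteq> j \<Longrightarrow> \<not> adj i j \<Longrightarrow> P i (P j u) = P j (P i u)"
    and braid: "i \<in> I \<Longrightarrow> j \<in> I \<Longrightarrow> adj i j \<Longrightarrow>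
          P i (P j (P i u)) x - c * P i u x = P j (P i (P j u)) x - c * P j u x"
    and total: "i \<in> I \<Longrightarrow> (\<Sum>x\<in>S. P i u x) = (\<Sum>x\<in>S. u x)"
    and invariant_const: "(\<And>i x. i \<in> I \<Longrightarrow> x \<in> S \<Longrightarrow> P i u x = u x) \<Longrightarrow> \<exists>a. \<forall>x\<in>S. u x = a"
    and adj_sym: "adj i j \<Longrightarrow> adj j i" and adj_irrefl: "\<not> adj i i"
    and degree: "i \<in> I \<Longrightarrow> card {j\<in>I. adj i j} \<le> 2"
    and c: "0 \<le> c" "c \<le> 1/4"
begin

definition Q where "Q i u = (\<lambda>x. u x - P i u x)"

lemma lin_Q: assumes "i \<in> I" shows "linop (Q i)"
  unfolding linop_def Q_def by (auto simp: linop_comb[OF lin[OF assms]] algebra_simps)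

lemma sa_Q: "i \<in> I \<Longrightarrow> ip S (Q i u) v = ip S u (Q i v)"
  by (simp add: Q_def ip_diff_left ip_diff_right sa)

lemma idem_Q: assumes "i \<in> I" shows "Q i (Q i u) = Q i u"
  unfolding Q_def linop_diff[OF lin[OF assms]] by (simp add: idem assms)

text \<open>In the expansion of \<open>Q i Q j Q i - c Q i\<close>, everything except
  \<open>P i P j P i - c P i\<close> is symmetric in \<open>i\<close> and \<open>j\<close>, so the
  complements inherit the braid relation with the same \<open>c\<close>. For non-adjacent types the
  inner product is the squared norm of \<open>Q i (Q j z)\<close>.\<close>

lemma Q_pair:
  assumes "i \<in> I" "j \<in> I" "i \<noteq> j"
  shows "ip S (Q i z) (Q j z) \<ge>
    (if adj i j then - (sqrt c * sqrt (ip S (Q i z) (Q i z)) * sqrt (ip S (Q j z) (Q j z))) else 0)"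
proof (cases "adj i j")
  case True
  have b: "Q i (Q j (Q i u)) x - c * Q i u x = Q j (Q i (Q j u)) x - c * Q j u x" for u x
  proof -
    have "Q j (Q i u) = (\<lambda>x. u x - P i u x - (P j u x - P j (P i u) x))"
      "Q i (Q j u) = (\<lambda>x. u x - P j u x - (P i u x - P i (P j u) x))"
      using assms(1,2) by (simp_all add: Q_def linop_diff[OF lin])
    then have "Q i (Q j (Q i u)) x = u x - P i u x - (P j u x - P j (P i u) x)
          - (P i u x - P i u x - (P i (P j u) x - P i (P j (P i u)) x))"
      "Q j (Q i (Q j u)) x = u x - P j u x - (P i u x - P i (P j u) x)
          - (P j u x - P j u x - (P j (P i u) x - P j (P i (P j u)) x))"
      using assms(1,2) by (simp_all add: Q_def[of i "Q j _"] Q_def[of j "Q i _"] Q_def[of i "\<lambda>x. _ x"] Q_def[of j "\<lambda>x. _ x"] linop_diff[OF lin] idem)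
    then show ?thesis
      using braid[OF assms(1,2) True, of u x] by (simp add: Q_def algebra_simps)
  qed
  show ?thesis
    using ip_two_projections[of "Q i" S "Q j" c z] b c assms lin_Q sa_Q idem_Q True by auto
next
  case False
  have co: "Q i (Q j z) = Q j (Q i z)"
    using comm[OF assms False, of z] assms(1,2) by (simp add: Q_def linop_diff[OF lin] fun_eq_iff)
  have "ip S (Q i z) (Q j z) = ip S (Q i (Q j z)) (Q i (Q j z))"
    by (metis co sa_Q idem_Q assms(1,2))
  then show ?thesis using False ip_nonneg by simp
qed

text \<open>Each cross term is charged to its two ends as \<open>\<alpha> i + \<alpha> j\<close>. A
  type has at most two neighbours and pays for each once in its own row and once in the neighbour's,
  at most \<open>4 * \<alpha> i\<close> in all. For \<open>i \<noteq> k\<close> this is exactly the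
  diagonal term.\<close>

lemma norm_sum_Q:
  assumes k: "k \<in> I"
  shows "ip S (\<lambda>x. \<Sum>i\<in>I. Q i z x) (\<lambda>x. \<Sum>i\<in>I. Q i z x) \<ge> (1 - 4 * c) * ip S (Q k z) (Q k z)"
proof -
  define t where "t i = sqrt (ip S (Q i z) (Q i z))" for i
  have t0: "t i \<ge> 0" for i by (simp add: t_def ip_nonneg)
  have t2: "(t i)\<^sup>2 = ip S (Q i z) (Q i z)" for i by (simp add: t_def ip_nonneg)
  define e where "e = sqrt c"
  have e: "0 \<le> e" "e \<le> 1/2" "e\<^sup>2 = c"
    using c real_sqrt_le_mono[of c "1/4"] by (auto simp: e_def real_sqrt_divide)
  \<comment> \<open>Weights from \<open>(e * x - y / 2)^2 \<ge> 0\<close>: an edge at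
    \<open>k\<close> costs \<open>k\<close> only \<open>c\<close> times its squared norm and the
    other end a quarter of its own. Edges away from \<open>k\<close> need just
    \<open>e \<le> 1/2\<close>.\<close>
  define \<alpha> where "\<alpha> i = (if i = k then c * (t i)\<^sup>2 else (t i)\<^sup>2 / 4)" for i
  define N where "N i = {j\<in>I. adj i j}" for i
  have fN: "finite (N i)" for i using finI by (simp add: N_def)
  have \<alpha>0: "\<alpha> i \<ge> 0" for i using c by (simp add: \<alpha>_def)
  have am: "e * t i * t j \<le> \<alpha> i + \<alpha> j" if "i \<noteq> j" for i j
  proof -
    have *: "e * x * y \<le> c * x\<^sup>2 + y\<^sup>2 / 4" for x y
      using zero_le_power2[of "e * x - y / 2"] by (simp add: power2_diff power_mult_distrib e(3) power_divide)
    have **: "e * t i * t j \<le> (t i)\<^sup>2 / 4 + (t j)\<^sup>2 / 4"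
    proof -
      have "e * (t i * t j) \<le> 1/2 * (t i * t j)"
        using e t0 by (intro mult_right_mono) auto
      then show ?thesis using zero_le_power2[of "t i - t j"] by (simp add: power2_diff)
    qed
    show ?thesis
      using that *[of "t i" "t j"] *[of "t j" "t i"] **
      by (cases "i = k"; cases "j = k") (auto simp: \<alpha>_def mult_ac)
  qed
  have row: "(\<Sum>j\<in>I. ip S (Q i z) (Q j z)) \<ge> (t i)\<^sup>2 - (\<Sum>j\<in>N i. \<alpha> i + \<alpha> j)" if i: "i \<in> I" for i
  proof -
    have "(\<Sum>j\<in>I. ip S (Q i z) (Q j z)) = (t i)\<^sup>2 + (\<Sum>j\<in>I-{i}. ip S (Q i z) (Q j z))"
      using finI i by (simp add: sum.remove t2)
    moreover have "(\<Sum>j\<in>I-{i}. ip S (Q i z) (Q j z)) \<ge> (\<Sum>j\<in>I-{i}. if j \<in> N i then - (\<alpha> i + \<alpha> j) else 0)"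
    proof (intro sum_mono)
      fix j assume j: "j \<in> I - {i}"
      then show "ip S (Q i z) (Q j z) \<ge> (if j \<in> N i then - (\<alpha> i + \<alpha> j) else 0)"
        using Q_pair[OF i, of j z] am[of i j] by (auto simp: N_def e_def t_def)
    qed
    moreover have "(\<Sum>j\<in>I-{i}. if j \<in> N i then - (\<alpha> i + \<alpha> j) else 0) = (\<Sum>j\<in>N i. - (\<alpha> i + \<alpha> j))"
      using finI adj_irrefl by (intro sum.mono_neutral_cong_right) (auto simp: N_def)
    ultimately show ?thesis by (simp add: sum_negf del: minus_add_distrib)
  qed
  have sw: "(\<Sum>i\<in>I. \<Sum>j\<in>N i. \<alpha> j) = (\<Sum>i\<in>I. \<Sum>j\<in>N i. \<alpha> i)"
  proof -
    have "(\<Sum>i\<in>I. \<Sum>j\<in>N i. \<alpha> j) = (\<Sum>i\<in>I. \<Sum>j\<in>{j\<in>I. adj i j}. \<alpha> j)"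
      by (simp add: N_def)
    also have "\<dots> = (\<Sum>j\<in>I. \<Sum>i\<in>{i\<in>I. adj i j}. \<alpha> j)"
      using finI by (intro sum.swap_restrict)
    also have "\<dots> = (\<Sum>j\<in>I. \<Sum>i\<in>N j. \<alpha> j)"
      using adj_sym by (intro sum.cong) (auto simp: N_def)
    finally show ?thesis .
  qed
  have deg: "(\<Sum>j\<in>N i. \<alpha> i) \<le> 2 * \<alpha> i" if "i \<in> I" for i
    using degree[OF that] \<alpha>0[of i] by (simp add: N_def mult_right_mono)
  have "ip S (\<lambda>x. \<Sum>i\<in>I. Q i z x) (\<lambda>x. \<Sum>i\<in>I. Q i z x) = (\<Sum>i\<in>I. \<Sum>j\<in>I. ip S (Q i z) (Q j z))"
    by (simp add: ip_sum_left ip_sum_right)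
  also have "\<dots> \<ge> (\<Sum>i\<in>I. (t i)\<^sup>2 - (\<Sum>j\<in>N i. \<alpha> i + \<alpha> j))"
    by (intro sum_mono row)
  also have "(\<Sum>i\<in>I. (t i)\<^sup>2 - (\<Sum>j\<in>N i. \<alpha> i + \<alpha> j)) = (\<Sum>i\<in>I. (t i)\<^sup>2) - 2 * (\<Sum>i\<in>I. \<Sum>j\<in>N i. \<alpha> i)"
    using sw by (simp add: sum_subtractf sum.distrib del: sum_constant)
  also have "\<dots> \<ge> (\<Sum>i\<in>I. (t i)\<^sup>2) - 2 * (\<Sum>i\<in>I. 2 * \<alpha> i)"
    using sum_mono[OF deg] by simp
  also have "(\<Sum>i\<in>I. (t i)\<^sup>2) - 2 * (\<Sum>i\<in>I. 2 * \<alpha> i) = (\<Sum>i\<in>I. (t i)\<^sup>2 - 4 * \<alpha> i)"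
    by (simp add: sum_subtractf sum_distrib_left)
  also have "\<dots> = (1 - 4 * c) * (t k)\<^sup>2"
    using finI k by (simp add: sum.remove[of I k] \<alpha>_def algebra_simps)
  finally show ?thesis by (simp add: t2)
qed

text \<open>Only functions constant on \<open>S\<close> are annihilated by every \<open>Q i\<close>.
  Adding the total of \<open>z\<close> makes the sum of the \<open>Q i\<close> positive definite, so
  that \<open>positive_linop_surj\<close> applies.\<close>

lemma decompose:
  assumes f: "(\<Sum>x\<in>S. f x) = 0"
  shows "\<exists>z. \<forall>x\<in>S. f x = (\<Sum>i\<in>I. Q i z x)"
proof -
  define T where "T z = (\<lambda>x. (\<Sum>i\<in>I. Q i z x) + (\<Sum>y\<in>S. z y))" for z
  have "linop T"
    unfolding linop_def T_def
    by (auto simp: linop_comb[OF lin_Q] sum.distrib sum_distrib_left algebra_simps cong: sum.cong)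
  moreover have "ip S z (T z) > 0" if z: "\<exists>x\<in>S. z x \<noteq> 0" for z
  proof -
    have "ip S z (T z) = ip S z (\<lambda>x. \<Sum>i\<in>I. Q i z x) + (\<Sum>y\<in>S. z y)\<^sup>2"
      by (simp add: T_def ip_def algebra_simps sum.distrib sum_distrib_left power2_eq_square)
    also have "ip S z (\<lambda>x. \<Sum>i\<in>I. Q i z x) = (\<Sum>i\<in>I. ip S (Q i z) (Q i z))"
      unfolding ip_sum_right by (intro sum.cong) (simp_all add: sa_Q idem_Q)
    finally have eq: "ip S z (T z) = (\<Sum>i\<in>I. ip S (Q i z) (Q i z)) + (\<Sum>y\<in>S. z y)\<^sup>2" .
    have nn: "(\<Sum>i\<in>I. ip S (Q i z) (Q i z)) \<ge> 0" by (intro sum_nonneg ip_nonneg)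
    show ?thesis
    proof (rule ccontr)
      assume "\<not> ip S z (T z) > 0"
      then have 0: "(\<Sum>i\<in>I. ip S (Q i z) (Q i z)) = 0" "(\<Sum>y\<in>S. z y) = 0"
        using eq nn by (auto simp: add_nonneg_eq_0_iff dest: order_antisym)
          (smt (verit) zero_le_power2 power2_eq_square mult_eq_0_iff)+
      have "Q i z x = 0" if "i \<in> I" "x \<in> S" for i x
        using 0(1) that finI finS by (auto simp: sum_nonneg_eq_0_iff ip_nonneg ip_def[of S "Q i z"])
      then obtain a where a: "\<forall>x\<in>S. z x = a"
        using invariant_const[of z] by (auto simp: Q_def)
      then have "sum z S = real (card S) * a" by simp
      with 0(2) finS z have "a = 0" by auto
      with a z show False by auto
    qed
  qed
  ultimately obtain z where z: "\<forall>x\<in>S. T z x = f x"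
    using positive_linop_surj[OF finS, of T f] by auto
  \<comment> \<open>Both \<open>f\<close> and every \<open>Q i z\<close> have total 0 on
    \<open>S\<close>; comparing totals removes the term that was added to make \<open>T\<close>
    definite.\<close>
  have "(\<Sum>x\<in>S. \<Sum>i\<in>I. Q i z x) = (\<Sum>i\<in>I. \<Sum>x\<in>S. Q i z x)" by (rule sum.swap)
  also have "\<dots> = 0" by (simp add: Q_def sum_subtractf total)
  finally have "(\<Sum>x\<in>S. T z x) = card S * (\<Sum>y\<in>S. z y)"
    by (simp add: T_def sum.distrib)
  moreover have "(\<Sum>x\<in>S. T z x) = 0" using z f by simp
  ultimately have "S = {} \<or> (\<Sum>y\<in>S. z y) = 0" using finS by simp
  then show ?thesis using z by (auto simp: T_def intro!: exI[of _ z])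
qed

theorem norm_P_le:
  assumes k: "k \<in> I" and inv: "\<And>i x. i \<in> I \<Longrightarrow> i \<noteq> k \<Longrightarrow> x \<in> S \<Longrightarrow> P i f x = f x"
    and f: "(\<Sum>x\<in>S. f x) = 0"
  shows "ip S (P k f) (P k f) \<le> 4 * c * ip S f f"
proof -
  obtain z where z: "\<forall>x\<in>S. f x = (\<Sum>i\<in>I. Q i z x)" using decompose[OF f] by blast
  have "ip S f f = ip S (\<lambda>x. \<Sum>i\<in>I. Q i z x) (\<lambda>x. \<Sum>i\<in>I. Q i z x)"
    using z by (intro ip_cong) auto
  then have 1: "ip S f f \<ge> (1 - 4 * c) * ip S (Q k z) (Q k z)" using norm_sum_Q[OF k, of z] by simp
  have "ip S f f = ip S f (\<lambda>x. \<Sum>i\<in>I. Q i z x)" using z by (intro ip_cong) auto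
  also have "\<dots> = (\<Sum>i\<in>I. ip S (Q i f) (Q i z))"
    unfolding ip_sum_right by (intro sum.cong) (simp_all add: sa_Q idem_Q)
  also have "\<dots> = (\<Sum>i\<in>I. if i = k then ip S (Q k f) (Q k z) else 0)"
    using inv by (intro sum.cong) (auto simp: ip_def Q_def)
  also have "\<dots> = ip S (Q k f) (Q k z)" using k finI by simp
  finally have "(ip S f f)\<^sup>2 \<le> ip S (Q k f) (Q k f) * ip S (Q k z) (Q k z)"
    using ip_Cauchy_Schwarz by metis
  \<comment> \<open>\<open>c = 1/4\<close> is allowed, so \<open>1 - 4 * c\<close> is carried along
    rather than divided out.\<close>
  then have "(1 - 4 * c) * (ip S f f)\<^sup>2 \<le> (1 - 4 * c) * (ip S (Q k f) (Q k f) * ip S (Q k z) (Q k z))"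
    using c by (intro mult_left_mono) auto
  also have "\<dots> = ip S (Q k f) (Q k f) * ((1 - 4 * c) * ip S (Q k z) (Q k z))" by simp
  also have "\<dots> \<le> ip S (Q k f) (Q k f) * ip S f f"
    using 1 by (intro mult_left_mono ip_nonneg)
  finally have "((1 - 4 * c) * ip S f f) * ip S f f \<le> ip S (Q k f) (Q k f) * ip S f f"
    by (simp add: power2_eq_square mult.assoc)
  moreover have "ip S (Q k f) (Q k f) = ip S f f - ip S (P k f) (P k f)"
    using sa_Q[OF k, of f "Q k f"] idem_Q[OF k, of f] sa[OF k, of "P k f" f] idem[OF k, of f]
    by (simp add: Q_def ip_diff_right ip_commute)
  ultimately have 2: "ip S (P k f) (P k f) * ip S f f \<le> 4 * c * ip S f f * ip S f f"
    by (simp add: algebra_simps)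
  show ?thesis
  proof (cases "ip S f f = 0")
    case True
    \<comment> \<open>Here \<open>f\<close> vanishes on \<open>S\<close> but perhaps not elsewhere;
      self-adjointness shows that \<open>P k f\<close> still has norm 0 on \<open>S\<close>.\<close>
    have "(ip S (P k f) (P k f))\<^sup>2 \<le> 0"
      using ip_Cauchy_Schwarz[of S f "P k f"] True sa[OF k, of "P k f" f] idem[OF k, of f]
      by (simp add: ip_commute)
    then show ?thesis using True by simp
  next
    case False
    then have "ip S f f > 0" using ip_nonneg[of S f] by simp
    then show ?thesis using 2 by simp
  qed
qed

end

section \<open>Lattices over a discrete valuation ring\<close>

lemma act_lat_act: "act_lat g (act_lat h L) = act_lat (g ** h) L"
  by (simp add: act_lat_def image_image matrix_vector_mul_assoc)

lemma act_lat_one [simp]: "act_lat (mat 1) L = L"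
  by (simp add: act_lat_def)

lemma mat_vector_mult: "(mat c :: 'a::field^'n^'n) *v x = c *s x"
proof -
  have "(\<Sum>j\<in>UNIV. (if i = j then c else 0) * x $ j) = (\<Sum>j\<in>UNIV. if j = i then c * x $ i else 0)" for i
    by (intro sum.cong) auto
  then show ?thesis by (simp add: matrix_vector_mult_def mat_def vec_eq_iff)
qed

lemma scale_set_eq_act: "scale_set c L = act_lat (mat c) L"
  by (simp add: scale_set_def act_lat_def mat_vector_mult)

lemma scale_scale: "scale_set a (scale_set b L) = scale_set (a * b) L"
  by (simp add: scale_set_def image_image)

lemma scale_one [simp]: "scale_set 1 L = L"
  by (simp add: scale_set_def)

lemma act_scale: "act_lat g (scale_set c L) = scale_set c (act_lat g L)"
  by (simp add: scale_set_def act_lat_def image_image vector_scalar_commute)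

lemma act_mono: "L \<subseteq> M \<Longrightarrow> act_lat g L \<subseteq> act_lat g M"
  by (auto simp: act_lat_def)

lemma invertible_inv: 
  assumes "invertible g"
  shows "matrix_inv g ** g = mat 1" "g ** matrix_inv g = mat 1" "invertible (matrix_inv g)"
proof -
  show *: "matrix_inv g ** g = mat 1" "g ** matrix_inv g = mat 1"
    using someI_ex[OF assms[unfolded invertible_def]] by (auto simp: matrix_inv_def)
  then show "invertible (matrix_inv g)" unfolding invertible_def by blast
qed

lemma act_inv_act:
  assumes "invertible g"
  shows "act_lat (matrix_inv g) (act_lat g L) = L" "act_lat g (act_lat (matrix_inv g) L) = L"
  using invertible_inv[OF assms] by (simp_all add: act_lat_act)

lemma act_subset_iff:
  assumes "invertible g"
  shows "act_lat g L \<subseteq> act_lat g M \<longleftrightarrow> L \<subseteq> M"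
  using act_mono act_inv_act(1)[OF assms] by metis

lemma invertible_mat: "c \<noteq> 0 \<Longrightarrow> invertible (mat c :: 'a::field^'n^'n)"
  by (simp add: invertible_det_nz det_diagonal mat_def)

lemma det_mat: "det (mat c :: 'a::field^'n^'n) = c ^ CARD('n)"
  by (simp add: det_diagonal mat_def)

section \<open>Valuations and submodules over the valuation ring\<close>

locale discrete_valued_field =
  fixes \<nu> :: "'a::field \<Rightarrow> int" and \<pi> :: 'a
  assumes valuation: "discrete_valuation \<nu> \<pi>"
begin

abbreviation \<O> where "\<O> \<equiv> val_ring \<nu>"
abbreviation std :: "('a^'n::finite) set" where "std \<equiv> std_lattice \<nu>"

lemma \<nu>_mult: "x \<noteq> 0 \<Longrightarrow> y \<noteq> 0 \<Longrightarrow> \<nu> (x * y) = \<nu> x + \<nu> y"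
  and \<nu>_add: "x \<noteq> 0 \<Longrightarrow> y \<noteq> 0 \<Longrightarrow> x + y \<noteq> 0 \<Longrightarrow> \<nu> (x + y) \<ge> min (\<nu> x) (\<nu> y)"
  and \<pi>_nonzero [simp]: "\<pi> \<noteq> 0"
  and \<nu>_\<pi> [simp]: "\<nu> \<pi> = 1"
  using valuation by (auto simp: discrete_valuation_def)

lemma \<nu>_one [simp]: "\<nu> 1 = 0"
  using \<nu>_mult[of 1 1] by simp

lemma \<nu>_minus_one [simp]: "\<nu> (-1) = 0"
  using \<nu>_mult[of "-1" "-1"] by simp

lemma \<nu>_inverse: "x \<noteq> 0 \<Longrightarrow> \<nu> (inverse x) = - \<nu> x"
  using \<nu>_mult[of x "inverse x"] by simp

lemma \<nu>_divide: "x \<noteq> 0 \<Longrightarrow> y \<noteq> 0 \<Longrightarrow> \<nu> (x / y) = \<nu> x - \<nu> y"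
  by (simp add: divide_inverse \<nu>_mult \<nu>_inverse)

lemma \<nu>_power: "x \<noteq> 0 \<Longrightarrow> \<nu> (x ^ k) = int k * \<nu> x"
  by (induction k) (simp_all add: \<nu>_mult algebra_simps)

lemma \<nu>_\<pi>_powi [simp]: "\<nu> (\<pi> powi k) = k"
  by (cases "k \<ge> 0") (simp_all add: power_int_def \<nu>_power \<nu>_inverse)

lemma O_0 [simp]: "0 \<in> \<O>" and O_1 [simp]: "1 \<in> \<O>" and O_\<pi> [simp]: "\<pi> \<in> \<O>"
  by (simp_all add: val_ring_def)

lemma O_add: "x \<in> \<O> \<Longrightarrow> y \<in> \<O> \<Longrightarrow> x + y \<in> \<O>"
  using \<nu>_add[of x y] by (cases "x = 0 \<or> y = 0 \<or> x + y = 0") (auto simp: val_ring_def)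

lemma O_mult: "x \<in> \<O> \<Longrightarrow> y \<in> \<O> \<Longrightarrow> x * y \<in> \<O>"
  by (cases "x = 0 \<or> y = 0") (auto simp: val_ring_def \<nu>_mult)

lemma O_minus: "x \<in> \<O> \<Longrightarrow> - x \<in> \<O>"
  using O_mult[of "-1" x] by (simp add: val_ring_def)

lemma O_diff: "x \<in> \<O> \<Longrightarrow> y \<in> \<O> \<Longrightarrow> x - y \<in> \<O>"
  using O_add[OF _ O_minus] by (metis diff_conv_add_uminus)

lemma O_sum: "(\<And>i. i \<in> I \<Longrightarrow> f i \<in> \<O>) \<Longrightarrow> sum f I \<in> \<O>"
  by (induction I rule: infinite_finite_induct) (auto intro: O_add)

lemma O_prod: "(\<And>i. i \<in> I \<Longrightarrow> f i \<in> \<O>) \<Longrightarrow> prod f I \<in> \<O>"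
  by (induction I rule: infinite_finite_induct) (auto intro: O_mult)

lemma O_divide: "x \<in> \<O> \<Longrightarrow> y \<noteq> 0 \<Longrightarrow> \<nu> y = 0 \<Longrightarrow> x / y \<in> \<O>"
  by (cases "x = 0") (auto simp: val_ring_def \<nu>_divide)

lemma O_div_\<pi>: "x \<in> \<O> \<Longrightarrow> x = 0 \<or> \<nu> x \<noteq> 0 \<Longrightarrow> x / \<pi> \<in> \<O>"
  by (cases "x = 0") (auto simp: val_ring_def \<nu>_divide)

lemma \<pi>_power_in_O: "\<pi> ^ k \<in> \<O>"
  by (simp add: val_ring_def \<nu>_power)

definition osub :: "('a^'n) set \<Rightarrow> bool" where
  "osub L \<longleftrightarrow> 0 \<in> L \<and> (\<forall>x\<in>L. \<forall>y\<in>L. x + y \<in> L) \<and> (\<forall>c\<in>\<O>. \<forall>x\<in>L. c *s x \<in> L)"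

lemma osub_0: "osub L \<Longrightarrow> 0 \<in> L"
  and osub_add: "osub L \<Longrightarrow> x \<in> L \<Longrightarrow> y \<in> L \<Longrightarrow> x + y \<in> L"
  and osub_scale: "osub L \<Longrightarrow> c \<in> \<O> \<Longrightarrow> x \<in> L \<Longrightarrow> c *s x \<in> L"
  by (auto simp: osub_def)

lemma osub_minus: "osub L \<Longrightarrow> x \<in> L \<Longrightarrow> - x \<in> L"
  using osub_scale[of L "-1" x] by (simp add: O_minus vector_sneg_minus1[symmetric])

lemma osub_diff: "osub L \<Longrightarrow> x \<in> L \<Longrightarrow> y \<in> L \<Longrightarrow> x - y \<in> L"
  using osub_add[of L x "-y"] osub_minus[of L y] by simp

lemma osub_sum: "osub L \<Longrightarrow> (\<And>i. i \<in> I \<Longrightarrow> f i \<in> L) \<Longrightarrow> sum f I \<in> L"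
  by (induction I rule: infinite_finite_induct) (auto intro: osub_add osub_0)

lemma osub_std: "osub std"
  by (auto simp: osub_def std_lattice_def intro: O_add O_mult)

lemma osub_act: "osub L \<Longrightarrow> osub (act_lat g L)"
  unfolding osub_def act_lat_def
  by (auto simp: matrix_vector_right_distrib[symmetric] vector_scalar_commute[symmetric])
    (metis image_eqI matrix_vector_mult_0_right)

lemma osub_Int: "osub L \<Longrightarrow> osub M \<Longrightarrow> osub (L \<inter> M)"
  by (auto simp: osub_def)

text \<open>Steps of length one between lattices are all of this form with \<open>\<pi> *s e\<close>
  in \<open>M\<close>. Arguments can thus follow single vectors instead of bases or quotient
  modules.\<close>

definition adjoin :: "('a^'n) set \<Rightarrow> 'a^'n \<Rightarrow> ('a^'n) set" where
  "adjoin M e = {x + c *s e | x c. x \<in> M \<and> c \<in> \<O>}"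

lemma osub_adjoin: assumes "osub M" shows "osub (adjoin M e)"
  unfolding osub_def
proof (intro conjI ballI)
  show "0 \<in> adjoin M e"
    using osub_0[OF assms] by (auto simp: adjoin_def intro!: exI[of _ "0::'a^_"] exI[of _ "0::'a"])
  fix x y assume "x \<in> adjoin M e" "y \<in> adjoin M e"
  then obtain u c v b where *: "x = u + c *s e" "y = v + b *s e" "u \<in> M" "v \<in> M" "c \<in> \<O>" "b \<in> \<O>"
    by (auto simp: adjoin_def)
  then have "x + y = (u + v) + (c + b) *s e" by (simp add: vector_sadd_rdistrib)
  then show "x + y \<in> adjoin M e"
    unfolding adjoin_def using * osub_add[OF assms] O_add by blast
next
  fix a x assume "a \<in> \<O>" "x \<in> adjoin M e"
  then obtain u c where *: "x = u + c *s e" "u \<in> M" "c \<in> \<O>"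
    by (auto simp: adjoin_def)
  then have "a *s x = a *s u + (a * c) *s e" by (simp add: vector_add_ldistrib)
  then show "a *s x \<in> adjoin M e"
    unfolding adjoin_def using * osub_scale[OF assms] O_mult \<open>a \<in> \<O>\<close> by blast
qed

lemma adjoin_superset: "M \<subseteq> adjoin M e"
  by (force simp: adjoin_def intro: exI[of _ "0::'a"])

lemma adjoin_mem: "osub M \<Longrightarrow> e \<in> adjoin M e"
  using osub_0 by (force simp: adjoin_def intro: exI[of _ "0::'a^_"] exI[of _ "1::'a"])

lemma adjoin_least: "osub L \<Longrightarrow> M \<subseteq> L \<Longrightarrow> e \<in> L \<Longrightarrow> adjoin M e \<subseteq> L"
  by (auto simp: adjoin_def intro: osub_add osub_scale)

section \<open>Lattices and the valuation of their determinant\<close>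

lemma is_lattice_act_std:
  assumes "invertible (g :: 'a^'n::finite^'n)"
  shows "is_lattice \<nu> (act_lat g std)"
  unfolding is_lattice_def
proof (intro exI[of _ "\<lambda>i. column i g"] conjI allI impI)
  have eq: "(\<Sum>i\<in>UNIV. c i *s column i g) = g *v (\<chi> i. c i)" for c
    by (simp add: matrix_mult_sum)
  show "c i = 0" if "(\<Sum>i\<in>UNIV. c i *s column i g) = 0" for c i
  proof -
    have "(\<chi> i. c i) = 0"
      using that eq assms by (metis invertible_left_inverse matrix_left_invertible_ker)
    then show ?thesis by (simp add: vec_eq_iff)
  qed
  show "act_lat g std = {(\<Sum>i\<in>UNIV. c i *s column i g) | c. \<forall>i. c i \<in> \<O>}"
  proof safe
    fix x assume "x \<in> act_lat g std"
    then obtain y where "x = g *v y" "y \<in> std" by (auto simp: act_lat_def)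
    then show "\<exists>c. x = (\<Sum>i\<in>UNIV. c i *s column i g) \<and> (\<forall>i. c i \<in> \<O>)"
      by (intro exI[of _ "\<lambda>i. y $ i"]) (auto simp: eq std_lattice_def)
  next
    fix c :: "'n \<Rightarrow> 'a" assume "\<forall>i. c i \<in> \<O>"
    then show "(\<Sum>i\<in>UNIV. c i *s column i g) \<in> act_lat g std"
      unfolding eq by (auto simp: std_lattice_def act_lat_def)
  qed
qed

lemma clear_denominators:
  fixes c :: "'n::finite \<Rightarrow> 'a"
  shows "\<exists>k. \<forall>i. \<pi> ^ k * c i \<in> \<O>"
proof -
  have "\<exists>k. \<pi> ^ k * c i \<in> \<O>" for i
    by (cases "c i = 0"; intro exI[of _ "nat (- \<nu> (c i))"]) (auto simp: val_ring_def \<nu>_mult \<nu>_power)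
  then obtain k where k: "\<And>i. \<pi> ^ k i * c i \<in> \<O>" by metis
  have "\<pi> ^ (\<Sum>i\<in>UNIV. k i) * c i \<in> \<O>" for i
  proof -
    have "(\<Sum>i\<in>UNIV. k i) = (\<Sum>j\<in>UNIV-{i}. k j) + k i" by (simp add: sum.remove[of UNIV i])
    then show ?thesis using O_mult[OF \<pi>_power_in_O k] by (simp add: power_add mult.assoc)
  qed
  then show ?thesis by blast
qed

text \<open>The basis of a lattice is independent over the valuation ring only; clearing
  denominators makes it independent over the field, so the matrix of the basis is
  invertible.\<close>

lemma is_lattice_iff: "is_lattice \<nu> (L :: ('a^'n::finite) set) \<longleftrightarrow> (\<exists>g. invertible g \<and> L = act_lat g std)"
proof
  assume "is_lattice \<nu> L"
  then obtain b :: "'n \<Rightarrow> 'a^'n" where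
    b: "\<And>c i. (\<forall>i. c i \<in> \<O>) \<Longrightarrow> (\<Sum>i\<in>UNIV. c i *s b i) = 0 \<Longrightarrow> c i = 0" and
    L: "L = {(\<Sum>i\<in>UNIV. c i *s b i) | c. \<forall>i. c i \<in> \<O>}"
    unfolding is_lattice_def by blast
  define g :: "'a^'n^'n" where "g = (\<chi> i j. b j $ i)"
  have col: "column j g = b j" for j by (simp add: column_def g_def vec_eq_iff)
  have eq: "g *v x = (\<Sum>i\<in>UNIV. (x $ i) *s b i)" for x
    unfolding matrix_mult_sum col ..
  have "x = 0" if "g *v x = 0" for x
  proof -
    obtain k where k: "\<And>i. \<pi> ^ k * x $ i \<in> \<O>" using clear_denominators[of "\<lambda>i. x $ i"] by blast
    have "(\<Sum>i\<in>UNIV. (\<pi> ^ k * x $ i) *s b i) = \<pi> ^ k *s (g *v x)"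
      by (simp add: eq vec.scale_sum_right)
    then have "\<pi> ^ k * x $ i = 0" for i
      using b[of "\<lambda>i. \<pi> ^ k * x $ i" i] k that by simp
    then show ?thesis by (simp add: vec_eq_iff)
  qed
  then have "invertible g" by (simp add: invertible_left_inverse matrix_left_invertible_ker)
  moreover have "L = act_lat g std"
  proof safe
    fix x assume "x \<in> L"
    then obtain c where "x = (\<Sum>i\<in>UNIV. c i *s b i)" "\<forall>i. c i \<in> \<O>" unfolding L by blast
    then have "x = g *v (\<chi> i. c i)" "(\<chi> i. c i) \<in> std" by (auto simp: eq std_lattice_def)
    then show "x \<in> act_lat g std" by (auto simp: act_lat_def)
  next
    fix x assume "x \<in> act_lat g std"
    then show "x \<in> L" unfolding L by (auto simp: act_lat_def std_lattice_def eq)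
  qed
  ultimately show "\<exists>g. invertible g \<and> L = act_lat g std" by blast
qed (use is_lattice_act_std in blast)

lemma lattice_osub: "is_lattice \<nu> L \<Longrightarrow> osub L"
  by (auto simp: is_lattice_iff intro: osub_act osub_std)

lemma lattice_act: "invertible g \<Longrightarrow> is_lattice \<nu> L \<Longrightarrow> is_lattice \<nu> (act_lat g L)"
  by (metis act_lat_act invertible_mult is_lattice_iff)

lemma lattice_scale: "c \<noteq> 0 \<Longrightarrow> is_lattice \<nu> L \<Longrightarrow> is_lattice \<nu> (scale_set c L)"
  by (simp add: scale_set_eq_act lattice_act invertible_mat)

lemma integral_matrix:
  assumes "act_lat A std \<subseteq> std" shows "A $ i $ j \<in> \<O>"
proof -
  have "axis j 1 \<in> std" by (auto simp: std_lattice_def axis_def)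
  then have "A *v axis j 1 \<in> std" using assms by (auto simp: act_lat_def)
  moreover have "(A *v axis j 1) $ i = A $ i $ j"
    by (simp add: matrix_vector_mult_def axis_def if_distrib cong: if_cong)
  ultimately show ?thesis by (metis (no_types, lifting) mem_Collect_eq std_lattice_def)
qed

lemma integral_det:
  fixes A :: "'a^'n::finite^'n"
  assumes "\<And>i j. A $ i $ j \<in> \<O>" shows "det A \<in> \<O>"
  unfolding det_def
proof (intro O_sum O_mult O_prod)
  fix p :: "'n \<Rightarrow> 'n"
  show "of_int (sign p) \<in> \<O>" by (auto simp: sign_def O_minus)
qed (use assms in auto)

lemma integral_det_unit:
  fixes A :: "'a^'n::finite^'n"
  assumes A: "\<And>i j. A $ i $ j \<in> \<O>" and d: "det A \<noteq> 0" "\<nu> (det A) = 0"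
  shows "std \<subseteq> act_lat A std"
proof
  fix y :: "'a^'n" assume y: "y \<in> std"
  \<comment> \<open>Cramer's rule: the numerators are integral determinants and the denominator is a
    unit.\<close>
  define x :: "'a^'n" where "x = (\<chi> k. det (\<chi> i j. if j = k then y $ i else A $ i $ j) / det A)"
  have "A *v x = y" using cramer[OF d(1), of x y] by (simp add: x_def)
  moreover have "x \<in> std"
    unfolding std_lattice_def x_def using A y d
    by (auto simp: std_lattice_def intro!: O_divide integral_det)
  ultimately show "y \<in> act_lat A std" by (auto simp: act_lat_def)
qed

text \<open>The lattices differ by the integral matrix \<open>matrix_inv h ** g\<close>. Its
  determinant has nonnegative valuation, and when that valuation is 0 the inverse is integral as
  well.\<close>

lemma act_std_subset:
  fixes g h :: "'a^'n::finite^'n"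
  assumes g: "invertible g" and h: "invertible h" and sub: "act_lat g std \<subseteq> act_lat h std"
  shows "\<nu> (det h) \<le> \<nu> (det g)" "\<nu> (det h) = \<nu> (det g) \<Longrightarrow> act_lat g std = act_lat h std"
proof -
  define A where "A = matrix_inv h ** g"
  have gA: "g = h ** A" unfolding A_def by (simp add: matrix_mul_assoc invertible_inv[OF h])
  have invA: "invertible A" unfolding A_def using g h by (simp add: invertible_mult invertible_inv)
  have Asub: "act_lat A std \<subseteq> std"
    using sub unfolding gA act_lat_act[symmetric] by (simp add: act_subset_iff h)
  then have AO: "A $ i $ j \<in> \<O>" for i j by (rule integral_matrix)
  have nz: "det A \<noteq> 0" "det h \<noteq> 0" using invA h by (auto simp: invertible_det_nz)
  have dg: "\<nu> (det g) = \<nu> (det h) + \<nu> (det A)" using nz by (simp add: gA det_mul \<nu>_mult)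
  show "\<nu> (det h) \<le> \<nu> (det g)" using integral_det[of A] AO nz dg by (simp add: val_ring_def)
  assume "\<nu> (det h) = \<nu> (det g)"
  then have "std \<subseteq> act_lat A std" using dg nz AO by (intro integral_det_unit) auto
  then have "act_lat h std \<subseteq> act_lat h (act_lat A std)" by (rule act_mono)
  then show "act_lat g std = act_lat h std" using sub by (auto simp: gA act_lat_act)
qed

text \<open>Length relative to the standard lattice, which has value 0; smaller lattices have larger
  values. It replaces the index of one lattice in another: for nested lattices, differences of
  \<open>lval\<close> are lengths of quotients, and equal values mean equality.\<close>

definition lval :: "('a^'n::finite) set \<Rightarrow> int" where
  "lval L = \<nu> (det (SOME g. invertible g \<and> L = act_lat g std))"

lemma lval_act_std:
  assumes "invertible (g :: 'a^'n::finite^'n)"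
  shows "lval (act_lat g std) = \<nu> (det g)"
proof -
  define h where "h = (SOME h. invertible h \<and> act_lat g std = act_lat h std)"
  have h: "invertible h" "act_lat g std = act_lat h std"
    unfolding h_def using someI[of "\<lambda>h. invertible h \<and> act_lat g std = act_lat h std" g] assms by auto
  have "\<nu> (det h) = \<nu> (det g)"
    using act_std_subset(1)[of g h] act_std_subset(1)[of h g] assms h by auto
  then show ?thesis unfolding lval_def h_def .
qed

lemma lval_mono: "is_lattice \<nu> M \<Longrightarrow> is_lattice \<nu> L \<Longrightarrow> M \<subseteq> L \<Longrightarrow> lval L \<le> lval M"
  by (auto simp: is_lattice_iff lval_act_std intro: act_std_subset)

lemma lval_eq: "is_lattice \<nu> M \<Longrightarrow> is_lattice \<nu> L \<Longrightarrow> M \<subseteq> L \<Longrightarrow> lval M \<le> lval L \<Longrightarrow> M = L"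
  using act_std_subset lval_mono[of M L] by (fastforce simp: is_lattice_iff lval_act_std)

lemma lval_act: "invertible g \<Longrightarrow> is_lattice \<nu> L \<Longrightarrow> lval (act_lat g L) = lval L + \<nu> (det g)"
  by (auto simp: is_lattice_iff lval_act_std act_lat_act invertible_mult det_mul \<nu>_mult invertible_det_nz)

lemma lval_scale:
  fixes L :: "('a^'n::finite) set"
  shows "c \<noteq> 0 \<Longrightarrow> is_lattice \<nu> L \<Longrightarrow> lval (scale_set c L) = lval L + int CARD('n) * \<nu> c"
  by (simp add: scale_set_eq_act lval_act invertible_mat det_mat \<nu>_power)

lemma scale_subset:
  assumes "osub L" "c \<in> \<O>" shows "scale_set c L \<subseteq> L"
  using assms by (auto simp: scale_set_def intro: osub_scale)

lemma scale_unit: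
  assumes "is_lattice \<nu> L" "c \<noteq> 0" "\<nu> c = 0" shows "scale_set c L = L"
  using assms by (intro lval_eq lattice_scale scale_subset lattice_osub)
    (auto simp: lval_scale val_ring_def)

text \<open>An exchange step: \<open>\<pi> *s e\<close> has a unit coordinate in a basis of
  \<open>M\<close>, for otherwise \<open>e\<close> would lie in \<open>M\<close>. So
  \<open>e\<close> can replace that basis vector, and up to a unit the determinant loses one factor
  \<open>\<pi>\<close>.\<close>

lemma adjoin_lattice:
  fixes M :: "('a^'n::finite) set"
  assumes M: "is_lattice \<nu> M" and e: "e \<notin> M" "\<pi> *s e \<in> M"
  shows "is_lattice \<nu> (adjoin M e)" "lval (adjoin M e) = lval M - 1"
proof -
  obtain h where h: "invertible h" "M = act_lat h std" using M by (auto simp: is_lattice_iff)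
  obtain u where u: "\<pi> *s e = h *v u" "u \<in> std" using e(2) h by (auto simp: act_lat_def)
  have uO: "u $ i \<in> \<O>" for i using u(2) by (simp add: std_lattice_def)
  have "\<exists>k. u $ k \<noteq> 0 \<and> \<nu> (u $ k) = 0"
  proof (rule ccontr)
    assume *: "\<not> ?thesis"
    have "e = inverse \<pi> *s (h *v u)" unfolding u(1)[symmetric] by simp
    also have "\<dots> = h *v (inverse \<pi> *s u)" by (simp add: vector_scalar_commute)
    finally have "e = h *v (inverse \<pi> *s u)" .
    moreover have "inverse \<pi> *s u \<in> std"
      using * O_div_\<pi>[OF uO] by (auto simp: std_lattice_def divide_inverse mult.commute)
    ultimately show False using e(1) h by (auto simp: act_lat_def)
  qed
  then obtain k where k: "u $ k \<noteq> 0" "\<nu> (u $ k) = 0" by blast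
  \<comment> \<open>\<open>h'\<close> replaces the \<open>k\<close>-th basis vector of \<open>M\<close> by \<open>e\<close>.\<close>
  define h' :: "'a^'n^'n" where "h' = (\<chi> i j. if j = k then e $ i else h $ i $ j)"
  have "det (\<chi> i j. if j = k then (h *v u) $ i else h $ i $ j) = u $ k * det h"
    by (rule cramer_lemma)
  moreover have "det (\<chi> i j. if j = k then (h *v u) $ i else h $ i $ j) = \<pi> * det h'"
  proof -
    define D :: "'a^'n^'n" where "D = (\<chi> i j. if i = j then (if i = k then \<pi> else 1) else 0)"
    have "(\<chi> i j. if j = k then (h *v u) $ i else h $ i $ j) = h' ** D"
    proof -
      have "(\<Sum>l\<in>UNIV. h' $ i $ l * D $ l $ j)
          = (\<Sum>l\<in>UNIV. if l = j then h' $ i $ j * (if j = k then \<pi> else 1) else 0)" for i j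
        by (intro sum.cong) (auto simp: D_def)
      then show ?thesis
        unfolding u(1)[symmetric] by (simp add: vec_eq_iff matrix_matrix_mult_def) (simp add: h'_def)
    qed
    moreover have "det D = \<pi>" unfolding D_def by (subst det_diagonal) (auto simp: prod.delta)
    ultimately show ?thesis by (simp add: det_mul mult.commute)
  qed
  ultimately have d: "\<pi> * det h' = u $ k * det h" by simp
  have dh: "det h \<noteq> 0" using h(1) by (simp add: invertible_det_nz)
  have dh': "det h' \<noteq> 0" using d k dh by auto
  then have inv': "invertible h'" by (simp add: invertible_det_nz)
  have \<nu>d: "\<nu> (det h') = \<nu> (det h) - 1"
    using arg_cong[OF d, of \<nu>] dh dh' k by (simp add: \<nu>_mult)
  have h'x: "h' *v x = h *v (\<chi> j. if j = k then 0 else x $ j) + x $ k *s e" for x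
  proof -
    have "(\<Sum>j\<in>UNIV. (if j = k then e $ i else h $ i $ j) * x $ j)
        = (\<Sum>j\<in>UNIV. h $ i $ j * (if j = k then 0 else x $ j)) + x $ k * e $ i" for i
    proof -
      have "(\<Sum>j\<in>UNIV. (if j = k then e $ i else h $ i $ j) * x $ j)
        = (\<Sum>j\<in>UNIV. h $ i $ j * (if j = k then 0 else x $ j) + (if j = k then x $ k * e $ i else 0))"
        by (intro sum.cong) auto
      then show ?thesis by (simp add: sum.distrib)
    qed
    then show ?thesis by (simp add: vec_eq_iff matrix_vector_mult_def h'_def)
  qed
  have "act_lat h' std = adjoin M e"
  proof
    show "act_lat h' std \<subseteq> adjoin M e"
      unfolding adjoin_def h(2) act_lat_def by (auto simp: h'x std_lattice_def intro!: imageI exI)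
  next
    have os: "osub (act_lat h' std)" by (intro osub_act osub_std)
    have "h *v y \<in> act_lat h' std" if y: "y \<in> std" for y
    proof -
      \<comment> \<open>subtract the multiple of \<open>h *v u = \<pi> *s e\<close> that clears the \<open>k\<close>-th coordinate\<close>
      define a where "a = y $ k / u $ k"
      have aO: "a \<in> \<O>" using y k by (auto simp: a_def std_lattice_def intro: O_divide)
      define x where "x = (\<chi> j. if j = k then a * \<pi> else (y - a *s u) $ j)"
      have "x \<in> std" using aO y uO by (auto simp: x_def std_lattice_def intro: O_mult O_diff)
      moreover have "h' *v x = h *v y"
      proof -
        have "(\<chi> j. if j = k then 0 else x $ j) = y - a *s u"
          using k by (auto simp: x_def vec_eq_iff a_def)
        then have "h' *v x = h *v (y - a *s u) + (a * \<pi>) *s e" by (simp add: h'x) (simp add: x_def)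
        also have "(a * \<pi>) *s e = h *v (a *s u)"
          unfolding vector_smult_assoc[symmetric] u(1) by (rule vector_scalar_commute[symmetric])
        finally show ?thesis unfolding matrix_vector_right_distrib[symmetric] by simp
      qed
      ultimately show ?thesis by (metis act_lat_def imageI)
    qed
    then have "M \<subseteq> act_lat h' std" unfolding h(2) by (auto simp: act_lat_def)
    moreover have "e \<in> act_lat h' std"
    proof -
      have "(\<chi> j. if j = k then 0 else axis k 1 $ j) = (0 :: 'a^'n)" by (auto simp: vec_eq_iff axis_def)
      then have "h' *v axis k 1 = e" by (simp add: h'x)
      moreover have "axis k 1 \<in> std" by (auto simp: std_lattice_def axis_def)
      ultimately show ?thesis by (metis act_lat_def imageI)
    qed
    ultimately show "adjoin M e \<subseteq> act_lat h' std" using os adjoin_least by blast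
  qed
  then show "is_lattice \<nu> (adjoin M e)" "lval (adjoin M e) = lval M - 1"
    using inv' h \<nu>d by (metis is_lattice_iff, metis lval_act_std)
qed

lemma lattice_absorbs:
  fixes M :: "('a^'n::finite) set"
  assumes "is_lattice \<nu> M" shows "\<exists>k. \<pi> ^ k *s x \<in> M"
proof -
  obtain h where h: "invertible h" "M = act_lat h std" using assms by (auto simp: is_lattice_iff)
  obtain k where k: "\<And>i. \<pi> ^ k * (matrix_inv h *v x) $ i \<in> \<O>"
    using clear_denominators[of "\<lambda>i. (matrix_inv h *v x) $ i"] by blast
  have "\<pi> ^ k *s (matrix_inv h *v x) \<in> std" using k by (simp add: std_lattice_def)
  moreover have "h *v (\<pi> ^ k *s (matrix_inv h *v x)) = \<pi> ^ k *s x"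
    by (simp add: vector_scalar_commute matrix_vector_mul_assoc invertible_inv[OF h(1)])
  ultimately show ?thesis using h(2) by (metis act_lat_def imageI)
qed

lemma step_exists:
  fixes M :: "('a^'n::finite) set"
  assumes M: "is_lattice \<nu> M" and L: "osub L" and x: "x \<in> L" "x \<notin> M"
  shows "\<exists>e\<in>L. e \<notin> M \<and> \<pi> *s e \<in> M"
proof -
  obtain k where k: "\<pi> ^ k *s x \<in> M" "\<And>j. j < k \<Longrightarrow> \<pi> ^ j *s x \<notin> M"
    using lattice_absorbs[OF M, of x] exists_least_iff[of "\<lambda>k. \<pi> ^ k *s x \<in> M"] by blast
  have "k \<noteq> 0" using k(1) x(2) by (intro notI) simp
  then obtain j where j: "k = Suc j" by (cases k) auto
  have "\<pi> ^ j *s x \<in> L" using L x \<pi>_power_in_O by (simp add: osub_scale)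
  moreover have "\<pi> ^ j *s x \<notin> M" using k(2)[of j] j by simp
  moreover have "\<pi> *s (\<pi> ^ j *s x) \<in> M" using k(1) j by simp
  ultimately show ?thesis by blast
qed

text \<open>Replaces the freeness of submodules of a free module over a principal ideal domain: from
  \<open>A\<close> one climbs inside \<open>M\<close> by adjoining single vectors, and
  \<open>lval B\<close> bounds the number of steps.\<close>

lemma squeezed_lattice:
  assumes "is_lattice \<nu> A" "is_lattice \<nu> B" "osub M" "A \<subseteq> M" "M \<subseteq> B"
  shows "is_lattice \<nu> M"
  using assms
proof (induction "nat (lval A - lval B)" arbitrary: A rule: less_induct)
  case less
  show ?case
  proof (cases "M \<subseteq> A")
    case True
    then show ?thesis using less.prems by (metis subset_antisym)
  next
    case False
    then obtain e where e: "e \<in> M" "e \<notin> A" "\<pi> *s e \<in> A"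
      using step_exists[OF less.prems(1,3)] by blast
    have sub: "adjoin A e \<subseteq> M" using e less.prems by (intro adjoin_least)
    have *: "is_lattice \<nu> (adjoin A e)" "lval (adjoin A e) = lval A - 1"
      using adjoin_lattice[OF less.prems(1)] e by auto
    have "lval B \<le> lval A - 1" using lval_mono[OF *(1) less.prems(2)] sub less.prems(5) * by auto
    then show ?thesis
      using less.hyps[OF _ *(1) less.prems(2,3) sub less.prems(5)] * by auto
  qed
qed

lemma scaled_subset:
  fixes L M :: "('a^'n::finite) set"
  assumes L: "is_lattice \<nu> L" and M: "is_lattice \<nu> M"
  shows "\<exists>k. scale_set (\<pi> ^ k) L \<subseteq> M"
proof -
  obtain h where h: "invertible h" "L = act_lat h std" using L by (auto simp: is_lattice_iff)
  have "\<forall>i. \<exists>k. \<pi> ^ k *s column i h \<in> M" using lattice_absorbs[OF M] by blast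
  then obtain k where "\<forall>i. \<pi> ^ k i *s column i h \<in> M"
    using choice[of "\<lambda>i k. \<pi> ^ k *s column i h \<in> M"] by blast
  then have k: "\<pi> ^ k i *s column i h \<in> M" for i by blast
  define K where "K = (\<Sum>i\<in>UNIV. k i)"
  have K: "\<pi> ^ K *s column i h \<in> M" for i
  proof -
    have "K = (\<Sum>j\<in>UNIV-{i}. k j) + k i" by (simp add: K_def sum.remove[of UNIV i])
    then have "\<pi> ^ K *s column i h = \<pi> ^ (\<Sum>j\<in>UNIV-{i}. k j) *s (\<pi> ^ k i *s column i h)"
      by (simp add: power_add)
    then show ?thesis using osub_scale[OF lattice_osub[OF M] \<pi>_power_in_O k] by metis
  qed
  have "\<pi> ^ K *s (h *v y) \<in> M" if "y \<in> std" for y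
  proof -
    have "\<pi> ^ K *s (h *v y) = (\<Sum>i\<in>UNIV. y $ i *s (\<pi> ^ K *s column i h))"
      unfolding matrix_mult_sum by (simp add: vec.scale_sum_right mult.commute)
    moreover have "(\<Sum>i\<in>UNIV. y $ i *s (\<pi> ^ K *s column i h)) \<in> M"
      by (intro osub_sum osub_scale K lattice_osub M) (use that in \<open>simp add: std_lattice_def\<close>)
    ultimately show ?thesis by metis
  qed
  then show ?thesis by (intro exI[of _ K]) (auto simp: scale_set_def h(2) act_lat_def)
qed

lemma lattice_Int:
  fixes L M :: "('a^'n::finite) set"
  assumes L: "is_lattice \<nu> L" and M: "is_lattice \<nu> M" shows "is_lattice \<nu> (L \<inter> M)"
proof -
  obtain k where k: "scale_set (\<pi> ^ k) L \<subseteq> M" using scaled_subset[OF assms] by blast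
  have "scale_set (\<pi> ^ k) L \<subseteq> L" using scale_subset[OF lattice_osub[OF L] \<pi>_power_in_O] .
  then show ?thesis
    using k L M by (intro squeezed_lattice[OF lattice_scale[OF _ L, of "\<pi> ^ k"] L])
      (auto intro: osub_Int lattice_osub)
qed

end

section \<open>Lattices between two lattices\<close>

context discrete_valued_field
begin

text \<open>When \<open>\<pi>\<close> kills \<open>A / B\<close>, these are the hyperplanes of that
  vector space over the residue field: the points of a projective line if \<open>B\<close> lies two
  steps under \<open>A\<close>, the lines of a projective plane if it lies three steps under
  \<open>A\<close>.\<close>

definition Btw :: "('a^'n::finite) set \<Rightarrow> ('a^'n) set \<Rightarrow> ('a^'n) set set" where
  "Btw A B = {M. is_lattice \<nu> M \<and> B \<subseteq> M \<and> M \<subseteq> A \<and> lval M = lval A + 1}"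

lemma step_adjoin:
  assumes M: "is_lattice \<nu> M" and L: "is_lattice \<nu> L" and sub: "M \<subseteq> L" and v: "lval M = lval L + 1"
    and e: "e \<in> L" "e \<notin> M"
  shows "\<pi> *s e \<in> M" "adjoin M e = L"
proof -
  have eqL: "adjoin M u = L" if "u \<in> L" "u \<notin> M" "\<pi> *s u \<in> M" for u
    using adjoin_lattice[OF M that(2,3)] v that
    by (intro lval_eq L adjoin_least lattice_osub sub) auto
  \<comment> \<open>It is not yet known that \<open>\<pi> *s e\<close> lies in \<open>M\<close>. An
    auxiliary vector with this property generates \<open>L\<close> over \<open>M\<close>, and
    expressing \<open>e\<close> through it transfers the property to \<open>e\<close>.\<close>
  obtain e0 where e0: "e0 \<in> L" "e0 \<notin> M" "\<pi> *s e0 \<in> M"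
    using step_exists[OF M lattice_osub[OF L] e] by blast
  then obtain x c where x: "e = x + c *s e0" "x \<in> M" "c \<in> \<O>"
    using eqL[OF e0] e(1) by (auto simp: adjoin_def)
  have "\<pi> *s e = \<pi> *s x + c *s (\<pi> *s e0)" by (simp add: x(1) mult.commute)
  then show pe: "\<pi> *s e \<in> M"
    using osub_add osub_scale lattice_osub[OF M] x e0 O_\<pi> by metis
  then show "adjoin M e = L" using eqL e by blast
qed

lemma distinct_not_subset:
  assumes "is_lattice \<nu> M" "is_lattice \<nu> M'" "lval M = lval M'" "M \<noteq> M'"
  shows "\<exists>e\<in>M. e \<notin> M'"
  using assms lval_eq[of M M'] by auto

text \<open>A vector of \<open>M\<close> outside \<open>M'\<close> generates \<open>A\<close> over
  \<open>M'\<close>; by the modular law it also generates \<open>M\<close> over the intersection,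
  which therefore lies one step under \<open>M\<close>.\<close>

lemma Int_of_maximal:
  fixes A :: "('a^'n::finite) set"
  assumes A: "is_lattice \<nu> A" and M: "M \<in> Btw A C" and M': "M' \<in> Btw A C" and ne: "M \<noteq> M'"
  shows "is_lattice \<nu> (M \<inter> M')" "lval (M \<inter> M') = lval A + 2"
proof -
  have lat: "is_lattice \<nu> M" "is_lattice \<nu> M'" "M \<subseteq> A" "M' \<subseteq> A" "lval M = lval A + 1" "lval M' = lval A + 1"
    using M M' by (auto simp: Btw_def)
  then show I: "is_lattice \<nu> (M \<inter> M')" by (intro lattice_Int)
  obtain e where e: "e \<in> M" "e \<notin> M'" using distinct_not_subset[of M M'] lat ne by auto
  have st: "\<pi> *s e \<in> M'" "adjoin M' e = A" using step_adjoin[of M' A e] A lat e by auto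
  have pe: "\<pi> *s e \<in> M \<inter> M'" using st osub_scale[OF lattice_osub[OF lat(1)] O_\<pi> e(1)] by simp
  have "M \<subseteq> adjoin (M \<inter> M') e"
  proof
    fix x assume x: "x \<in> M"
    then obtain y c where y: "x = y + c *s e" "y \<in> M'" "c \<in> \<O>" using lat st by (auto simp: adjoin_def)
    moreover have "y = x - c *s e" using y by simp
    then have "y \<in> M" using x e y osub_diff osub_scale lattice_osub[OF lat(1)] by metis
    ultimately show "x \<in> adjoin (M \<inter> M') e" by (auto simp: adjoin_def)
  qed
  moreover have "adjoin (M \<inter> M') e \<subseteq> M" using lat e by (intro adjoin_least lattice_osub) auto
  ultimately have "adjoin (M \<inter> M') e = M" by auto
  then show "lval (M \<inter> M') = lval A + 2"
    using adjoin_lattice(2)[OF I _ pe] e lat by simp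
qed

text \<open>\<open>J\<close> is the sum of \<open>N\<close> and \<open>N'\<close>, obtained by
  adjoining one vector of \<open>N'\<close> to \<open>N\<close>. Its minimality is what makes it
  unique between given bounds.\<close>

lemma sum_of_minimal:
  fixes C :: "('a^'n::finite) set"
  assumes C: "is_lattice \<nu> C" "C \<subseteq> N" "C \<subseteq> N'" and N: "is_lattice \<nu> N" "is_lattice \<nu> N'"
    and v: "lval C = lval N + 1" "lval N' = lval N" and ne: "N \<noteq> N'"
  shows "\<exists>J. is_lattice \<nu> J \<and> lval J = lval N - 1 \<and> N \<subseteq> J \<and> N' \<subseteq> J \<and>
           (\<forall>K. osub K \<longrightarrow> N \<subseteq> K \<longrightarrow> N' \<subseteq> K \<longrightarrow> J \<subseteq> K)"
proof -
  obtain e where e: "e \<in> N'" "e \<notin> N" using distinct_not_subset[of N' N] N v ne by auto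
  have "e \<notin> C" using e C by auto
  then have st: "\<pi> *s e \<in> C" "adjoin C e = N'" using step_adjoin[of C N' e] N C v e by auto
  then have pe: "\<pi> *s e \<in> N" using C by auto
  have "N' \<subseteq> adjoin N e" unfolding st(2)[symmetric] using C by (auto simp: adjoin_def)
  then show ?thesis
    using adjoin_lattice[OF N(1) e(2) pe] adjoin_superset[of N e] e(1) adjoin_least[of _ N e]
    by (intro exI[of _ "adjoin N e"]) blast
qed

end

section \<open>Counting in projective lines and planes over the residue field\<close>

locale local_field = discrete_valued_field +
  fixes q :: nat
  assumes finite_residue: "finite (residue_field \<nu>)" and card_residue: "card (residue_field \<nu>) = q"
begin

lemma equiv_residue: "equiv \<O> (residue_rel \<nu>)"
proof (rule equivI)
  have rel: "(x, y) \<in> residue_rel \<nu> \<longleftrightarrow> x \<in> \<O> \<and> y \<in> \<O> \<and> (x - y) / \<pi> \<in> \<O>" for x y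
    by (cases "x = y") (auto simp: residue_rel_def val_ring_def \<nu>_divide)
  show "residue_rel \<nu> \<subseteq> \<O> \<times> \<O>" by (auto simp: residue_rel_def)
  show "refl_on \<O> (residue_rel \<nu>)" by (auto simp: refl_on_def residue_rel_def)
  show "sym (residue_rel \<nu>)"
  proof (rule symI)
    fix x y assume "(x, y) \<in> residue_rel \<nu>"
    then show "(y, x) \<in> residue_rel \<nu>" using O_minus[of "(x - y) / \<pi>"] by (simp add: rel minus_divide_left)
  qed
  show "trans (residue_rel \<nu>)"
  proof (rule transI)
    fix x y z assume "(x, y) \<in> residue_rel \<nu>" "(y, z) \<in> residue_rel \<nu>"
    then show "(x, z) \<in> residue_rel \<nu>"
      using O_add[of "(x - y) / \<pi>" "(y - z) / \<pi>"] by (simp add: rel add_divide_distrib[symmetric])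
  qed
qed

text \<open>The projective line \<open>A / B\<close> in coordinates: \<open>M0\<close>, spanned by
  \<open>e1\<close>, is the point at infinity, and the other points are spanned by
  \<open>e2 + a *s e1\<close>, where only the residue class of \<open>a\<close> matters.\<close>

lemma card_Btw:
  fixes A B :: "('a^'n::finite) set"
  assumes A: "is_lattice \<nu> A" and B: "is_lattice \<nu> B" and \<pi>A: "scale_set \<pi> A \<subseteq> B"
    and v: "lval B = lval A + 2" and M0: "M0 \<in> Btw A B"
  shows "finite (Btw A B)" "card (Btw A B) = q + 1"
proof -
  note osA = lattice_osub[OF A] and osB = lattice_osub[OF B]
  have lat0: "is_lattice \<nu> M0" "B \<subseteq> M0" "M0 \<subseteq> A" "lval M0 = lval A + 1"
    using M0 by (auto simp: Btw_def)
  have os0: "osub M0" by (rule lattice_osub[OF lat0(1)])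
  have pA: "\<pi> *s x \<in> B" if "x \<in> A" for x using that \<pi>A by (auto simp: scale_set_def)
  \<comment> \<open>Non-units act as 0 on \<open>A / B\<close>.\<close>
  have pB: "c *s x \<in> B" if x: "x \<in> A" and c: "c \<in> \<O>" "c = 0 \<or> \<nu> c \<noteq> 0" for c x
  proof -
    have "(c / \<pi>) *s (\<pi> *s x) = c *s x" by simp
    then show ?thesis using osub_scale[OF osB O_div_\<pi>[OF c] pA[OF x]] by metis
  qed
  have "\<not> M0 \<subseteq> B"
  proof
    assume "M0 \<subseteq> B"
    from lval_mono[OF lat0(1) B this] lat0(4) v show False by simp
  qed
  then obtain e1 where e1: "e1 \<in> M0" "e1 \<notin> B" by auto
  have "\<not> A \<subseteq> M0"
  proof
    assume "A \<subseteq> M0"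
    from lval_mono[OF A lat0(1) this] lat0(4) show False by simp
  qed
  then obtain e2 where e2: "e2 \<in> A" "e2 \<notin> M0" by auto
  have M0eq: "adjoin B e1 = M0" using step_adjoin(2)[OF B lat0(1,2) _ e1] lat0 v by simp
  have Aeq: "adjoin M0 e2 = A" using step_adjoin(2)[OF lat0(1) A lat0(3) _ e2] lat0 by simp
  have e1A: "e1 \<in> A" using e1 lat0 by auto
  define Ma where "Ma a = adjoin B (e2 + a *s e1)" for a
  have nM0: "e2 + a *s e1 \<notin> M0" if "a \<in> \<O>" for a
  proof
    assume "e2 + a *s e1 \<in> M0"
    from osub_diff[OF os0 this osub_scale[OF os0 that e1(1)]] show False using e2 by simp
  qed
  have inA: "e2 + a *s e1 \<in> A" if "a \<in> \<O>" for a
    using that osub_add[OF osA e2(1) osub_scale[OF osA that e1A]] by simp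
  have Ma: "Ma a \<in> Btw A B" if a: "a \<in> \<O>" for a
  proof -
    have "e2 + a *s e1 \<notin> B" using nM0[OF a] lat0 by auto
    from adjoin_lattice[OF B this pA[OF inA[OF a]]]
    show ?thesis using v adjoin_least[OF osA _ inA[OF a], of B] lat0
      by (auto simp: Btw_def Ma_def adjoin_superset)
  qed
  have Ma_mem: "e2 + a *s e1 \<in> Ma a" for a unfolding Ma_def by (rule adjoin_mem[OF osB])
  have Ma_eq: "Ma a = Ma b \<longleftrightarrow> (a, b) \<in> residue_rel \<nu>" if a: "a \<in> \<O>" and b: "b \<in> \<O>" for a b
  proof
    assume eq: "Ma a = Ma b"
    have os: "osub (Ma a)" using osub_adjoin[OF osB] by (simp add: Ma_def)
    show "(a, b) \<in> residue_rel \<nu>"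
    proof (rule ccontr)
      assume "(a, b) \<notin> residue_rel \<nu>"
      then have ab: "a - b \<noteq> 0" "\<nu> (a - b) = 0"
        using a b O_diff[OF a b] by (auto simp: residue_rel_def val_ring_def)
      have "(e2 + a *s e1) - (e2 + b *s e1) \<in> Ma a"
        by (rule osub_diff[OF os Ma_mem]) (use Ma_mem[of b] eq in simp)
      then have "(a - b) *s e1 \<in> Ma a" by (simp add: vector_sub_rdistrib)
      moreover have "(1 / (a - b)) *s ((a - b) *s e1) = e1"
        using ab by (simp del: vector_sub_rdistrib)
      ultimately have e1a: "e1 \<in> Ma a"
        using osub_scale[OF os O_divide[OF O_1 ab], of "(a - b) *s e1"] by metis
      have "(e2 + a *s e1) - a *s e1 \<in> Ma a" by (intro osub_diff[OF os Ma_mem] osub_scale[OF os a e1a])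
      then have e2a: "e2 \<in> Ma a" by simp
      have "M0 \<subseteq> Ma a" unfolding M0eq[symmetric]
        using os e1a by (intro adjoin_least) (auto simp: Ma_def adjoin_superset)
      then have "A \<subseteq> Ma a" unfolding Aeq[symmetric] using os e2a by (intro adjoin_least)
      then show False using Ma[OF a] lval_mono[OF A, of "Ma a"] by (auto simp: Btw_def)
    qed
  next
    have *: "Ma a \<subseteq> Ma b" if ab: "(a, b) \<in> residue_rel \<nu>" for a b
    proof -
      have O: "a \<in> \<O>" "b \<in> \<O>" using ab by (auto simp: residue_rel_def)
      have os: "osub (Ma b)" using osub_adjoin[OF osB] by (simp add: Ma_def)
      have "(a - b) *s e1 \<in> B"
        using ab O_diff[OF O] by (intro pB e1A) (auto simp: residue_rel_def)
      then have "(a - b) *s e1 \<in> Ma b" using adjoin_superset by (auto simp: Ma_def)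
      then have "(e2 + b *s e1) + (a - b) *s e1 \<in> Ma b" by (intro osub_add[OF os Ma_mem])
      then have "e2 + a *s e1 \<in> Ma b" by (simp add: vector_sub_rdistrib)
      then show ?thesis unfolding Ma_def[of a]
        using os by (intro adjoin_least) (auto simp: Ma_def adjoin_superset)
    qed
    assume ab: "(a, b) \<in> residue_rel \<nu>"
    then have "(b, a) \<in> residue_rel \<nu>" using equiv_residue by (meson equivE symE)
    then show "Ma a = Ma b" using * ab by blast
  qed
  have exh: "M \<in> insert M0 (Ma ` \<O>)" if M: "M \<in> Btw A B" for M
  proof (cases "M = M0")
    case False
    have lat: "is_lattice \<nu> M" "B \<subseteq> M" "M \<subseteq> A" "lval M = lval A + 1"
      using M by (auto simp: Btw_def)
    obtain x where x: "x \<in> M" "x \<notin> M0"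
      using distinct_not_subset[of M M0] lat lat0 False by auto
    then obtain y a2 where y: "x = y + a2 *s e2" "y \<in> M0" "a2 \<in> \<O>"
      using lat Aeq by (auto simp: adjoin_def)
    then obtain b a1 where b: "y = b + a1 *s e1" "b \<in> B" "a1 \<in> \<O>"
      using M0eq by (auto simp: adjoin_def)
    \<comment> \<open>Were \<open>a2\<close> a non-unit, \<open>a2 *s e2\<close> would lie in
      \<open>B\<close>, and \<open>x\<close> in \<open>M0\<close>.\<close>
    have unit: "a2 \<noteq> 0" "\<nu> a2 = 0"
    proof -
      have "a2 \<noteq> 0 \<and> \<nu> a2 = 0"
      proof (rule ccontr)
        assume "\<not> ?thesis"
        then have "a2 *s e2 \<in> M0" using pB[OF e2(1) y(3)] lat0 by auto
        then show False using x y osub_add[OF os0] by simp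
      qed
      then show "a2 \<noteq> 0" "\<nu> a2 = 0" by auto
    qed
    define a where "a = a1 / a2"
    have a: "a \<in> \<O>" using b unit by (simp add: a_def O_divide)
    have os: "osub M" by (rule lattice_osub[OF lat(1)])
    have "(1 / a2) *s (x - b) \<in> M"
      using lat b x unit by (intro osub_scale[OF os] osub_diff[OF os] O_divide) auto
    moreover have "(1 / a2) *s (x - b) = e2 + a *s e1"
      using unit by (simp add: y(1) b(1) a_def)
    ultimately have "e2 + a *s e1 \<in> M" by simp
    then have "Ma a \<subseteq> M" unfolding Ma_def using lat os by (intro adjoin_least)
    then have "Ma a = M" using Ma[OF a] lat by (intro lval_eq) (auto simp: Btw_def)
    then show ?thesis using a by blast
  qed simp
  have Btw_eq: "Btw A B = insert M0 (Ma ` \<O>)" using exh Ma M0 by blast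
  have M0n: "M0 \<notin> Ma ` \<O>" using nM0 Ma_mem by (metis imageE)
  \<comment> \<open>By \<open>Ma_eq\<close>, \<open>Ma\<close> is constant on each residue class and
    separates distinct classes; \<open>the_elem\<close> picks its single value on a class.\<close>
  have "bij_betw (\<lambda>X. the_elem (Ma ` X)) (residue_field \<nu>) (Ma ` \<O>)"
  proof -
    have img: "the_elem (Ma ` X) = Ma a" if "a \<in> X" "X \<in> residue_field \<nu>" for a X
    proof -
      have "\<forall>b\<in>X. Ma b = Ma a"
      proof
        fix b assume "b \<in> X"
        then have ba: "(b, a) \<in> residue_rel \<nu>"
          using that quotient_eq_iff[OF equiv_residue, of X X b a] by (auto simp: residue_field_def)
        then show "Ma b = Ma a" using Ma_eq by (auto simp: residue_rel_def)
      qed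
      then have "Ma ` X = {Ma a}" using that(1) by blast
      then show ?thesis by simp
    qed
    show ?thesis
    proof (rule bij_betwI')
      fix X Y assume X: "X \<in> residue_field \<nu>" and Y: "Y \<in> residue_field \<nu>"
      obtain a where a: "a \<in> X" "a \<in> \<O>" using X equiv_residue
        by (metis residue_field_def in_quotient_imp_non_empty in_quotient_imp_subset ex_in_conv subsetD)
      obtain b where b: "b \<in> Y" "b \<in> \<O>" using Y equiv_residue
        by (metis residue_field_def in_quotient_imp_non_empty in_quotient_imp_subset ex_in_conv subsetD)
      show "the_elem (Ma ` X) = the_elem (Ma ` Y) \<longleftrightarrow> X = Y"
        unfolding img[OF a(1) X] img[OF b(1) Y] Ma_eq[OF a(2) b(2)]
        using quotient_eq_iff[OF equiv_residue, of X Y a b] X Y a b by (auto simp: residue_field_def)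
    next
      fix X assume X: "X \<in> residue_field \<nu>"
      obtain a where a: "a \<in> X" "a \<in> \<O>" using X equiv_residue
        by (metis residue_field_def in_quotient_imp_non_empty in_quotient_imp_subset ex_in_conv subsetD)
      then show "the_elem (Ma ` X) \<in> Ma ` \<O>" using img[OF a(1) X] by auto
    next
      fix M assume "M \<in> Ma ` \<O>"
      then obtain a where a: "a \<in> \<O>" "M = Ma a" by auto
      have "residue_rel \<nu> `` {a} \<in> residue_field \<nu>"
        unfolding residue_field_def by (rule quotientI[OF a(1)])
      moreover have "a \<in> residue_rel \<nu> `` {a}" using a by (simp add: residue_rel_def)
      ultimately
      show "\<exists>X\<in>residue_field \<nu>. M = the_elem (Ma ` X)"
        using img[of a "residue_rel \<nu> `` {a}"] a(2) by (intro bexI[of _ "residue_rel \<nu> `` {a}"]) simp_all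
    qed
  qed
  then have "card (Ma ` \<O>) = q" "finite (Ma ` \<O>)"
    using finite_residue card_residue bij_betw_same_card bij_betw_finite by metis+
  then show "finite (Btw A B)" "card (Btw A B) = q + 1"
    unfolding Btw_eq using M0n by simp_all
qed

text \<open>The sum of \<open>N\<close> and \<open>B\<close> lies one step under \<open>A\<close>
  and inside every \<open>M\<close> that is counted, so it equals each of them.\<close>

lemma card_over:
  fixes A B C :: "('a^'n::finite) set"
  assumes A: "is_lattice \<nu> A" and C: "is_lattice \<nu> C" "lval C = lval A + 3"
    and B: "is_lattice \<nu> B" "C \<subseteq> B" "lval B = lval A + 2" and BA: "B \<subseteq> A"
    and N: "is_lattice \<nu> N" "C \<subseteq> N" "N \<subseteq> A" "lval N = lval A + 2" and ne: "N \<noteq> B"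
  shows "card {M \<in> Btw A B. N \<subseteq> M} = 1"
proof -
  obtain J where J: "is_lattice \<nu> J" "lval J = lval N - 1" "N \<subseteq> J" "B \<subseteq> J"
      "\<And>K. osub K \<Longrightarrow> N \<subseteq> K \<Longrightarrow> B \<subseteq> K \<Longrightarrow> J \<subseteq> K"
    using sum_of_minimal[of C N B] assms by auto
  have "J = M" if "M \<in> Btw A B" "N \<subseteq> M" for M
    using that J N by (intro lval_eq J(5) lattice_osub) (auto simp: Btw_def)
  moreover have "J \<in> Btw A B" using J N A BA lattice_osub[OF A] by (auto simp: Btw_def)
  ultimately have "{M \<in> Btw A B. N \<subseteq> M} = {J}" using J(3) by blast
  then show ?thesis by simp
qed

lemma card_under:
  fixes A M0 C :: "('a^'n::finite) set"
  assumes A: "is_lattice \<nu> A" and C: "is_lattice \<nu> C" "lval C = lval A + 3"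
    and M0: "M0 \<in> Btw A C" and M: "M \<in> Btw A C" and ne: "M \<noteq> M0"
  shows "card {N \<in> Btw M0 C. N \<subseteq> M} = 1"
proof -
  note I = Int_of_maximal[OF A M M0 ne]
  have "N = M \<inter> M0" if "N \<in> Btw M0 C" "N \<subseteq> M" for N
    using I M0 that by (intro lval_eq I(1)) (auto simp: Btw_def)
  moreover have "M \<inter> M0 \<in> Btw M0 C" using I M M0 by (auto simp: Btw_def)
  ultimately have "{N \<in> Btw M0 C. N \<subseteq> M} = {M \<inter> M0}" by blast
  then show ?thesis by simp
qed

text \<open>In the projective plane \<open>A / C\<close>, both sides count all incident pairs \<open>(M, N)\<close>: two distinct
  lines meet in one point, two distinct points span one line.\<close>

lemma Btw_braid:
  fixes A B C M0 :: "('a^'n::finite) set" and G :: "('a^'n) set \<Rightarrow> ('a^'n) set \<Rightarrow> real"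
  assumes A: "is_lattice \<nu> A" and C: "is_lattice \<nu> C" "lval C = lval A + 3" "scale_set \<pi> A \<subseteq> C"
    and M0: "M0 \<in> Btw A B" and B: "B \<in> Btw M0 C"
  shows "(\<Sum>M1\<in>Btw A B. \<Sum>N\<in>Btw M1 C. \<Sum>M\<in>Btw A N. G M N) - real q * (\<Sum>M\<in>Btw A B. G M B)
       = (\<Sum>N1\<in>Btw M0 C. \<Sum>M\<in>Btw A N1. \<Sum>N\<in>Btw M C. G M N) - real q * (\<Sum>N\<in>Btw M0 C. G M0 N)"
proof -
  define \<M> where "\<M> = Btw A C"
  define \<N> where "\<N> = {N. is_lattice \<nu> N \<and> C \<subseteq> N \<and> N \<subseteq> A \<and> lval N = lval A + 2}"
  have lB: "is_lattice \<nu> B" "C \<subseteq> B" "B \<subseteq> M0" "lval B = lval A + 2"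
    and lM0: "is_lattice \<nu> M0" "M0 \<subseteq> A" "lval M0 = lval A + 1"
    using B M0 by (auto simp: Btw_def)
  have BN: "B \<in> \<N>" and MM: "M0 \<in> \<M>" using lB lM0 by (auto simp: \<N>_def \<M>_def Btw_def)
  have \<pi>sub: "scale_set \<pi> M \<subseteq> C" if "M \<subseteq> A" for M
    using that C(3) by (auto simp: scale_set_def)
  have below: "Btw M C = {N\<in>\<N>. N \<subseteq> M}" if "M \<in> \<M>" for M
    using that by (auto simp: \<M>_def \<N>_def Btw_def)
  have above: "Btw A N = {M\<in>\<M>. N \<subseteq> M}" if "N \<in> \<N>" for N
    using that by (auto simp: \<M>_def \<N>_def Btw_def)
  have exM: "\<exists>N. N \<in> Btw M C" if "M \<in> \<M>" for M
  proof (cases "M = M0")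
    case False
    have M: "M \<in> Btw A C" "M0 \<in> Btw A C" using that MM by (auto simp: \<M>_def)
    then show ?thesis using Int_of_maximal[OF A M False]
      by (intro exI[of _ "M \<inter> M0"]) (auto simp: Btw_def)
  qed (use B in auto)
  have exN: "\<exists>M. M \<in> Btw A N" if "N \<in> \<N>" for N
  proof (cases "N = B")
    case False
    have "card {M \<in> Btw A B. N \<subseteq> M} = 1"
      using that lB lM0 C A False by (intro card_over[of A C B N]) (auto simp: \<N>_def)
    then obtain M where "M \<in> Btw A B" "N \<subseteq> M" by (metis (no_types, lifting) card.empty mem_Collect_eq equals0I zero_neq_one)
    then show ?thesis by (auto simp: Btw_def)
  qed (use M0 in auto)
  have cA: "finite (Btw A N) \<and> card (Btw A N) = q + 1" if N: "N \<in> \<N>" for N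
  proof -
    obtain M where M: "M \<in> Btw A N" using exN[OF N] by blast
    have lN: "is_lattice \<nu> N" "lval N = lval A + 2" "scale_set \<pi> A \<subseteq> N" using N C by (auto simp: \<N>_def)
    show ?thesis using card_Btw[OF A lN(1,3,2) M] by simp
  qed
  have cB: "finite (Btw M C) \<and> card (Btw M C) = q + 1" if M: "M \<in> \<M>" for M
  proof -
    obtain N where N: "N \<in> Btw M C" using exM[OF M] by blast
    have lM: "is_lattice \<nu> M" "lval C = lval M + 2" "scale_set \<pi> M \<subseteq> C"
      using M C \<pi>sub by (auto simp: \<M>_def Btw_def)
    show ?thesis using card_Btw[OF lM(1) C(1) lM(3,2) N] by simp
  qed
  \<comment> \<open>Finiteness of the plane: every other line meets \<open>M0\<close> in one of its
    finitely many points, and each point lies on finitely many lines.\<close>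
  have "\<M> \<subseteq> {M0} \<union> (\<Union>N\<in>Btw M0 C. Btw A N)"
  proof
    fix M assume M: "M \<in> \<M>"
    show "M \<in> {M0} \<union> (\<Union>N\<in>Btw M0 C. Btw A N)"
    proof (cases "M = M0")
      case False
      have M': "M \<in> Btw A C" "M0 \<in> Btw A C" using M MM by (auto simp: \<M>_def)
      have "M \<inter> M0 \<in> Btw M0 C" "M \<in> Btw A (M \<inter> M0)"
        using Int_of_maximal[OF A M' False] M' by (auto simp: Btw_def)
      then show ?thesis by blast
    qed simp
  qed
  moreover have "finite (Btw A N)" if "N \<in> Btw M0 C" for N
    using that cA below[OF MM] by auto
  ultimately have finM: "finite \<M>" using cB[OF MM] by (auto intro: finite_subset)
  have "\<N> \<subseteq> (\<Union>M\<in>\<M>. Btw M C)"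
  proof
    fix N assume N: "N \<in> \<N>"
    then obtain M where "M \<in> Btw A N" using exN by blast
    then have "M \<in> \<M>" "N \<subseteq> M" using above[OF N] by auto
    then show "N \<in> (\<Union>M\<in>\<M>. Btw M C)" using below N by auto
  qed
  then have finN: "finite \<N>" using finM cB by (auto intro: finite_subset)
  define H where "H N = (\<Sum>M\<in>{M\<in>\<M>. N \<subseteq> M}. G M N)" for N
  define K where "K M = (\<Sum>N\<in>{N\<in>\<N>. N \<subseteq> M}. G M N)" for M
  have sub1: "Btw A B \<subseteq> \<M>" and sub2: "Btw M0 C \<subseteq> \<N>" using above[OF BN] below[OF MM] by auto
  have finAB: "finite (Btw A B)" "finite (Btw M0 C)" using cA[OF BN] cB[OF MM] by auto
  have "(\<Sum>M1\<in>Btw A B. \<Sum>N\<in>Btw M1 C. \<Sum>M\<in>Btw A N. G M N) = (\<Sum>M1\<in>Btw A B. \<Sum>N\<in>{N\<in>\<N>. N \<subseteq> M1}. H N)"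
  proof (rule sum.cong[OF refl])
    fix M1 assume "M1 \<in> Btw A B"
    then have "Btw M1 C = {N\<in>\<N>. N \<subseteq> M1}" using sub1 below by blast
    then show "(\<Sum>N\<in>Btw M1 C. \<Sum>M\<in>Btw A N. G M N) = (\<Sum>N\<in>{N\<in>\<N>. N \<subseteq> M1}. H N)"
      by (simp add: above H_def)
  qed
  also have "\<dots> = (\<Sum>N\<in>\<N>. \<Sum>M1\<in>{M1\<in>Btw A B. N \<subseteq> M1}. H N)"
    by (rule sum.swap_restrict[OF finAB(1) finN])
  \<comment> \<open>A point \<open>N \<noteq> B\<close> is reached once, through the line joining it
    to \<open>B\<close>; \<open>B\<close> itself is reached through all \<open>q + 1\<close> lines.
    The \<open>q\<close> surplus visits are the term subtracted in the statement.\<close>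
  also have "\<dots> = (\<Sum>N\<in>\<N>. H N + (if N = B then real q * H B else 0))"
  proof (intro sum.cong refl)
    fix N assume N: "N \<in> \<N>"
    show "(\<Sum>M1\<in>{M1\<in>Btw A B. N \<subseteq> M1}. H N) = H N + (if N = B then real q * H B else 0)"
    proof (cases "N = B")
      case True
      have "{M1\<in>Btw A B. B \<subseteq> M1} = Btw A B" by (auto simp: Btw_def)
      then show ?thesis using True cA[OF BN] by (simp add: algebra_simps)
    next
      case False
      have "card {M \<in> Btw A B. N \<subseteq> M} = 1"
        using N lB lM0 C A False by (intro card_over[of A C B N]) (auto simp: \<N>_def)
      then show ?thesis using False by simp
    qed
  qed
  also have "\<dots> = (\<Sum>N\<in>\<N>. H N) + real q * H B" using finN BN by (simp add: sum.distrib)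
  finally have 1: "(\<Sum>M1\<in>Btw A B. \<Sum>N\<in>Btw M1 C. \<Sum>M\<in>Btw A N. G M N) = (\<Sum>N\<in>\<N>. H N) + real q * H B" .
  have "(\<Sum>N1\<in>Btw M0 C. \<Sum>M\<in>Btw A N1. \<Sum>N\<in>Btw M C. G M N) = (\<Sum>N1\<in>Btw M0 C. \<Sum>M\<in>{M\<in>\<M>. N1 \<subseteq> M}. K M)"
  proof (rule sum.cong[OF refl])
    fix N1 assume "N1 \<in> Btw M0 C"
    then have "Btw A N1 = {M\<in>\<M>. N1 \<subseteq> M}" using sub2 above by blast
    then show "(\<Sum>M\<in>Btw A N1. \<Sum>N\<in>Btw M C. G M N) = (\<Sum>M\<in>{M\<in>\<M>. N1 \<subseteq> M}. K M)"
      by (simp add: below K_def)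
  qed
  also have "\<dots> = (\<Sum>M\<in>\<M>. \<Sum>N1\<in>{N1\<in>Btw M0 C. N1 \<subseteq> M}. K M)"
    by (rule sum.swap_restrict[OF finAB(2) finM])
  also have "\<dots> = (\<Sum>M\<in>\<M>. K M + (if M = M0 then real q * K M0 else 0))"
  proof (intro sum.cong refl)
    fix M assume M: "M \<in> \<M>"
    show "(\<Sum>N1\<in>{N1\<in>Btw M0 C. N1 \<subseteq> M}. K M) = K M + (if M = M0 then real q * K M0 else 0)"
    proof (cases "M = M0")
      case True
      have "{N1\<in>Btw M0 C. N1 \<subseteq> M0} = Btw M0 C" by (auto simp: Btw_def)
      then show ?thesis using True cB[OF MM] by (simp add: algebra_simps)
    next
      case False
      have "card {N \<in> Btw M0 C. N \<subseteq> M} = 1"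
        using M MM A C False by (intro card_under) (auto simp: \<M>_def)
      then show ?thesis using False by simp
    qed
  qed
  also have "\<dots> = (\<Sum>M\<in>\<M>. K M) + real q * K M0" using finM MM by (simp add: sum.distrib)
  finally have 2: "(\<Sum>N1\<in>Btw M0 C. \<Sum>M\<in>Btw A N1. \<Sum>N\<in>Btw M C. G M N) = (\<Sum>M\<in>\<M>. K M) + real q * K M0" .
  have "(\<Sum>N\<in>\<N>. H N) = (\<Sum>M\<in>\<M>. K M)"
    unfolding H_def K_def by (rule sum.swap_restrict[OF finN finM])
  moreover have "H B = (\<Sum>M\<in>Btw A B. G M B)" using above[OF BN] by (simp add: H_def)
  moreover have "K M0 = (\<Sum>N\<in>Btw M0 C. G M0 N)" using below[OF MM] by (simp add: K_def)
  ultimately show ?thesis using 1 2 by simp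
qed

end

section \<open>Chambers as periodic chains of lattices\<close>

lemma scale_subset_iff:
  assumes "c \<noteq> (0::'a::field)" shows "scale_set c L \<subseteq> scale_set c M \<longleftrightarrow> L \<subseteq> M"
  using assms by (simp add: scale_set_eq_act act_subset_iff invertible_mat)

lemma scale_Int:
  assumes "c \<noteq> (0::'a::field)" shows "scale_set c (L \<inter> M) = scale_set c L \<inter> scale_set c M"
  unfolding scale_set_def using assms by (intro image_Int) (auto simp: inj_on_def)

locale building = local_field \<nu> \<pi> q for \<nu> :: "'a::field \<Rightarrow> int" and \<pi> q +
  fixes n_type :: "'n::finite itself"
  assumes dim: "CARD('n) \<ge> 3"
begin

definition d :: int where "d = int CARD('n)"

lemma d3: "d \<ge> 3" using dim by (simp add: d_def)

text \<open>A chamber together with all multiples of its lattices by powers of \<open>\<pi>\<close>.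
  Indexing by \<open>lval\<close> selects one lattice from each class for every admissible value,
  and makes the index mod \<open>d\<close> the type.\<close>

definition chain :: "(int \<Rightarrow> ('a^'n) set) \<Rightarrow> bool" where
  "chain L \<longleftrightarrow> (\<forall>n. is_lattice \<nu> (L n) \<and> lval (L n) = n \<and> L (n + 1) \<subseteq> L n \<and> L (n + d) = scale_set \<pi> (L n))"

lemma chain_lattice: "chain L \<Longrightarrow> is_lattice \<nu> (L n)"
  and chain_lval: "chain L \<Longrightarrow> lval (L n) = n"
  and chain_step: "chain L \<Longrightarrow> L (n + 1) \<subseteq> L n"
  by (auto simp: chain_def)

lemma chain_antimono: assumes L: "chain L" and "m \<le> n" shows "L n \<subseteq> L m"
  using \<open>m \<le> n\<close> by (induction n rule: int_ge_induct) (use chain_step[OF L] in auto)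

lemma chain_shift: assumes L: "chain L" shows "L (n + k * d) = scale_set (\<pi> powi k) (L n)"
proof -
  have s: "L (n + d) = scale_set \<pi> (L n)" for n using L by (simp add: chain_def)
  have *: "L (n + int k * d) = scale_set (\<pi> ^ k) (L n)" for n k
  proof (induction k)
    case (Suc k)
    have "L (n + int (Suc k) * d) = L ((n + int k * d) + d)" by (simp add: algebra_simps)
    then show ?case by (simp add: s Suc scale_scale)
  qed simp
  show ?thesis
  proof (cases "k \<ge> 0")
    case True
    then show ?thesis using *[of n "nat k"] by (simp add: power_int_def)
  next
    case False
    have "L n = scale_set (\<pi> ^ nat (- k)) (L (n + k * d))"
      using *[of "n + k * d" "nat (-k)"] False by simp
    then show ?thesis using False by (simp add: scale_scale power_int_def flip: power_mult_distrib)
  qed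
qed

lemma lval_scale_d: "c \<noteq> 0 \<Longrightarrow> is_lattice \<nu> L \<Longrightarrow> lval (scale_set c (L :: ('a^'n) set)) = lval L + \<nu> c * d"
  by (simp add: lval_scale d_def)

lemma div_mod_shift: "(n + d - i) div d = 1 + (n - i) div d" "(n + d - i) mod d = (n - i) mod d"
proof -
  have *: "n + d - i = (n - i) + d" by simp
  show "(n + d - i) div d = 1 + (n - i) div d" "(n + d - i) mod d = (n - i) mod d"
    unfolding * using d3 by (simp_all add: div_add_self2)
qed

lemma chain_of_period:
  assumes lat: "\<And>r. 0 \<le> r \<Longrightarrow> r < d \<Longrightarrow> is_lattice \<nu> (g r) \<and> lval (g r) = v0 + r"
    and step: "\<And>r. 0 \<le> r \<Longrightarrow> r + 1 < d \<Longrightarrow> g (r + 1) \<subseteq> g r"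
    and last: "scale_set \<pi> (g 0) \<subseteq> g (d - 1)"
  shows "chain (\<lambda>n. scale_set (\<pi> powi ((n - v0) div d)) (g ((n - v0) mod d)))"
  unfolding chain_def
proof (intro allI conjI)
  fix n
  define k r where "k = (n - v0) div d" and "r = (n - v0) mod d"
  have r: "0 \<le> r" "r < d" using d3 by (auto simp: r_def)
  have n: "n = v0 + r + k * d" by (simp add: k_def r_def)
  have dk: "(n - v0) div d = k" "(n - v0) mod d = r" by (simp_all add: k_def r_def)
  show "is_lattice \<nu> (scale_set (\<pi> powi ((n - v0) div d)) (g ((n - v0) mod d)))"
    using lat[OF r] by (simp add: dk lattice_scale)
  show "lval (scale_set (\<pi> powi ((n - v0) div d)) (g ((n - v0) mod d))) = n"
    using lat[OF r] unfolding dk by (simp add: lval_scale_d n)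
  show "scale_set (\<pi> powi ((n + d - v0) div d)) (g ((n + d - v0) mod d))
      = scale_set \<pi> (scale_set (\<pi> powi ((n - v0) div d)) (g ((n - v0) mod d)))"
    by (simp add: div_mod_shift scale_scale power_int_add)
  show "scale_set (\<pi> powi ((n + 1 - v0) div d)) (g ((n + 1 - v0) mod d))
     \<subseteq> scale_set (\<pi> powi ((n - v0) div d)) (g ((n - v0) mod d))"
  proof (cases "r + 1 < d")
    case True
    have e: "n + 1 - v0 = (r + 1) + k * d" by (simp add: n)
    have "(n + 1 - v0) div d = k" "(n + 1 - v0) mod d = r + 1"
      unfolding e using True r by simp_all
    then show ?thesis using step[OF r(1) True] by (simp add: dk scale_subset_iff)
  next
    case False
    then have rd: "r = d - 1" using r by simp
    have e: "n + 1 - v0 = 0 + (1 + k) * d" by (simp add: n rd algebra_simps)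
    have "(n + 1 - v0) div d = 1 + k" "(n + 1 - v0) mod d = 0"
      unfolding e using d3 by simp_all
    moreover have "scale_set (\<pi> powi k) (scale_set \<pi> (g 0)) \<subseteq> scale_set (\<pi> powi k) (g (d - 1))"
      using last by (simp add: scale_subset_iff)
    ultimately show ?thesis by (simp add: dk rd scale_scale power_int_add mult.commute)
  qed
qed

lemma chain_exists:
  fixes M :: "('a^'n) set"
  assumes M: "is_lattice \<nu> M"
  shows "\<exists>L. chain L \<and> L (lval M) = M"
proof -
  \<comment> \<open>A flag built upwards from \<open>scale_set \<pi> M\<close>. The
    \<open>min\<close> freezes it at \<open>M\<close> after \<open>d\<close> steps, so dependent
    choice can run over all natural numbers; \<open>g\<close> then reads it downwards.\<close>
  define P where "P t X \<longleftrightarrow> is_lattice \<nu> X \<and> scale_set \<pi> M \<subseteq> X \<and> X \<subseteq> M \<and>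
      lval X = lval M + (d - min (int t) d)" for t :: nat and X
  have "\<exists>f. \<forall>t. P t (f t) \<and> f t \<subseteq> f (Suc t)"
  proof (rule dependent_nat_choice)
    show "\<exists>X. P 0 X"
      using M d3 scale_subset[OF lattice_osub[OF M]]
      by (intro exI[of _ "scale_set \<pi> M"]) (auto simp: P_def lattice_scale lval_scale_d)
  next
    fix X t assume X: "P t X"
    show "\<exists>Y. P (Suc t) Y \<and> X \<subseteq> Y"
    proof (cases "int t < d")
      case True
      then have "\<not> M \<subseteq> X" using X lval_mono[OF M, of X] by (auto simp: P_def)
      then obtain e where e: "e \<in> M" "e \<notin> X" "\<pi> *s e \<in> X"
        using step_exists[of X M] X lattice_osub[OF M] unfolding P_def by blast
      have "adjoin X e \<subseteq> M" using X e lattice_osub[OF M] by (intro adjoin_least) (auto simp: P_def)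
      then have "P (Suc t) (adjoin X e)"
        using X adjoin_lattice[of X e] e True adjoin_superset[of X e] by (auto simp: P_def)
      then show ?thesis using adjoin_superset by blast
    next
      case False
      then have "P (Suc t) X" using X by (simp add: P_def)
      then show ?thesis by blast
    qed
  qed
  then obtain f where f: "\<And>t. P t (f t)" "\<And>t. f t \<subseteq> f (Suc t)" by blast
  define g where "g r = f (nat (d - r))" for r
  have P: "P (nat (d - r)) (g r)" for r using f(1) by (simp add: g_def)
  have "M = g 0" using P[of 0] d3 M by (intro sym[OF lval_eq]) (auto simp: P_def)
  let ?L = "\<lambda>n. scale_set (\<pi> powi ((n - lval M) div d)) (g ((n - lval M) mod d))"
  have "chain ?L"
  proof (rule chain_of_period)
    show "is_lattice \<nu> (g r) \<and> lval (g r) = lval M + r" if "0 \<le> r" "r < d" for r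
      using P[of r] that by (auto simp: P_def)
    show "g (r + 1) \<subseteq> g r" if "0 \<le> r" "r + 1 < d" for r
    proof -
      have "nat (d - r) = Suc (nat (d - (r + 1)))" using that by simp
      then show ?thesis using f(2) by (simp add: g_def)
    qed
    show "scale_set \<pi> (g 0) \<subseteq> g (d - 1)"
      using P[of "d - 1"] \<open>M = g 0\<close> by (simp add: P_def)
  qed
  moreover have "?L (lval M) = M" using \<open>M = g 0\<close> by simp
  ultimately show ?thesis by blast
qed

lemma chain_Btw: "chain L \<Longrightarrow> L i \<in> Btw (L (i - 1)) (L (i + 1))"
  using chain_step[of L "i - 1"] by (auto simp: Btw_def chain_lattice chain_lval chain_step)

lemma chain_\<pi>: "chain L \<Longrightarrow> n \<le> m + d \<Longrightarrow> scale_set \<pi> (L m) \<subseteq> L n"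
  using chain_antimono[of L n "m + d"] by (simp add: chain_def)

text \<open>Passage to a neighbouring chamber. All translates of position \<open>i\<close> by
  multiples of \<open>d\<close> change together, which keeps the chain periodic.\<close>

definition upd :: "(int \<Rightarrow> ('a^'n) set) \<Rightarrow> int \<Rightarrow> ('a^'n) set \<Rightarrow> int \<Rightarrow> ('a^'n) set" where
  "upd L i M = (\<lambda>n. if (n - i) mod d = 0 then scale_set (\<pi> powi ((n - i) div d)) M else L n)"

lemma upd_at [simp]: "upd L i M i = M"
  by (simp add: upd_def)

lemma upd_other: "(n - i) mod d \<noteq> 0 \<Longrightarrow> upd L i M n = L n"
  by (simp add: upd_def)

lemma mod_small_nonzero: "k \<noteq> 0 \<Longrightarrow> \<bar>k\<bar> < d \<Longrightarrow> k mod d \<noteq> 0"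
  by (metis abs_of_nonneg d3 dvd_imp_le_int mod_0_imp_dvd abs_ge_zero linorder_not_less order_trans zero_le_numeral)

lemma upd_self: assumes "chain L" shows "upd L i (L i) = L"
proof
  fix n show "upd L i (L i) n = L n"
  proof (cases "(n - i) mod d = 0")
    case True
    then have "n = i + ((n - i) div d) * d" using div_mult_mod_eq[of "n - i" d] by simp
    then have "L n = scale_set (\<pi> powi ((n - i) div d)) (L i)"
      using chain_shift[OF assms, of i "(n - i) div d"] by simp
    then show ?thesis using True by (simp add: upd_def)
  qed (simp add: upd_def)
qed

lemma chain_upd:
  assumes L: "chain L" and M: "M \<in> Btw (L (i - 1)) (L (i + 1))"
  shows "chain (upd L i M)"
  unfolding chain_def
proof (intro allI conjI)
  have lM: "is_lattice \<nu> M" "lval M = i" "L (i + 1) \<subseteq> M" "M \<subseteq> L (i - 1)"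
    using M chain_lval[OF L] by (auto simp: Btw_def)
  fix n
  define k where "k = (n - i) div d"
  have n: "n = i + k * d" if "(n - i) mod d = 0" using that div_mult_mod_eq[of "n - i" d] by (simp add: k_def)
  show "is_lattice \<nu> (upd L i M n)"
    using lM chain_lattice[OF L] by (auto simp: upd_def lattice_scale)
  show "lval (upd L i M n) = n"
    using n lM chain_lval[OF L] by (auto simp: upd_def lval_scale_d k_def)
  show "upd L i M (n + d) = scale_set \<pi> (upd L i M n)"
    using L by (simp add: upd_def div_mod_shift scale_scale power_int_add chain_def)
  show "upd L i M (n + 1) \<subseteq> upd L i M n"
  proof -
    consider (a) "(n - i) mod d = 0" | (b) "(n + 1 - i) mod d = 0" | (c) "(n - i) mod d \<noteq> 0" "(n + 1 - i) mod d \<noteq> 0"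
      by blast
    then show ?thesis
    proof cases
      case a
      have "(n + 1 - i) mod d = (1 + k * d) mod d" using n[OF a] by simp
      then have b: "(n + 1 - i) mod d \<noteq> 0" using d3 by simp
      have "L (n + 1) = scale_set (\<pi> powi k) (L (i + 1))"
        using chain_shift[OF L, of "i + 1" k] n[OF a] by (simp add: algebra_simps)
      then show ?thesis using a b lM by (simp add: upd_def k_def[symmetric] scale_subset_iff)
    next
      case b
      define k' where "k' = (n + 1 - i) div d"
      have n': "n = (i - 1) + k' * d" using b div_mult_mod_eq[of "n + 1 - i" d] by (simp add: k'_def)
      have "(n - i) mod d = (- 1) mod d" using n' mod_mult_self1[of "-1" k' d] by simp
      then have a: "(n - i) mod d \<noteq> 0" using d3 mod_small_nonzero[of "-1"] by simp
      have "L n = scale_set (\<pi> powi k') (L (i - 1))"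
        using chain_shift[OF L, of "i - 1" k'] n' by simp
      then show ?thesis using a b lM by (simp add: upd_def k'_def[symmetric] scale_subset_iff)
    next
      case c
      then show ?thesis using chain_step[OF L] by (simp add: upd_def)
    qed
  qed
qed

section \<open>Panels and sums over panels\<close>

definition agree :: "int \<Rightarrow> (int \<Rightarrow> ('a^'n) set) \<Rightarrow> (int \<Rightarrow> ('a^'n) set) \<Rightarrow> bool" where
  "agree i L L' \<longleftrightarrow> (\<forall>n. (n - i) mod d \<noteq> 0 \<longrightarrow> L n = L' n)"

definition panel :: "int \<Rightarrow> (int \<Rightarrow> ('a^'n) set) \<Rightarrow> (int \<Rightarrow> ('a^'n) set) set" where
  "panel i L = {L'. chain L' \<and> agree i L L'}"

lemma agree_upd: "agree i L (upd L i M)"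
  by (simp add: agree_def upd_def)

lemma agree_near: "agree i L L' \<Longrightarrow> L (i - 1) = L' (i - 1)" "agree i L L' \<Longrightarrow> L (i + 1) = L' (i + 1)"
  using mod_small_nonzero[of "-1"] mod_small_nonzero[of 1] d3 by (auto simp: agree_def)

lemma agree_imp_upd:
  assumes L': "chain L'" and ag: "agree i L L'" shows "L' = upd L i (L' i)"
proof -
  have "upd L' i (L' i) = upd L i (L' i)" using ag by (auto simp: upd_def agree_def fun_eq_iff)
  then show ?thesis using upd_self[OF L'] by simp
qed

lemma panel_bij:
  assumes L: "chain L"
  shows "bij_betw (upd L i) (Btw (L (i - 1)) (L (i + 1))) (panel i L)"
proof (rule bij_betw_byWitness[where f' = "\<lambda>L'. L' i"])
  show "\<forall>L'\<in>panel i L. upd L i (L' i) = L'"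
    using agree_imp_upd by (auto simp: panel_def)
  show "upd L i ` Btw (L (i - 1)) (L (i + 1)) \<subseteq> panel i L"
    using chain_upd[OF L] by (auto simp: panel_def agree_upd)
  show "(\<lambda>L'. L' i) ` panel i L \<subseteq> Btw (L (i - 1)) (L (i + 1))"
  proof safe
    fix L' assume "L' \<in> panel i L"
    then have "chain L'" "agree i L L'" by (auto simp: panel_def)
    then show "L' i \<in> Btw (L (i - 1)) (L (i + 1))" using chain_Btw[of L' i] agree_near[of i L L'] by simp
  qed
qed simp

lemma card_panel: assumes L: "chain L" shows "card (panel i L) = q + 1"
proof -
  have "card (Btw (L (i - 1)) (L (i + 1))) = q + 1"
    using card_Btw[of "L (i - 1)" "L (i + 1)" "L i"] chain_\<pi>[OF L, of "i + 1" "i - 1"] d3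
    by (auto simp: L chain_lattice chain_lval chain_Btw)
  then show ?thesis using panel_bij[OF L, of i] bij_betw_same_card by metis
qed

text \<open>In terms of the Hecke algebra generator \<open>T i\<close>, which sums over the
  \<open>q\<close> other chambers of the panel, this is \<open>T i + 1\<close>.\<close>

definition Av :: "int \<Rightarrow> ((int \<Rightarrow> ('a^'n) set) \<Rightarrow> real) \<Rightarrow> (int \<Rightarrow> ('a^'n) set) \<Rightarrow> real" where
  "Av i F L = (\<Sum>L'\<in>panel i L. F L')"

lemma Av_eq: "chain L \<Longrightarrow> Av i F L = (\<Sum>M\<in>Btw (L (i - 1)) (L (i + 1)). F (upd L i M))"
  unfolding Av_def using panel_bij[of L i] by (simp add: sum.reindex_bij_betw)

lemma panel_mod: "i mod d = j mod d \<Longrightarrow> panel i = panel j"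
proof -
  assume "i mod d = j mod d"
  then have "(n - i) mod d = (n - j) mod d" for n by (metis mod_diff_right_eq)
  then show ?thesis by (simp add: panel_def agree_def fun_eq_iff)
qed

lemma Av_mod: "i mod d = j mod d \<Longrightarrow> Av i = Av j"
  using panel_mod[of i j] by (simp add: Av_def fun_eq_iff)

text \<open>The congruences say that an update at \<open>j\<close> leaves positions
  \<open>i - 1\<close>, \<open>i\<close>, \<open>i + 1\<close> alone, and conversely. Both orders
  therefore sum over the same independent pairs of choices.\<close>

lemma Av_comm:
  assumes L: "chain L"
    and ij: "(i - j) mod d \<noteq> 0" "(i - 1 - j) mod d \<noteq> 0" "(i + 1 - j) mod d \<noteq> 0"
    and ji: "(j - i) mod d \<noteq> 0" "(j - 1 - i) mod d \<noteq> 0" "(j + 1 - i) mod d \<noteq> 0"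
  shows "Av i (Av j F) L = Av j (Av i F) L"
proof -
  have c: "upd (upd L i M) j N = upd (upd L j N) i M" for M N
  proof
    fix n
    have "\<not> ((n - i) mod d = 0 \<and> (n - j) mod d = 0)"
      using ji(1) mod_diff_eq[of "n - i" d "n - j"] by auto
    then show "upd (upd L i M) j N n = upd (upd L j N) i M n" by (auto simp: upd_def)
  qed
  have "Av i (Av j F) L = (\<Sum>M\<in>Btw (L (i - 1)) (L (i + 1)). \<Sum>N\<in>Btw (L (j - 1)) (L (j + 1)). F (upd (upd L i M) j N))"
    unfolding Av_eq[OF L] using ij ji by (intro sum.cong refl) (simp add: Av_eq chain_upd[OF L] upd_other)
  moreover have "Av j (Av i F) L = (\<Sum>N\<in>Btw (L (j - 1)) (L (j + 1)). \<Sum>M\<in>Btw (L (i - 1)) (L (i + 1)). F (upd (upd L j N) i M))"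
    unfolding Av_eq[OF L] using ij ji by (intro sum.cong refl) (simp add: Av_eq chain_upd[OF L] upd_other)
  ultimately show ?thesis by (simp add: c) (rule sum.swap)
qed

text \<open>Of three alternating updates the first is overwritten by the third, so both sides are
  sums over flags in the plane \<open>L (i - 1) / L (i + 2)\<close> and \<open>Btw_braid\<close>
  applies. Since \<open>d \<ge> 3\<close>, the lattice \<open>L (i + 2)\<close> contains
  \<open>scale_set \<pi> (L (i - 1))\<close>.\<close>

lemma Av_braid:
  assumes L: "chain L"
  shows "Av i (Av (i + 1) (Av i F)) L - real q * Av i F L
       = Av (i + 1) (Av i (Av (i + 1) F)) L - real q * Av (i + 1) F L"
proof -
  define G where "G M N = F (upd (upd L i M) (i + 1) N)" for M N
  let ?A = "L (i - 1)" and ?B = "L (i + 1)" and ?C = "L (i + 2)" and ?M = "L i"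
  have mods: "(1::int) mod d \<noteq> 0" "(-1::int) mod d \<noteq> 0" "(2::int) mod d \<noteq> 0" "(-2::int) mod d \<noteq> 0"
    using mod_small_nonzero d3 by auto
  have uo: "upd L' i M (i + 1) = L' (i + 1)" "upd L' i M (i - 1) = L' (i - 1)"
     "upd L' i M (i + 2) = L' (i + 2)" "upd L' (i + 1) M i = L' i"
     "upd L' (i + 1) M (i - 1) = L' (i - 1)" "upd L' (i + 1) M (i + 2) = L' (i + 2)" for L' M
    using mods by (simp_all add: upd_other)
  have disj: "\<not> ((n - i) mod d = 0 \<and> (n - (i + 1)) mod d = 0)" for n
    using mods mod_diff_eq[of "n - i" d "n - (i + 1)"] by auto
  have Ai: "Av i F' L' = (\<Sum>M\<in>Btw (L' (i - 1)) (L' (i + 1)). F' (upd L' i M))" if "chain L'" for L' F'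
    by (rule Av_eq[OF that])
  have Aj: "Av (i + 1) F' L' = (\<Sum>N\<in>Btw (L' i) (L' (i + 2)). F' (upd L' (i + 1) N))" if "chain L'" for L' F'
    using Av_eq[OF that, of "i + 1" F'] by (simp add: add.assoc)
  have ci: "chain (upd L' i M)" if "chain L'" "M \<in> Btw (L' (i - 1)) (L' (i + 1))" for L' M
    using chain_upd that by blast
  have cj: "chain (upd L' (i + 1) N)" if "chain L'" "N \<in> Btw (L' i) (L' (i + 2))" for L' N
    using chain_upd[of L' N "i + 1"] that by (simp add: add.assoc)
  have "Av i (Av (i + 1) (Av i F)) L = (\<Sum>M1\<in>Btw ?A ?B. \<Sum>N\<in>Btw M1 ?C. \<Sum>M\<in>Btw ?A N.
      F (upd (upd (upd L i M1) (i + 1) N) i M))"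
    unfolding Ai[OF L]
    by (intro sum.cong refl) (simp add: Aj ci[OF L] uo Ai cj cong: sum.cong)
  moreover have "upd (upd (upd L i M1) (i + 1) N) i M = upd (upd L i M) (i + 1) N" for M1 N M
    using disj by (auto simp: upd_def fun_eq_iff)
  ultimately have 1: "Av i (Av (i + 1) (Av i F)) L = (\<Sum>M1\<in>Btw ?A ?B. \<Sum>N\<in>Btw M1 ?C. \<Sum>M\<in>Btw ?A N. G M N)"
    by (simp add: G_def)
  have "Av (i + 1) (Av i (Av (i + 1) F)) L = (\<Sum>N1\<in>Btw ?M ?C. \<Sum>M\<in>Btw ?A N1. \<Sum>N\<in>Btw M ?C.
      F (upd (upd (upd L (i + 1) N1) i M) (i + 1) N))"
    unfolding Aj[OF L]
    by (intro sum.cong refl) (simp add: Ai cj[OF L] uo Aj ci cong: sum.cong)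
  moreover have "upd (upd (upd L (i + 1) N1) i M) (i + 1) N = upd (upd L i M) (i + 1) N" for N1 M N
    using disj by (auto simp: upd_def fun_eq_iff)
  ultimately have 2: "Av (i + 1) (Av i (Av (i + 1) F)) L = (\<Sum>N1\<in>Btw ?M ?C. \<Sum>M\<in>Btw ?A N1. \<Sum>N\<in>Btw M ?C. G M N)"
    by (simp add: G_def)
  have 3: "Av i F L = (\<Sum>M\<in>Btw ?A ?B. G M ?B)"
    unfolding Ai[OF L] G_def
  proof (intro sum.cong refl)
    fix M assume "M \<in> Btw ?A ?B"
    then have "upd (upd L i M) (i + 1) (upd L i M (i + 1)) = upd L i M" by (intro upd_self ci L)
    then show "F (upd L i M) = F (upd (upd L i M) (i + 1) ?B)" by (simp add: uo)
  qed
  have 4: "Av (i + 1) F L = (\<Sum>N\<in>Btw ?M ?C. G ?M N)"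
    unfolding Aj[OF L] G_def by (simp add: upd_self[OF L])
  have "?B \<in> Btw ?M ?C" using chain_Btw[OF L, of "i + 1"] by (simp add: add.assoc)
  then show ?thesis
    unfolding 1 2 3 4
    using d3 by (intro Btw_braid chain_Btw L chain_lattice chain_\<pi>) (auto simp: chain_lval L)
qed

end

section \<open>Gallery connectedness\<close>

context building
begin

lemma chain_subset_lattice:
  assumes L: "chain L" and M: "is_lattice \<nu> M"
  shows "\<exists>N. \<forall>n\<ge>N. L n \<subseteq> M"
proof -
  obtain k where "scale_set (\<pi> ^ k) (L 0) \<subseteq> M" using scaled_subset[OF chain_lattice[OF L] M] by blast
  then have "L (int k * d) \<subseteq> M" using chain_shift[OF L, of 0 "int k"] by simp
  then show ?thesis using chain_antimono[OF L] by blast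
qed

lemma lattice_subset_chain:
  assumes L: "chain L" and M: "is_lattice \<nu> M"
  shows "\<exists>N. \<forall>n\<le>N. M \<subseteq> L n"
proof -
  obtain k where "scale_set (\<pi> ^ k) M \<subseteq> L 0" using scaled_subset[OF M chain_lattice[OF L]] by blast
  moreover have "L 0 = scale_set (\<pi> ^ k) (L (- int k * d))"
    using chain_shift[OF L, of "- int k * d" "int k"] by simp
  ultimately have "M \<subseteq> L (- int k * d)" by (simp add: scale_subset_iff)
  then show ?thesis using chain_antimono[OF L] by blast
qed

text \<open>The filtration of \<open>M j\<close> by the chain \<open>L\<close> jumps at some
  indices. Sought is a jump at \<open>i - 1\<close> followed by no jump at \<open>i\<close>. If
  there is none for a given \<open>j\<close>, the filtration first never jumps and then always does,
  which forces \<open>M j\<close> to be a member of \<open>L\<close>.\<close>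

lemma descent_exists:
  assumes L: "chain L" and M: "chain M" and ne: "L \<noteq> M"
  shows "\<exists>i j. 0 \<le> i \<and> i < d \<and> M j \<inter> L i \<subseteq> L (i + 1) \<and> \<not> M j \<inter> L (i - 1) \<subseteq> L i"
proof -
  have "\<exists>i j. M j \<inter> L i \<subseteq> L (i + 1) \<and> \<not> M j \<inter> L (i - 1) \<subseteq> L i"
  proof (rule ccontr)
    assume none: "\<not> ?thesis"
    have "M j = L j" for j
    proof -
      \<comment> \<open>Indices without a jump; the absence of a descent makes this set closed
        downwards, and \<open>k\<close> will be its first non-member.\<close>
      define S where "S = {i. M j \<inter> L i \<subseteq> L (i + 1)}"
      have down: "i - 1 \<in> S" if "i \<in> S" for i using none that by (auto simp: S_def)
      have down: "i' \<in> S" if "i' \<le> i" "i \<in> S" for i i'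
        using that by (induction i' rule: int_le_induct) (auto intro: down)
      obtain N1 where N1: "\<forall>n\<ge>N1. L n \<subseteq> M j" using chain_subset_lattice[OF L chain_lattice[OF M]] by blast
      obtain N0 where N0: "\<forall>n\<le>N0. M j \<subseteq> L n" using lattice_subset_chain[OF L chain_lattice[OF M]] by blast
      have inS: "N0 - 1 \<in> S" using N0 by (auto simp: S_def)
      have notS: "n \<notin> S" if "n \<ge> N1" for n
      proof
        assume "n \<in> S"
        then have "L n \<subseteq> L (n + 1)" using that N1 by (auto simp: S_def)
        then have "lval (L (n + 1)) \<le> lval (L n)" by (intro lval_mono chain_lattice L)
        then show False by (simp add: chain_lval L)
      qed
      define t where "t = (LEAST t::nat. N0 - 1 + int t \<notin> S)"
      have "N0 - 1 + int (nat (N1 - N0 + 1)) \<notin> S" by (intro notS) simp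
      then have t: "N0 - 1 + int t \<notin> S" unfolding t_def by (rule LeastI)
      have t0: "t \<noteq> 0" using t inS by (intro notI) simp
      then have t': "N0 - 1 + int (t - 1) \<in> S"
        using not_less_Least[of "t - 1" "\<lambda>t. N0 - 1 + int t \<notin> S"] by (auto simp: t_def)
      define k where "k = N0 - 1 + int t"
      have k: "k \<notin> S" "k - 1 \<in> S" using t t' t0 by (auto simp: k_def of_nat_diff algebra_simps)
      have N0k: "N0 \<le> k" using t0 by (simp add: k_def)
      have "i \<le> k \<longrightarrow> M j \<subseteq> L i" if "N0 \<le> i" for i
        using that
      proof (induction i rule: int_ge_induct)
        case (step i)
        show ?case
        proof
          assume "i + 1 \<le> k"
          then have "i \<in> S" using down[of i "k - 1"] k by simp
          then show "M j \<subseteq> L (i + 1)" using step \<open>i + 1 \<le> k\<close> by (auto simp: S_def)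
        qed
      qed (use N0 in auto)
      then have sub1: "M j \<subseteq> L k" using N0k by blast
      \<comment> \<open>From \<open>k\<close> on every step of \<open>L\<close> jumps, so it is
        generated by a vector of \<open>M j\<close>; descending from an \<open>L i\<close> inside
        \<open>M j\<close> never leaves \<open>M j\<close>.\<close>
      have "k \<le> i \<longrightarrow> L i \<subseteq> M j" if "i \<le> max k N1" for i
        using that
      proof (induction i rule: int_le_induct)
        case (step i)
        show ?case
        proof
          assume ki: "k \<le> i - 1"
          then have "i - 1 \<notin> S" using down[of k "i - 1"] k by blast
          then obtain e where e: "e \<in> M j" "e \<in> L (i - 1)" "e \<notin> L i" by (auto simp: S_def)
          have "adjoin (L i) e = L (i - 1)"
            using chain_step[OF L, of "i - 1"] e
            by (intro step_adjoin(2)) (auto simp: chain_lattice chain_lval L)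
          moreover have "adjoin (L i) e \<subseteq> M j"
            using step ki e by (intro adjoin_least lattice_osub chain_lattice M) auto
          ultimately show "L (i - 1) \<subseteq> M j" by simp
        qed
      qed (use N1 in auto)
      then have sub2: "L k \<subseteq> M j" by simp
      then have "L k = M j" using sub1 by auto
      then show ?thesis using chain_lval[OF L, of k] chain_lval[OF M, of j] by simp
    qed
    then show False using ne by auto
  qed
  then obtain i j where ij: "M j \<inter> L i \<subseteq> L (i + 1)" "\<not> M j \<inter> L (i - 1) \<subseteq> L i" by blast
  \<comment> \<open>Periodicity moves the descent into the window
    \<open>0 \<le> i < d\<close>.\<close>
  define k where "k = - (i div d)"
  have sh: "X (n + k * d) = scale_set (\<pi> powi k) (X n)" if "chain X" for X n by (rule chain_shift[OF that])
  have eqs: "i + k * d + 1 = (i + 1) + k * d" "i + k * d - 1 = (i - 1) + k * d" by simp_all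
  have "M (j + k * d) \<inter> L (i + k * d) \<subseteq> L (i + k * d + 1)" "\<not> M (j + k * d) \<inter> L (i + k * d - 1) \<subseteq> L (i + k * d)"
    unfolding eqs sh[OF L] sh[OF M] using ij by (simp_all add: scale_Int[symmetric] scale_subset_iff)
  moreover have "i + k * d = i mod d" by (simp add: k_def minus_div_mult_eq_mod[symmetric])
  ultimately show ?thesis using d3 by (intro exI[of _ "i + k * d"] exI[of _ "j + k * d"]) simp
qed

lemma max_le_lval_Int:
  assumes "chain L" "chain M" shows "max i j \<le> lval (L i \<inter> M j)"
  using lval_mono[OF lattice_Int[of "L i" "M j"], of "L i"] lval_mono[OF lattice_Int[of "L i" "M j"], of "M j"]
  by (auto simp: chain_lattice chain_lval assms)

text \<open>Outside a finite window of \<open>j\<close>, one of the two lattices contains the other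
  and \<open>lval\<close> of the intersection takes its least possible value. This makes the defect
  summed in \<open>gallery_connected\<close> finite.\<close>

lemma lval_Int_eventually:
  assumes L: "chain L" and M: "chain M"
  shows "\<exists>B\<ge>0. \<forall>i\<in>{0..<d}. \<forall>j. j \<notin> {-B..B} \<longrightarrow> lval (L i \<inter> M j) = max i j"
proof -
  obtain N1 where N1: "\<forall>n\<ge>N1. M n \<subseteq> L (d - 1)" using chain_subset_lattice[OF M chain_lattice[OF L]] by blast
  obtain N0 where N0: "\<forall>n\<le>N0. L 0 \<subseteq> M n" using lattice_subset_chain[OF M chain_lattice[OF L]] by blast
  define B where "B = max \<bar>N0\<bar> (max \<bar>N1\<bar> d)"
  have "lval (L i \<inter> M j) = max i j" if i: "i \<in> {0..<d}" and j: "j \<notin> {-B..B}" for i j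
  proof (cases "j > 0")
    case True
    then have "j \<ge> N1" "j \<ge> i" using i j by (auto simp: B_def)
    then have "M j \<subseteq> L i" using N1 chain_antimono[OF L, of i "d - 1"] i by auto
    then have "L i \<inter> M j = M j" by auto
    then show ?thesis using \<open>j \<ge> i\<close> chain_lval[OF M] by simp
  next
    case False
    then have "j \<le> N0" "j \<le> i" using i j by (auto simp: B_def)
    then have "L i \<subseteq> M j" using N0 chain_antimono[OF L, of 0 i] i by auto
    then have "L i \<inter> M j = L i" by auto
    then show ?thesis using \<open>j \<le> i\<close> chain_lval[OF L] by simp
  qed
  moreover have "B \<ge> 0" using d3 by (simp add: B_def)
  ultimately show ?thesis by blast
qed

text \<open>Replacing \<open>L i\<close> by \<open>N\<close> turns no intersection with
  \<open>M\<close> smaller in length. For \<open>j' \<le> j\<close> the vector \<open>e\<close>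
  enters the intersection and gains one step over \<open>L (i + 1)\<close>, compensating at least
  what \<open>L i\<close> had; for \<open>j' > j\<close>, \<open>L i\<close> met \<open>M j'\<close>
  only inside \<open>L (i + 1)\<close>. At \<open>j\<close> itself \<open>L i\<close> had gained
  nothing, so the gain is strict.\<close>

lemma descent_lval:
  assumes L: "chain L" and M: "chain M"
    and d1: "M j \<inter> L i \<subseteq> L (i + 1)" and e: "e \<in> M j" "e \<in> L (i - 1)" "e \<notin> L i"
  defines "N \<equiv> adjoin (L (i + 1)) e"
  shows "N \<in> Btw (L (i - 1)) (L (i + 1))" "lval (N \<inter> M j') \<le> lval (L i \<inter> M j')" "lval (N \<inter> M j) < lval (L i \<inter> M j)"
proof -
  have lat: "is_lattice \<nu> (L n)" "is_lattice \<nu> (M n)" for n using L M chain_lattice by auto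
  note os = lattice_osub[OF lat(1)] lattice_osub[OF lat(2)]
  have en: "e \<notin> L (i + 1)" using e chain_step[OF L, of i] by auto
  have pe: "\<pi> *s e \<in> L (i + 1)"
    using chain_\<pi>[OF L, of "i + 1" "i - 1"] d3 e by (auto simp: scale_set_def)
  note N = adjoin_lattice[OF lat(1) en pe, folded N_def]
  have Nsub: "L (i + 1) \<subseteq> N" "e \<in> N" "N \<subseteq> L (i - 1)"
    using adjoin_superset adjoin_mem[OF os(1)] adjoin_least[OF os(1) _ e(2)] chain_antimono[OF L, of "i - 1" "i + 1"]
    by (auto simp: N_def)
  show "N \<in> Btw (L (i - 1)) (L (i + 1))" using N Nsub by (simp add: Btw_def chain_lval L)
  have base: "lval (N \<inter> M j') = lval (L (i + 1) \<inter> M j') - 1" if "j' \<le> j" for j'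
  proof -
    have e': "e \<in> M j'" using e(1) chain_antimono[OF M that] by auto
    have pe': "\<pi> *s e \<in> L (i + 1) \<inter> M j'" using pe osub_scale[OF os(2) O_\<pi> e'] by simp
    have "N \<inter> M j' \<subseteq> adjoin (L (i + 1) \<inter> M j') e"
    proof
      fix x assume x: "x \<in> N \<inter> M j'"
      then obtain y c where y: "x = y + c *s e" "y \<in> L (i + 1)" "c \<in> \<O>" by (auto simp: N_def adjoin_def)
      have "x - c *s e \<in> M j'" using x by (intro osub_diff[OF os(2)] osub_scale[OF os(2) y(3) e']) auto
      then have "y \<in> M j'" using y by simp
      then show "x \<in> adjoin (L (i + 1) \<inter> M j') e" using y by (auto simp: adjoin_def)
    qed
    moreover have "adjoin (L (i + 1) \<inter> M j') e \<subseteq> N \<inter> M j'"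
      using Nsub e' by (intro adjoin_least osub_Int os lattice_osub[OF N(1)]) auto
    ultimately have "N \<inter> M j' = adjoin (L (i + 1) \<inter> M j') e" by auto
    then show ?thesis using adjoin_lattice(2)[OF lattice_Int[OF lat] _ pe'] en by simp
  qed
  have "L i \<inter> M j = L (i + 1) \<inter> M j" using d1 chain_step[OF L, of i] by auto
  then show "lval (N \<inter> M j) < lval (L i \<inter> M j)" using base[of j] by simp
  show "lval (N \<inter> M j') \<le> lval (L i \<inter> M j')"
  proof (cases "j' \<le> j")
    case False
    then have "L i \<inter> M j' \<subseteq> N \<inter> M j'" using d1 Nsub chain_antimono[OF M, of j j'] by auto
    then show ?thesis by (intro lval_mono lattice_Int lat N(1))
  next
    case True
    have "lval (L (i + 1) \<inter> M j') - 1 \<le> lval (L i \<inter> M j')"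
    proof (cases "L i \<inter> M j' \<subseteq> L (i + 1)")
      case True
      then have "L i \<inter> M j' = L (i + 1) \<inter> M j'" using chain_step[OF L, of i] by auto
      then show ?thesis by simp
    next
      case False
      then obtain x where x: "x \<in> L i" "x \<in> M j'" "x \<notin> L (i + 1)" by auto
      have st: "\<pi> *s x \<in> L (i + 1)" "adjoin (L (i + 1)) x = L i"
        using step_adjoin[OF lat(1) lat(1) chain_step[OF L] _ x(1,3)] by (auto simp: chain_lval L)
      have px: "\<pi> *s x \<in> L (i + 1) \<inter> M j'" using st osub_scale[OF os(2) O_\<pi> x(2)] by simp
      have "L i \<inter> M j' \<subseteq> adjoin (L (i + 1) \<inter> M j') x"
      proof
        fix z assume z: "z \<in> L i \<inter> M j'"
        then obtain y c where y: "z = y + c *s x" "y \<in> L (i + 1)" "c \<in> \<O>"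
          unfolding st(2)[symmetric] by (auto simp: adjoin_def)
        have "z - c *s x \<in> M j'" using z by (intro osub_diff[OF os(2)] osub_scale[OF os(2) y(3) x(2)]) auto
        then have "y \<in> M j'" using y by simp
        then show "z \<in> adjoin (L (i + 1) \<inter> M j') x" using y by (auto simp: adjoin_def)
      qed
      then show ?thesis
        using adjoin_lattice[OF lattice_Int[OF lat] _ px] x(3) lval_mono[OF lattice_Int[OF lat]] by fastforce
    qed
    then show ?thesis using base[OF True] by simp
  qed
qed

text \<open>\<open>\<mu>\<close> adds up how far each \<open>lval (L i \<inter> M j)\<close> exceeds
  its minimum \<open>max i j\<close>; it drops with every descent, so one arrives at
  \<open>M\<close> by crossing panels. The form with an invariant \<open>F\<close> avoids galleries
  and is what \<open>invariant_const\<close> asks for.\<close>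

theorem gallery_connected:
  assumes inv: "\<And>i L L'. chain L \<Longrightarrow> chain L' \<Longrightarrow> agree i L L' \<Longrightarrow> F L = F L'"
    and L: "chain L" and M: "chain M"
  shows "F L = F M"
proof -
  define good where "good B L \<longleftrightarrow> (\<forall>i\<in>{0..<d}. \<forall>j. j \<notin> {-B..B} \<longrightarrow> lval (L i \<inter> M j) = max i j)" for B L
  define \<mu> where "\<mu> B L = (\<Sum>i\<in>{0..<d}. \<Sum>j\<in>{-B..B}. nat (lval (L i \<inter> M j) - max i j))" for B L
  obtain B where B: "good B L" using lval_Int_eventually[OF L M] by (auto simp: good_def)
  show ?thesis
    using L B
  proof (induction "\<mu> B L" arbitrary: L rule: less_induct)
    case less
    show ?case
    proof (cases "L = M")
      case False
      then obtain i j where i: "0 \<le> i" "i < d" and d1: "M j \<inter> L i \<subseteq> L (i + 1)"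
        and d2: "\<not> M j \<inter> L (i - 1) \<subseteq> L i"
        using descent_exists[OF less.prems(1) M] by blast
      obtain e where e: "e \<in> M j" "e \<in> L (i - 1)" "e \<notin> L i" using d2 by auto
      define N where "N = adjoin (L (i + 1)) e"
      note D = descent_lval[OF less.prems(1) M d1 e, folded N_def]
      define L' where "L' = upd L i N"
      have L': "chain L'" unfolding L'_def by (rule chain_upd[OF less.prems(1) D(1)])
      have same: "L' i' = L i'" if "i' \<in> {0..<d}" "i' \<noteq> i" for i'
        unfolding L'_def using that i by (intro upd_other mod_small_nonzero) auto
      have le: "lval (L' i' \<inter> M j') \<le> lval (L i' \<inter> M j')" if "i' \<in> {0..<d}" for i' j'
        using D(2) same[OF that] by (cases "i' = i") (auto simp: L'_def)
      have lower: "max i' j' \<le> lval (L' i' \<inter> M j')" for i' j' by (rule max_le_lval_Int[OF L' M])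
      have strict: "lval (L' i \<inter> M j) < lval (L i \<inter> M j)" using D(3) by (simp add: L'_def)
      \<comment> \<open>The window \<open>B\<close> chosen for the initial chain stays valid: off
        the window the values were already minimal and cannot rise.\<close>
      have "good B L'" using less.prems(2) le lower unfolding good_def by (metis order_antisym)
      moreover have jB: "j \<in> {-B..B}"
        using less.prems(2) strict lower[of i j] i unfolding good_def by force
      moreover have "\<mu> B L' < \<mu> B L"
      proof -
        define S where "S L i' = (\<Sum>j\<in>{-B..B}. nat (lval (L i' \<inter> M j) - max i' j))" for L and i' :: int
        have "S L' i' \<le> S L i'" if "i' \<in> {0..<d}" for i'
          unfolding S_def using le[OF that] by (intro sum_mono nat_mono) simp
        moreover have "S L' i < S L i"
          unfolding S_def using jB le i strict lower[of i j]
          by (intro sum_strict_mono_ex1) (auto intro!: nat_mono bexI[of _ j])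
        ultimately show ?thesis
          unfolding \<mu>_def S_def[symmetric] using i by (intro sum_strict_mono_ex1) auto
      qed
      ultimately have "F L' = F M" using less.hyps L' by blast
      moreover have "F L = F L'"
        using inv[OF less.prems(1) L', of i] agree_upd[of i L N] by (simp add: L'_def)
      ultimately show ?thesis by simp
    qed simp
  qed
qed

end

section \<open>The quotient complex\<close>

context discrete_valued_field
begin

lemma lat_class_scale: "c \<noteq> 0 \<Longrightarrow> lat_class (scale_set c L) = lat_class L"
  unfolding lat_class_def
  by (auto simp: scale_scale) (metis divide_eq_0_iff nonzero_divide_eq_eq)

lemma lat_class_self: "L \<in> lat_class L"
  unfolding lat_class_def by (auto intro!: exI[of _ 1])

lemma lat_class_eqD: "lat_class L = lat_class M \<Longrightarrow> \<exists>c. c \<noteq> 0 \<and> M = scale_set c L"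
proof -
  assume "lat_class L = lat_class M"
  then have "M \<in> lat_class L" using lat_class_self[of M] by simp
  then show ?thesis by (auto simp: lat_class_def)
qed

lemma lat_class_inj:
  fixes L M :: "('a^'n::finite) set"
  assumes "lat_class L = lat_class M" "is_lattice \<nu> L" "lval L = lval M"
  shows "L = M"
proof -
  obtain c where "c \<noteq> 0" "M = scale_set c L" using lat_class_eqD[OF assms(1)] by blast
  then show ?thesis using assms lval_scale[of c L] scale_unit[of L c] by auto
qed

lemma act_vert_lat_class:
  fixes g :: "'a^'n::finite^'n"
  shows "act_vert g (lat_class L) = lat_class (act_lat g L)"
proof -
  have "lat_class M = (\<lambda>c. scale_set c M) ` {c. c \<noteq> 0}" for M :: "('a^'n) set"
    by (auto simp: lat_class_def)
  then show ?thesis by (simp add: act_vert_def image_image act_scale)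
qed

lemma vtype_lat_class:
  fixes L :: "('a^'n::finite) set"
  assumes L: "is_lattice \<nu> L" shows "vtype \<nu> (lat_class L) = lval L mod int CARD('n)"
  unfolding vtype_def
proof (rule some_equality)
  show "\<exists>g::'a^'n^'n. invertible g \<and> lat_class L = lat_class (act_lat g std)
      \<and> lval L mod int CARD('n) = \<nu> (det g) mod int CARD('n)"
    using L by (auto simp: is_lattice_iff lval_act_std)
next
  fix t assume "\<exists>g::'a^'n^'n. invertible g \<and> lat_class L = lat_class (act_lat g std)
      \<and> t = \<nu> (det g) mod int CARD('n)"
  then obtain g :: "'a^'n^'n" where g: "invertible g" "lat_class L = lat_class (act_lat g std)"
    "t = \<nu> (det g) mod int CARD('n)" by blast
  obtain c where "c \<noteq> 0" "act_lat g std = scale_set c L" using lat_class_eqD[OF g(2)] by blast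
  then have "\<nu> (det g) = lval L + int CARD('n) * \<nu> c"
    using lval_act_std[OF g(1)] lval_scale[of c L] L by simp
  then show "t = lval L mod int CARD('n)" using g(3) by simp
qed

lemma bt_vertices_iff: "v \<in> bt_vertices \<nu> \<longleftrightarrow> (\<exists>L. is_lattice \<nu> L \<and> v = lat_class L)"
  by (auto simp: bt_vertices_def)

lemma lat_class_vertex: "is_lattice \<nu> L \<Longrightarrow> lat_class L \<in> bt_vertices \<nu>"
  by (auto simp: bt_vertices_iff)

end

section \<open>Orbits under a type preserving group\<close>

lemma act_vert_act: "act_vert g (act_vert h v) = act_vert (g ** h) v"
  by (simp add: act_vert_def image_image act_lat_act)

lemma act_vert_one [simp]: "act_vert (mat 1) v = v"
  by (simp add: act_vert_def)

lemma orbit_act: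
  assumes \<Gamma>: "pgl_subgroup \<Gamma>" and g: "g \<in> \<Gamma>"
  shows "orbit_of \<Gamma> (act_vert g v) = orbit_of \<Gamma> v"
proof -
  have inv: "invertible g" "matrix_inv g \<in> \<Gamma>" and mult: "\<And>h k. h \<in> \<Gamma> \<Longrightarrow> k \<in> \<Gamma> \<Longrightarrow> h ** k \<in> \<Gamma>"
    using \<Gamma> g by (auto simp: pgl_subgroup_def)
  show ?thesis
  proof
    show "orbit_of \<Gamma> (act_vert g v) \<subseteq> orbit_of \<Gamma> v"
      using mult g by (auto simp: orbit_of_def act_vert_act)
    show "orbit_of \<Gamma> v \<subseteq> orbit_of \<Gamma> (act_vert g v)"
    proof
      fix w assume "w \<in> orbit_of \<Gamma> v"
      then obtain h where h: "h \<in> \<Gamma>" "w = act_vert h v" by (auto simp: orbit_of_def)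
      have "w = act_vert (h ** matrix_inv g) (act_vert g v)"
        using invertible_inv(1)[OF inv(1)] by (simp add: h act_vert_act matrix_mul_assoc[symmetric])
      then show "w \<in> orbit_of \<Gamma> (act_vert g v)" using mult h inv by (auto simp: orbit_of_def)
    qed
  qed
qed

locale building_quotient = building \<nu> \<pi> q n_type
  for \<nu> :: "'a::field \<Rightarrow> int" and \<pi> q and n_type :: "'n::finite itself" +
  fixes \<Gamma> :: "('a^'n^'n) set"
  assumes cocompact: "cocompact_lattice \<nu> \<Gamma>" and type_pres: "type_preserving \<nu> \<Gamma>"
    and inj_rad: "inj_radius_ge \<nu> \<pi> \<Gamma> 2"
begin

abbreviation orb :: "('a^'n) set \<Rightarrow> ('a^'n) set set set" where
  "orb M \<equiv> orbit_of \<Gamma> (lat_class M)"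

lemma group: "pgl_subgroup \<Gamma>"
  using cocompact by (simp add: cocompact_lattice_def)

lemma \<Gamma>_inv: "g \<in> \<Gamma> \<Longrightarrow> invertible g"
  and \<Gamma>_mat: "c \<noteq> 0 \<Longrightarrow> mat c \<in> \<Gamma>"
  and \<Gamma>_mult: "g \<in> \<Gamma> \<Longrightarrow> h \<in> \<Gamma> \<Longrightarrow> g ** h \<in> \<Gamma>"
  using group by (auto simp: pgl_subgroup_def)

lemma vtype_eq: "is_lattice \<nu> (M :: ('a^'n) set) \<Longrightarrow> vtype \<nu> (lat_class M) = lval M mod d"
  by (simp add: vtype_lat_class d_def)

lemma \<Gamma>_det: assumes "g \<in> \<Gamma>" shows "\<nu> (det g) mod d = 0"
proof -
  have std: "is_lattice \<nu> (std :: ('a^'n) set)"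
    using is_lattice_act_std[of "mat 1"] invertible_mat[of 1] by simp
  then have "vtype \<nu> (act_vert g (lat_class std)) = vtype \<nu> (lat_class (std :: ('a^'n) set))"
    using type_pres assms lat_class_vertex[OF std] by (simp add: type_preserving_def)
  then have "(lval (std :: ('a^'n) set) + \<nu> (det g)) mod d = lval (std :: ('a^'n) set) mod d"
    by (simp add: act_vert_lat_class vtype_eq std lattice_act \<Gamma>_inv[OF assms] lval_act)
  then have "((lval (std :: ('a^'n) set) + \<nu> (det g)) - lval (std :: ('a^'n) set)) mod d = 0"
    by (metis mod_diff_cong diff_self mod_0)
  then show ?thesis by simp
qed

lemma orb_scale: "c \<noteq> 0 \<Longrightarrow> orb (scale_set c L) = orb L"
  by (simp add: lat_class_scale)

lemma orb_act: "g \<in> \<Gamma> \<Longrightarrow> orb (act_lat g L) = orb L"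
  using orbit_act[OF group, of g "lat_class L"] by (simp add: act_vert_lat_class)

text \<open>\<open>\<Gamma>\<close> contains the scalars, so the scalar between \<open>M\<close> and
  a translate of \<open>L\<close> is absorbed into the group element. Equal \<open>lval\<close> then
  gives its determinant valuation 0, so that it maps chains to chains without shifting the
  index.\<close>

lemma orb_eqD:
  assumes L: "is_lattice \<nu> L" and M: "is_lattice \<nu> M" and v: "lval L = lval M" and eq: "orb L = orb M"
  shows "\<exists>g\<in>\<Gamma>. \<nu> (det g) = 0 \<and> M = act_lat g L"
proof -
  have "lat_class M \<in> orb M"
    using \<Gamma>_mat[of 1] unfolding orbit_of_def by (auto intro!: exI[of _ "mat 1"])
  then obtain g where g: "g \<in> \<Gamma>" "lat_class M = lat_class (act_lat g L)"
    unfolding eq[symmetric] by (auto simp: orbit_of_def act_vert_lat_class)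
  obtain c where c: "c \<noteq> 0" "M = scale_set c (act_lat g L)" using lat_class_eqD[OF g(2)[symmetric]] by blast
  then have M': "M = act_lat (mat c ** g) L" by (simp add: scale_set_eq_act act_lat_act)
  have "mat c ** g \<in> \<Gamma>" using c g by (simp add: \<Gamma>_mat \<Gamma>_mult)
  moreover from this have "\<nu> (det (mat c ** g)) = 0" using v lval_act[OF \<Gamma>_inv L] M' by simp
  ultimately show ?thesis using M' by blast
qed

lemma X_type_orb:
  assumes M: "is_lattice \<nu> M" shows "X_type \<nu> (orb M) = lval M mod d"
proof -
  have "vtype \<nu> v = lval M mod d" if v: "v \<in> orb M" for v
  proof -
    obtain g where g: "g \<in> \<Gamma>" "v = lat_class (act_lat g M)"
      using v by (auto simp: orbit_of_def act_vert_lat_class)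
    then have "vtype \<nu> v = (lval M + \<nu> (det g)) mod d"
      using M by (simp add: vtype_eq lattice_act lval_act \<Gamma>_inv)
    also have "\<dots> = lval M mod d" using \<Gamma>_det[OF g(1)] by (simp add: mod_add_eq[symmetric])
    finally show ?thesis .
  qed
  moreover have "lat_class M \<in> orb M"
    using \<Gamma>_mat[of 1] unfolding orbit_of_def by (auto intro!: exI[of _ "mat 1"])
  ultimately show ?thesis unfolding X_type_def by (metis someI_ex)
qed

definition V :: "int \<Rightarrow> ('a^'n) set set set set" where
  "V i = {x \<in> X_vertices \<nu> \<Gamma>. X_type \<nu> x = i}"

lemma V_eq: assumes "i \<in> {0..<d}" shows "V i = {orb M | M. is_lattice \<nu> M \<and> lval M = i}"
proof safe
  fix x assume "x \<in> V i"
  then obtain M where M: "is_lattice \<nu> M" "x = orb M" "X_type \<nu> x = i"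
    by (auto simp: V_def X_vertices_def bt_vertices_iff)
  define c where "c = \<pi> powi (- (lval M div d))"
  have "lval M mod d = i" using M X_type_orb by simp
  then have "lval (scale_set c M) = i"
    using M(1) by (simp add: c_def lval_scale_d minus_div_mult_eq_mod)
  then show "\<exists>M. x = orb M \<and> is_lattice \<nu> M \<and> lval M = i"
    using M by (intro exI[of _ "scale_set c M"]) (simp add: c_def lattice_scale orb_scale)
next
  fix M :: "('a^'n) set" assume "is_lattice \<nu> M" "i = lval M"
  then show "orb M \<in> V (lval M)"
    using assms lat_class_vertex[of M] by (auto simp: V_def X_vertices_def X_type_orb)
qed

lemma finite_X_vertices: "finite (X_vertices \<nu> \<Gamma>)"
  using cocompact by (simp add: cocompact_lattice_def X_vertices_def)

section \<open>Top cells of the quotient and their lifts to chains\<close>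

definition cell :: "(int \<Rightarrow> ('a^'n) set) \<Rightarrow> ('a^'n) set set set set" where
  "cell L = (\<lambda>n. orb (L n)) ` {0..<d}"

lemma lat_class_chain_mod: assumes "chain L" shows "lat_class (L n) = lat_class (L (n mod d))"
proof -
  have "L n = scale_set (\<pi> powi (n div d)) (L (n mod d))"
    using chain_shift[OF assms, of "n mod d" "n div d"] by (simp add: add.commute)
  then show ?thesis by (simp add: lat_class_scale)
qed

lemma lat_class_chain_cong: "chain L \<Longrightarrow> (n - m) mod d = 0 \<Longrightarrow> lat_class (L n) = lat_class (L m)"
  using lat_class_chain_mod[of L n] lat_class_chain_mod[of L m] by (metis mod_eq_dvd_iff mod_0_imp_dvd)

lemma lat_class_chain_inj:
  assumes "chain L" "lat_class (L n) = lat_class (L m)" shows "(n - m) mod d = 0"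
proof -
  have "vtype \<nu> (lat_class (L n)) = vtype \<nu> (lat_class (L m))" using assms by simp
  then have "n mod d = m mod d" using assms(1) by (simp add: vtype_eq chain_lattice chain_lval)
  then show ?thesis by (simp add: mod_eq_dvd_iff)
qed

lemma chain_psubset: assumes "chain L" "m < n" shows "L n \<subset> L m"
  using chain_antimono[OF assms(1), of m n] chain_lval[OF assms(1), of m] chain_lval[OF assms(1), of n] assms(2)
  by (cases "L n = L m") auto

lemma chain_\<pi>_psubset: assumes "chain L" "n < m + d" shows "scale_set \<pi> (L m) \<subset> L n"
  using chain_psubset[OF assms] assms(1) by (simp add: chain_def)

lemma chain_face:
  assumes L: "chain L"
  defines "C \<equiv> (\<lambda>n. lat_class (L n)) ` {0..<d}"
  shows "bt_face \<nu> \<pi> C" "card C = CARD('n)"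
proof -
  have inj: "inj_on (\<lambda>n. lat_class (L n)) {0..<d}"
  proof (rule inj_onI)
    fix n m assume nm: "n \<in> {0..<d}" "m \<in> {0..<d}" "lat_class (L n) = lat_class (L m)"
    then have "\<bar>n - m\<bar> < d" by auto
    then show "n = m" using lat_class_chain_inj[OF L nm(3)] mod_small_nonzero[of "n - m"] by auto
  qed
  then show "card C = CARD('n)" by (simp add: C_def card_image d_def)
  have set: "{0..d - 1} = {0..<d}" by auto
  have len: "length [0..d - 1] = nat d" by simp
  have nth: "map L [0..d - 1] ! i = L (int i)" if "i < nat d" for i
    using that len by (simp add: nth_upto)
  show "bt_face \<nu> \<pi> C"
    unfolding bt_face_def
  proof (intro exI[of _ "map L [0..d - 1]"] conjI allI impI ballI)
    show "map L [0..d - 1] \<noteq> []" using d3 by simp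
    show "is_lattice \<nu> M" if "M \<in> set (map L [0..d - 1])" for M
      using that chain_lattice[OF L] by auto
    show "distinct (map lat_class (map L [0..d - 1]))"
      using inj by (simp add: distinct_map comp_def set)
    show "lat_class ` set (map L [0..d - 1]) = C"
      by (simp add: C_def image_image set)
    show "map L [0..d - 1] ! Suc i \<subset> map L [0..d - 1] ! i" if "Suc i < length (map L [0..d - 1])" for i
      using that nth[of i] nth[of "Suc i"] chain_psubset[OF L, of "int i" "1 + int i"] by simp
    have "last (map L [0..d - 1]) = L (d - 1)"
      using d3 by (subst last_conv_nth) (auto simp: nth_upto)
    then show "scale_set \<pi> (map L [0..d - 1] ! 0) \<subset> last (map L [0..d - 1])"
      using d3 nth[of 0] chain_\<pi>_psubset[OF L, of "d - 1" 0] by simp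
  qed
qed

text \<open>The \<open>d\<close> lattices followed by \<open>scale_set \<pi> (Ls ! 0)\<close> form
  \<open>d\<close> strict inclusions over a total length of \<open>d\<close>, so every step has
  length exactly one and the list is a full period of a chain.\<close>

lemma face_chain:
  assumes C: "bt_face \<nu> \<pi> C" "card C = CARD('n)"
  shows "\<exists>L. chain L \<and> C = (\<lambda>n. lat_class (L n)) ` {0..<d}"
proof -
  obtain Ls :: "('a^'n) set list" where Ls: "Ls \<noteq> []" "\<And>L. L \<in> set Ls \<Longrightarrow> is_lattice \<nu> L"
     "distinct (map lat_class Ls)" "lat_class ` set Ls = C"
     "\<And>i. Suc i < length Ls \<Longrightarrow> Ls ! Suc i \<subset> Ls ! i" "scale_set \<pi> (Ls ! 0) \<subset> last Ls"
    using C(1) unfolding bt_face_def by blast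
  have len: "length Ls = nat d"
    using C(2) distinct_card[OF Ls(3)] Ls(4) by (simp add: d_def)
  have lat: "is_lattice \<nu> (Ls ! i)" if "i < nat d" for i using Ls(2) that len by simp
  have sub: "Ls ! Suc i \<subset> Ls ! i" if "Suc i < nat d" for i using Ls(5) that len by simp
  have last: "last Ls = Ls ! nat (d - 1)" using Ls(1) len d3 by (simp add: last_conv_nth nat_diff_distrib)
  have strict: "lval A < lval B" if "is_lattice \<nu> A" "is_lattice \<nu> B" "B \<subset> A" for A B :: "('a^'n) set"
  proof -
    have "\<not> lval B \<le> lval A" using that lval_eq[of B A] by blast
    then show ?thesis by simp
  qed
  define v0 where "v0 = lval (Ls ! 0)"
  have up: "lval (Ls ! i) \<le> lval (Ls ! j) - int (j - i)" if "i \<le> j" "j < nat d" for i j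
    using that
  proof (induction j)
    case (Suc j)
    show ?case
    proof (cases "i = Suc j")
      case False
      have "lval (Ls ! j) < lval (Ls ! Suc j)" using Suc.prems by (intro strict lat sub) auto
      then show ?thesis using Suc False by (auto simp: Suc_diff_le)
    qed simp
  qed simp
  have "lval (last Ls) < lval (scale_set \<pi> (Ls ! 0))"
    using Ls(6) d3 lat[of "nat (d - 1)"] lat[of 0] unfolding last by (intro strict lattice_scale) auto
  then have top: "lval (Ls ! nat (d - 1)) \<le> v0 + d - 1"
    using d3 lat[of 0] by (simp add: last lval_scale_d v0_def)
  have val: "lval (Ls ! i) = v0 + int i" if "i < nat d" for i
  proof -
    have "i \<le> nat (d - 1)" using that by linarith
    then show ?thesis
      using up[of 0 i] up[of i "nat (d - 1)"] that top d3 by (auto simp: v0_def of_nat_diff)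
  qed
  define L where "L = (\<lambda>n. scale_set (\<pi> powi ((n - v0) div d)) (Ls ! nat ((n - v0) mod d)))"
  have "chain (\<lambda>n. scale_set (\<pi> powi ((n - v0) div d)) ((\<lambda>r. Ls ! nat r) ((n - v0) mod d)))"
  proof (rule chain_of_period)
    show "is_lattice \<nu> (Ls ! nat r) \<and> lval (Ls ! nat r) = v0 + r" if "0 \<le> r" "r < d" for r
      using that lat val by simp
    show "Ls ! nat (r + 1) \<subseteq> Ls ! nat r" if "0 \<le> r" "r + 1 < d" for r
    proof -
      have "Suc (nat r) < nat d" using that by linarith
      then show ?thesis using sub[of "nat r"] that by (auto simp: nat_add_distrib)
    qed
    show "scale_set \<pi> (Ls ! nat 0) \<subseteq> Ls ! nat (d - 1)" using Ls(6) last by auto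
  qed
  then have L: "chain L" by (simp add: L_def)
  have "C = (\<lambda>n. lat_class (L n)) ` {0..<d}"
  proof
    show "C \<subseteq> (\<lambda>n. lat_class (L n)) ` {0..<d}"
    proof
      fix v assume "v \<in> C"
      then obtain i where i: "i < nat d" "v = lat_class (Ls ! i)"
        unfolding Ls(4)[symmetric] len[symmetric] by (auto simp: in_set_conv_nth)
      have "L (v0 + int i) = Ls ! i" using i by (simp add: L_def)
      then have "v = lat_class (L ((v0 + int i) mod d))" using i lat_class_chain_mod[OF L] by metis
      then show "v \<in> (\<lambda>n. lat_class (L n)) ` {0..<d}" using d3 by auto
    qed
    show "(\<lambda>n. lat_class (L n)) ` {0..<d} \<subseteq> C"
    proof safe
      fix n
      have "nat ((n - v0) mod d) < length Ls" using d3 len by simp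
      then have "Ls ! nat ((n - v0) mod d) \<in> set Ls" by simp
      then show "lat_class (L n) \<in> C" unfolding Ls(4)[symmetric] L_def by (simp add: lat_class_scale)
    qed
  qed
  with L show ?thesis by blast
qed

definition \<Omega> :: "('a^'n) set set set set set" where
  "\<Omega> = X_top_cells \<nu> \<pi> \<Gamma>"

lemma \<Omega>_eq: "\<Omega> = cell ` Collect chain"
proof -
  have *: "orbit_of \<Gamma> ` (\<lambda>n. lat_class (L n)) ` {0..<d} = cell L" for L
    by (simp add: cell_def image_image)
  show ?thesis
  proof
    show "\<Omega> \<subseteq> cell ` Collect chain"
      unfolding \<Omega>_def X_top_cells_def using face_chain * by fastforce
    show "cell ` Collect chain \<subseteq> \<Omega>"
    proof safe
      fix L assume "chain L"
      from chain_face[OF this] show "cell L \<in> \<Omega>"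
        unfolding \<Omega>_def X_top_cells_def *[symmetric] by blast
    qed
  qed
qed

lemma \<Omega>_cases: assumes "\<sigma> \<in> \<Omega>" obtains L where "chain L" "\<sigma> = cell L"
  using assms by (auto simp: \<Omega>_eq)

lemma cell_in_\<Omega>: "chain L \<Longrightarrow> cell L \<in> \<Omega>"
  by (auto simp: \<Omega>_eq)

lemma finite_\<Omega>: "finite \<Omega>"
proof (rule finite_subset)
  show "\<Omega> \<subseteq> Pow (X_vertices \<nu> \<Gamma>)"
    using chain_lattice by (auto simp: \<Omega>_eq cell_def X_vertices_def intro!: imageI lat_class_vertex)
qed (simp add: finite_X_vertices)

definition vx :: "int \<Rightarrow> ('a^'n) set set set set \<Rightarrow> ('a^'n) set set set" where
  "vx i \<sigma> = the_elem (\<sigma> \<inter> V i)"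

lemma cell_Int_V: assumes L: "chain L" and i: "i \<in> {0..<d}" shows "cell L \<inter> V i = {orb (L i)}"
proof -
  have ty: "X_type \<nu> (orb (L n)) = n mod d" for n using X_type_orb chain_lattice[OF L] chain_lval[OF L] by simp
  have "orb (L i) \<in> V i" using V_eq[OF i] chain_lattice[OF L] chain_lval[OF L] by blast
  then show ?thesis using i ty by (auto simp: cell_def V_def)
qed

lemma vx_cell: "chain L \<Longrightarrow> i \<in> {0..<d} \<Longrightarrow> vx i (cell L) = orb (L i)"
  by (simp add: vx_def cell_Int_V)

lemma chain_adj:
  assumes L: "chain L" and ne: "(n - k) mod d \<noteq> 0"
  shows "(lat_class (L k), lat_class (L n)) \<in> bt_adj \<nu> \<pi>"
proof -
  \<comment> \<open>The position congruent to \<open>n\<close> within the period after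
    \<open>k\<close>; its lattice lies strictly between \<open>L k\<close> and
    \<open>scale_set \<pi> (L k)\<close>.\<close>
  define m where "m = k + (n - k) mod d"
  have "(n - k) mod d > 0" using ne d3 by (metis pos_mod_sign order_le_less less_le_trans zero_less_numeral)
  then have m: "k < m" "m < k + d" using d3 by (auto simp: m_def)
  have "(n - m) mod d = 0" by (simp add: m_def) (metis diff_diff_eq minus_mod_eq_mult_div mod_mult_self1_is_0)
  then have eq: "lat_class (L n) = lat_class (L m)" by (rule lat_class_chain_cong[OF L])
  have ne': "lat_class (L k) \<noteq> lat_class (L m)"
    using lat_class_chain_inj[OF L, of m k] mod_small_nonzero[of "m - k"] m by auto
  have "bt_face \<nu> \<pi> {lat_class (L k), lat_class (L m)}"
    unfolding bt_face_def
    using chain_lattice[OF L] ne' m chain_psubset[OF L m(1)] chain_\<pi>_psubset[OF L m(2)]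
    by (intro exI[of _ "[L k, L m]"]) auto
  then show ?thesis
    using ne' chain_lattice[OF L] unfolding eq bt_adj_def by (auto simp: bt_vertices_iff)
qed

lemma chain_ball: assumes L: "chain L" shows "lat_class (L n) \<in> bt_ball \<nu> \<pi> (lat_class (L k)) 2"
proof (cases "(n - k) mod d = 0")
  case True
  then have "lat_class (L n) = lat_class (L k)" by (rule lat_class_chain_cong[OF L])
  then show ?thesis unfolding bt_ball_def by (auto intro!: exI[of _ 0])
next
  case False
  then show ?thesis using chain_adj[OF L False] unfolding bt_ball_def by (auto intro!: exI[of _ 1])
qed

text \<open>The only use of the injectivity radius: the star of a vertex is mapped injectively.\<close>

lemma star_point:
  assumes L: "chain L" and L': "chain L'" and k: "L k = L' k" and eq: "orb (L n) = orb (L' n)"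
  shows "L n = L' n"
proof -
  have "inj_on (orbit_of \<Gamma>) (bt_ball \<nu> \<pi> (lat_class (L k)) 2)"
    using inj_rad lat_class_vertex[OF chain_lattice[OF L]] by (simp add: inj_radius_ge_def)
  then have "lat_class (L n) = lat_class (L' n)"
    using chain_ball[OF L, of n k] chain_ball[OF L', of n k] eq unfolding k[symmetric] by (auto dest: inj_onD)
  then show ?thesis
    by (rule lat_class_inj) (simp_all add: L L' chain_lattice chain_lval)
qed

lemma orb_chain_mod: "chain L \<Longrightarrow> orb (L n) = orb (L (n mod d))"
  using lat_class_chain_mod by metis

lemma cell_eq_orb:
  assumes "chain L" "chain L'" "cell L = cell L'" shows "orb (L n) = orb (L' n)"
proof -
  have n: "n mod d \<in> {0..<d}" using d3 by simp
  have "vx (n mod d) (cell L) = vx (n mod d) (cell L')" using assms by simp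
  then show ?thesis
    using vx_cell[OF assms(1) n] vx_cell[OF assms(2) n] orb_chain_mod[OF assms(1), of n] orb_chain_mod[OF assms(2), of n]
    by simp
qed

lemma star_inj:
  assumes "chain L" "chain L'" "L k = L' k" "cell L = cell L'" shows "L = L'"
  using star_point[OF assms(1-3)] cell_eq_orb[OF assms(1,2,4)] by auto

lemma chain_act:
  assumes g: "invertible g" "\<nu> (det g) = 0" and L: "chain L"
  shows "chain (\<lambda>n. act_lat g (L n))"
  using L g by (auto simp: chain_def lattice_act lval_act act_scale intro: subsetD[OF act_mono])

text \<open>Lifts of a cell can be moved by \<open>\<Gamma>\<close>, so one of them passes through
  any prescribed lattice over one of its vertices.\<close>

lemma star_surj:
  assumes L: "chain L" and M: "is_lattice \<nu> M" "lval M = k" and eq: "orb (L k) = orb M"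
  shows "\<exists>L'. chain L' \<and> L' k = M \<and> cell L' = cell L"
proof -
  obtain g where g: "g \<in> \<Gamma>" "\<nu> (det g) = 0" "M = act_lat g (L k)"
    using orb_eqD[OF chain_lattice[OF L] M(1) _ eq] M(2) chain_lval[OF L] by auto
  show ?thesis
    using g by (intro exI[of _ "\<lambda>n. act_lat g (L n)"]) (simp add: chain_act L \<Gamma>_inv cell_def orb_act)
qed

definition xpanel :: "int \<Rightarrow> ('a^'n) set set set set \<Rightarrow> ('a^'n) set set set set set" where
  "xpanel i \<sigma> = {\<sigma>' \<in> \<Omega>. \<forall>j\<in>{0..<d}. j \<noteq> i \<longrightarrow> vx j \<sigma> = vx j \<sigma>'}"

text \<open>Lifts are anchored at \<open>L (i + 1)\<close>, which a panel of type \<open>i\<close>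
  leaves fixed. Once a cell is lifted through this lattice, \<open>star_point\<close> forces the
  lift to agree with \<open>L\<close> wherever the vertices of the cells agree.\<close>

lemma xpanel_bij:
  assumes L: "chain L" and i: "i \<in> {0..<d}"
  shows "bij_betw cell (panel i L) (xpanel i (cell L))"
  unfolding bij_betw_def
proof
  have k: "(i + 1 - i) mod d \<noteq> 0" using d3 by simp
  show "inj_on cell (panel i L)"
    using k by (intro inj_onI star_inj[of _ _ "i + 1"]) (auto simp: panel_def agree_def)
  show "cell ` panel i L = xpanel i (cell L)"
  proof
    show "cell ` panel i L \<subseteq> xpanel i (cell L)"
    proof safe
      fix L' assume L': "L' \<in> panel i L"
      have "L j = L' j" if "j \<in> {0..<d}" "j \<noteq> i" for j
        using that L' i mod_small_nonzero[of "j - i"] by (auto simp: panel_def agree_def)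
      then show "cell L' \<in> xpanel i (cell L)"
        using L L' by (auto simp: xpanel_def panel_def vx_cell cell_in_\<Omega>)
    qed
    show "xpanel i (cell L) \<subseteq> cell ` panel i L"
    proof
      fix \<sigma>' assume \<sigma>': "\<sigma>' \<in> xpanel i (cell L)"
      then obtain L' where L': "chain L'" "\<sigma>' = cell L'" by (auto simp: xpanel_def elim: \<Omega>_cases)
      have orb_eq: "orb (L n) = orb (L' n)" if "(n - i) mod d \<noteq> 0" for n
      proof -
        have j: "n mod d \<in> {0..<d}" using d3 by simp
        have "n mod d \<noteq> i"
        proof
          assume "n mod d = i"
          then have "(n - i) mod d = (n - n mod d) mod d" by simp
          then show False using that by (simp add: minus_mod_eq_mult_div)
        qed
        then have "vx (n mod d) (cell L) = vx (n mod d) (cell L')"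
          using \<sigma>' j L'(2) by (auto simp: xpanel_def)
        then show ?thesis
          using vx_cell[OF L j] vx_cell[OF L'(1) j] orb_chain_mod[OF L, of n] orb_chain_mod[OF L'(1), of n] by simp
      qed
      obtain L'' where L'': "chain L''" "L'' (i + 1) = L (i + 1)" "cell L'' = cell L'"
        using star_surj[OF L'(1) chain_lattice[OF L] chain_lval[OF L], of "i + 1"] orb_eq[OF k] by auto
      have "L n = L'' n" if "(n - i) mod d \<noteq> 0" for n
        using orb_eq[OF that] cell_eq_orb[OF L''(1) L'(1) L''(3), of n]
        by (intro star_point[OF L L''(1) L''(2)[symmetric]]) simp
      then have "L'' \<in> panel i L" using L'' by (auto simp: panel_def agree_def)
      then show "\<sigma>' \<in> cell ` panel i L" using L''(3) L'(2) by blast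
    qed
  qed
qed

text \<open>The cells at a vertex correspond to the chains through a lattice over it. Their number
  is the same for all lattices of equal \<open>lval\<close>, since matrices with determinant
  valuation 0 permute these lattices transitively.\<close>

lemma card_star:
  assumes i: "i \<in> {0..<d}"
  shows "\<exists>N>0. \<forall>x\<in>V i. card {\<sigma>\<in>\<Omega>. vx i \<sigma> = x} = N"
proof -
  define S where "S M = {L. chain L \<and> L i = M}" for M
  have bij: "bij_betw cell (S M) {\<sigma>\<in>\<Omega>. vx i \<sigma> = orb M}" if M: "is_lattice \<nu> M" "lval M = i" for M
    unfolding bij_betw_def
  proof
    show "inj_on cell (S M)" by (intro inj_onI star_inj[of _ _ i]) (auto simp: S_def)
    show "cell ` S M = {\<sigma>\<in>\<Omega>. vx i \<sigma> = orb M}"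
    proof
      show "cell ` S M \<subseteq> {\<sigma>\<in>\<Omega>. vx i \<sigma> = orb M}" using i by (auto simp: S_def vx_cell cell_in_\<Omega>)
      show "{\<sigma>\<in>\<Omega>. vx i \<sigma> = orb M} \<subseteq> cell ` S M"
      proof safe
        fix \<sigma> assume "\<sigma> \<in> \<Omega>" "vx i \<sigma> = orb M"
        then obtain L where L: "chain L" "\<sigma> = cell L" "orb (L i) = orb M"
          using i by (metis \<Omega>_cases vx_cell)
        then show "\<sigma> \<in> cell ` S M" using star_surj[OF L(1) M L(3)] by (auto simp: S_def)
      qed
    qed
  qed
  \<comment> \<open>The matrix \<open>g\<close> need not lie in \<open>\<Gamma>\<close>; it acts on
    chains only. Finiteness of \<open>S M\<close> comes from that of
    \<open>\<Omega>\<close>.\<close>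
  have le: "card (S M) \<le> card (S M')" "finite (S M)"
    if M: "is_lattice \<nu> M" "lval M = i" and M': "is_lattice \<nu> M'" "lval M' = i" for M M'
  proof -
    obtain h h' where h: "invertible h" "M = act_lat h std" "invertible h'" "M' = act_lat h' std"
      using M M' by (auto simp: is_lattice_iff)
    define g where "g = h' ** matrix_inv h"
    have g: "invertible g" using h by (simp add: g_def invertible_mult invertible_inv)
    have gM: "act_lat g M = M'" using h by (simp add: g_def act_inv_act flip: act_lat_act)
    have g0: "\<nu> (det g) = 0" using lval_act[OF g M(1)] gM M M' by simp
    show fin: "finite (S M)" using bij_betw_finite[OF bij[OF M]] finite_\<Omega> by simp
    have fin': "finite (S M')" using bij_betw_finite[OF bij[OF M']] finite_\<Omega> by simp
    have "inj_on (\<lambda>L n. act_lat g (L n)) (S M)"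
    proof (rule inj_onI, rule ext)
      fix L L' n assume "(\<lambda>n. act_lat g (L n)) = (\<lambda>n. act_lat g (L' n))"
      then have "act_lat g (L n) = act_lat g (L' n)" by metis
      then show "L n = L' n" using act_inv_act(1)[OF g] by metis
    qed
    moreover have "(\<lambda>L n. act_lat g (L n)) ` S M \<subseteq> S M'"
      using chain_act[OF g g0] gM by (auto simp: S_def)
    ultimately show "card (S M) \<le> card (S M')" using fin' card_inj_on_le by blast
  qed
  obtain M0 :: "('a^'n) set" where M0: "is_lattice \<nu> M0" "lval M0 = i"
  proof -
    obtain L :: "int \<Rightarrow> ('a^'n) set" where "chain L"
      using chain_exists[OF is_lattice_act_std[OF invertible_mat[of 1]]] by auto
    then show ?thesis using that[of "L i"] chain_lattice chain_lval by blast
  qed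
  have "card (S M0) > 0"
    using chain_exists[OF M0(1)] M0(2) le(2)[OF M0 M0] by (auto simp: card_gt_0_iff S_def)
  moreover have "card {\<sigma>\<in>\<Omega>. vx i \<sigma> = x} = card (S M0)" if "x \<in> V i" for x
  proof -
    obtain M where M: "is_lattice \<nu> M" "lval M = i" "x = orb M" using \<open>x \<in> V i\<close> V_eq[OF i] by blast
    then show ?thesis
      using bij_betw_same_card[OF bij[OF M(1,2)]] le(1)[OF M(1,2) M0] le(1)[OF M0 M(1,2)] by simp
  qed
  ultimately show ?thesis by blast
qed

end

section \<open>Mixing in the quotient\<close>

context building_quotient
begin

text \<open>The value 0 off \<open>\<Omega>\<close> makes idempotence and commutation hold as
  equalities of functions, as \<open>projection_system\<close> requires.\<close>

definition P :: "int \<Rightarrow> (('a^'n) set set set set \<Rightarrow> real) \<Rightarrow> ('a^'n) set set set set \<Rightarrow> real" where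
  "P i u \<sigma> = (if \<sigma> \<in> \<Omega> then (\<Sum>\<sigma>'\<in>xpanel i \<sigma>. u \<sigma>') / (real q + 1) else 0)"

lemma P_cell:
  assumes "chain L" "i \<in> {0..<d}"
  shows "P i u (cell L) = Av i (u \<circ> cell) L / (real q + 1)"
  using sum.reindex_bij_betw[OF xpanel_bij[OF assms], of u] assms
  by (simp add: P_def Av_def cell_in_\<Omega>)

lemma Av_cong: "(\<And>L. chain L \<Longrightarrow> F L = G L) \<Longrightarrow> Av i F L = Av i G L"
  unfolding Av_def by (intro sum.cong) (auto simp: panel_def)

lemma Av_divide: "Av i (\<lambda>L. F L / a) L = Av i F L / a"
  by (simp add: Av_def sum_divide_distrib)

lemma Av_P:
  assumes "i \<in> {0..<d}"
  shows "Av j (P i u \<circ> cell) L = Av j (Av i (u \<circ> cell)) L / (real q + 1)"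
proof -
  have "Av j (P i u \<circ> cell) L = Av j (\<lambda>L. Av i (u \<circ> cell) L / (real q + 1)) L"
    by (rule Av_cong) (simp add: P_cell[OF _ assms])
  then show ?thesis by (simp add: Av_divide)
qed

lemma Av_Av: assumes "chain L" shows "Av i (Av i F) L = (real q + 1) * Av i F L"
proof -
  have "panel i L' = panel i L" if "L' \<in> panel i L" for L'
    using that by (auto simp: panel_def agree_def)
  then have "Av i (Av i F) L = (\<Sum>L'\<in>panel i L. Av i F L)"
    unfolding Av_def by (intro sum.cong) auto
  then show ?thesis using card_panel[OF assms, of i] by simp
qed

lemma P_ext: "(\<And>L. chain L \<Longrightarrow> P i u (cell L) = v (cell L)) \<Longrightarrow> (\<And>\<sigma>. \<sigma> \<notin> \<Omega> \<Longrightarrow> v \<sigma> = 0) \<Longrightarrow> P i u = v"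
  by (rule ext) (metis P_def \<Omega>_cases)

text \<open>Bonds of the cycle on \<open>d\<close> types, the Coxeter diagram of affine type
  A.\<close>

definition adjn :: "int \<Rightarrow> int \<Rightarrow> bool" where
  "adjn i j \<longleftrightarrow> (j - i) mod d = 1 \<or> (i - j) mod d = 1"

lemma P_self_adjoint:
  assumes "i \<in> {0..<d}" shows "ip \<Omega> (P i u) v = ip \<Omega> u (P i v)"
proof -
  define R where "R \<sigma> \<sigma>' \<longleftrightarrow> (\<forall>j\<in>{0..<d}. j \<noteq> i \<longrightarrow> vx j \<sigma> = vx j \<sigma>')" for \<sigma> \<sigma>'
  have R: "R \<sigma> \<sigma>' = R \<sigma>' \<sigma>" for \<sigma> \<sigma>' by (auto simp: R_def)
  have xp: "xpanel i \<sigma> = {\<sigma>'\<in>\<Omega>. R \<sigma> \<sigma>'}" for \<sigma> by (simp add: xpanel_def R_def)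
  have "(\<Sum>\<sigma>\<in>\<Omega>. \<Sum>\<sigma>'\<in>{\<sigma>'\<in>\<Omega>. R \<sigma> \<sigma>'}. u \<sigma>' * v \<sigma>) = (\<Sum>\<sigma>'\<in>\<Omega>. \<Sum>\<sigma>\<in>{\<sigma>\<in>\<Omega>. R \<sigma> \<sigma>'}. u \<sigma>' * v \<sigma>)"
    by (rule sum.swap_restrict[OF finite_\<Omega> finite_\<Omega>])
  then show ?thesis
    by (simp add: ip_def P_def xp R sum_distrib_left sum_distrib_right flip: sum_divide_distrib)
qed

lemma P_one: assumes "i \<in> {0..<d}" "\<sigma> \<in> \<Omega>" shows "P i (\<lambda>_. 1) \<sigma> = 1"
proof -
  obtain L where L: "chain L" "\<sigma> = cell L" using \<Omega>_cases[OF assms(2)] .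
  show ?thesis unfolding L(2) P_cell[OF L(1) assms(1)] Av_def using card_panel[OF L(1), of i] by simp
qed

lemma P_system: "projection_system \<Omega> {0..<d} P adjn (real q / (real q + 1)\<^sup>2)"
proof
  show "finite \<Omega>" by (rule finite_\<Omega>)
  show "finite {0..<d}" by simp
  have q1: "real q + 1 \<noteq> 0" by linarith
  show "linop (P i)" if "i \<in> {0..<d}" for i
    unfolding linop_def
    by (auto simp: P_def fun_eq_iff sum.distrib sum_distrib_left add_divide_distrib)
  show "ip \<Omega> (P i u) v = ip \<Omega> u (P i v)" if "i \<in> {0..<d}" for i u v by (rule P_self_adjoint[OF that])
  show "P i (P i u) = P i u" if "i \<in> {0..<d}" for i u
  proof (rule P_ext)
    show "P i (P i u) (cell L) = P i u (cell L)" if L: "chain L" for L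
      using \<open>i \<in> {0..<d}\<close> L q1 by (simp add: P_cell Av_P Av_Av)
  qed (simp add: P_def)
  show "P i (P j u) = P j (P i u)" if ij: "i \<in> {0..<d}" "j \<in> {0..<d}" "i \<noteq> j" "\<not> adjn i j" for i j u
  proof (rule P_ext)
    fix L assume L: "chain L"
    have m: "(k - 1) mod d \<noteq> 0" if "k mod d \<noteq> 1" for k
    proof
      assume "(k - 1) mod d = 0"
      then have "k mod d = 1 mod d" by (simp add: mod_eq_dvd_iff mod_0_imp_dvd)
      then show False using that d3 by simp
    qed
    have m': "(k + 1) mod d \<noteq> 0" if "(- k) mod d \<noteq> 1" for k
    proof
      assume "(k + 1) mod d = 0"
      then have "d dvd - (k + 1)" by (simp only: dvd_minus_iff mod_0_imp_dvd)
      then have "(- k) mod d = 1 mod d" by (simp add: mod_eq_dvd_iff)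
      then show False using that d3 by simp
    qed
    have ab: "\<bar>i - j\<bar> < d" "\<bar>j - i\<bar> < d" using ij(1,2) unfolding abs_if by auto
    have "Av i (Av j (u \<circ> cell)) L = Av j (Av i (u \<circ> cell)) L"
    proof (rule Av_comm[OF L])
      show "(i - j) mod d \<noteq> 0" "(j - i) mod d \<noteq> 0" using ij(3) ab mod_small_nonzero[of "i - j"] mod_small_nonzero[of "j - i"] by auto
      show "(i - 1 - j) mod d \<noteq> 0" "(i + 1 - j) mod d \<noteq> 0" "(j - 1 - i) mod d \<noteq> 0" "(j + 1 - i) mod d \<noteq> 0"
        using ij(4) m[of "i - j"] m'[of "i - j"] m[of "j - i"] m'[of "j - i"]
        by (auto simp: adjn_def algebra_simps)
    qed
    then show "P i (P j u) (cell L) = P j (P i u) (cell L)" using ij L by (simp add: P_cell Av_P)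
  qed (simp add: P_def)
  show "P i (P j (P i u)) x - real q / (real q + 1)\<^sup>2 * P i u x
      = P j (P i (P j u)) x - real q / (real q + 1)\<^sup>2 * P j u x"
    if ij: "i \<in> {0..<d}" "j \<in> {0..<d}" "adjn i j" for i j u x
  proof (cases "x \<in> \<Omega>")
    case True
    then obtain L where L: "chain L" "x = cell L" by (rule \<Omega>_cases)
    let ?F = "u \<circ> cell"
    have PPP: "P i (P j (P i u)) x = Av i (Av j (Av i ?F)) L / (real q + 1) ^ 3"
      if "i \<in> {0..<d}" "j \<in> {0..<d}" for i j
      using that L by (simp add: P_cell Av_P Av_cong[OF Av_P] Av_divide power3_eq_cube cong: Av_cong)
    have br: "Av i (Av j (Av i ?F)) L - real q * Av i ?F L = Av j (Av i (Av j ?F)) L - real q * Av j ?F L"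
      if "i \<in> {0..<d}" "j \<in> {0..<d}" "(j - i) mod d = 1" for i j
    proof -
      have "(j - (i + 1)) mod d = 0" using that(3) d3 by (metis diff_diff_eq mod_diff_left_eq diff_self mod_0)
      then have "j mod d = (i + 1) mod d" by (simp add: mod_eq_dvd_iff mod_0_imp_dvd)
      then have "Av j = Av (i + 1)" by (rule Av_mod)
      then show ?thesis using Av_braid[OF L(1), of i ?F] by simp
    qed
    have br': "Av i (Av j (Av i ?F)) L - real q * Av i ?F L = Av j (Av i (Av j ?F)) L - real q * Av j ?F L"
      using ij br[of i j] br[of j i] unfolding adjn_def by auto
    \<comment> \<open>Three averages divide by \<open>(q + 1)^3\<close> and one by
      \<open>q + 1\<close>, so the coefficient \<open>q\<close> of \<open>Av_braid\<close> turns
      into \<open>q / (q + 1)^2\<close>.\<close>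
    have sc: "P i (P j (P i u)) x - real q / (real q + 1)\<^sup>2 * P i u x
      = (Av i (Av j (Av i ?F)) L - real q * Av i ?F L) / (real q + 1) ^ 3"
      if "i \<in> {0..<d}" "j \<in> {0..<d}" for i j
      unfolding PPP[OF that] using that L
      by (simp add: P_cell diff_divide_distrib power3_eq_cube power2_eq_square)
    show ?thesis unfolding sc[OF ij(1,2)] sc[OF ij(2,1)] br' ..
  qed (simp add: P_def)
  show "(\<Sum>x\<in>\<Omega>. P i u x) = (\<Sum>x\<in>\<Omega>. u x)" if "i \<in> {0..<d}" for i u
    using P_self_adjoint[OF that, of u "\<lambda>_. 1"] P_one[OF that] by (simp add: ip_def)
  show "\<exists>a. \<forall>x\<in>\<Omega>. u x = a" if inv: "\<And>i x. i \<in> {0..<d} \<Longrightarrow> x \<in> \<Omega> \<Longrightarrow> P i u x = u x" for u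
  proof -
    \<comment> \<open>Positions in \<open>gallery_connected\<close> are arbitrary integers, but
      panels depend on them only mod \<open>d\<close>. Chains of one panel share an average, and
      \<open>u\<close> equals its average.\<close>
    have agr: "(u \<circ> cell) L = (u \<circ> cell) L'" if L: "chain L" "chain L'" "agree i L L'" for i L L'
    proof -
      have i: "i mod d \<in> {0..<d}" using d3 by simp
      have "panel i L = panel i L'" using L by (auto simp: panel_def agree_def)
      moreover have "panel (i mod d) = panel i" by (rule panel_mod) simp
      ultimately have "P (i mod d) u (cell L) = P (i mod d) u (cell L')"
        using i L by (simp add: P_cell Av_def)
      then show ?thesis using inv[OF i cell_in_\<Omega>[OF L(1)]] inv[OF i cell_in_\<Omega>[OF L(2)]] by simp
    qed
    have "u (cell L) = u (cell L')" if "chain L" "chain L'" for L L'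
      using gallery_connected[of "u \<circ> cell", OF agr that] by simp
    then show ?thesis by (metis \<Omega>_cases)
  qed
  show "adjn i j \<Longrightarrow> adjn j i" for i j by (auto simp: adjn_def)
  show "\<not> adjn i i" for i by (simp add: adjn_def)
  show "card {j \<in> {0..<d}. adjn i j} \<le> 2" if "i \<in> {0..<d}" for i
  proof -
    have "{j \<in> {0..<d}. adjn i j} \<subseteq> {(i + 1) mod d, (i - 1) mod d}"
    proof
      fix j assume "j \<in> {j \<in> {0..<d}. adjn i j}"
      then have j: "j mod d = j" "(j - i) mod d = 1 mod d \<or> (i - j) mod d = 1 mod d"
        using d3 by (auto simp: adjn_def)
      then have "d dvd j - i - 1 \<or> d dvd - (i - j - 1)" by (simp only: mod_eq_dvd_iff dvd_minus_iff)
      then have "j mod d = (i + 1) mod d \<or> j mod d = (i - 1) mod d"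
        by (simp add: mod_eq_dvd_iff algebra_simps)
      then show "j \<in> {(i + 1) mod d, (i - 1) mod d}" using j by simp
    qed
    then have "card {j \<in> {0..<d}. adjn i j} \<le> card {(i + 1) mod d, (i - 1) mod d}" by (rule card_mono[rotated]) simp
    also have "\<dots> \<le> 2" by (simp add: card_insert_if)
    finally show ?thesis .
  qed
  show "0 \<le> real q / (real q + 1)\<^sup>2" by simp
  have "4 * real q \<le> (real q + 1)\<^sup>2" using zero_le_power2[of "real q - 1"] by (simp add: power2_eq_square algebra_simps)
  moreover have "(real q + 1)\<^sup>2 > 0" using q1 by simp
  ultimately show "real q / (real q + 1)\<^sup>2 \<le> 1 / 4" by (simp add: divide_simps)
qed

lemma P_invariant:
  assumes i: "i \<in> {0..<d}" and \<sigma>: "\<sigma> \<in> \<Omega>" and u: "\<And>\<sigma>'. \<sigma>' \<in> xpanel i \<sigma> \<Longrightarrow> u \<sigma>' = u \<sigma>"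
  shows "P i u \<sigma> = u \<sigma>"
proof -
  have "(\<Sum>\<sigma>'\<in>xpanel i \<sigma>. u \<sigma>') = (\<Sum>\<sigma>'\<in>xpanel i \<sigma>. 1) * u \<sigma>" using u by simp
  moreover have "(\<Sum>\<sigma>'\<in>xpanel i \<sigma>. 1) / (real q + 1) = 1" using P_one[OF i \<sigma>] \<sigma> by (simp add: P_def)
  ultimately show ?thesis using \<sigma> by (simp add: P_def divide_simps split: if_splits)
qed

section \<open>Covariances on the set of top cells\<close>

definition E :: "(('a^'n) set set set set \<Rightarrow> real) \<Rightarrow> real" where
  "E f = (\<Sum>\<sigma>\<in>\<Omega>. f \<sigma>) / real (card \<Omega>)"

lemma card_\<Omega>_pos: "card \<Omega> > 0"
proof -
  obtain L :: "int \<Rightarrow> ('a^'n) set" where "chain L"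
    using chain_exists[OF is_lattice_act_std[OF invertible_mat[of 1]]] by auto
  then show ?thesis using cell_in_\<Omega> finite_\<Omega> by (auto simp: card_gt_0_iff)
qed

lemma E_bounds: "(\<And>\<sigma>. \<sigma> \<in> \<Omega> \<Longrightarrow> 0 \<le> f \<sigma> \<and> f \<sigma> \<le> 1) \<Longrightarrow> 0 \<le> E f \<and> E f \<le> 1"
  using card_\<Omega>_pos sum_bounded_above[of \<Omega> f 1] by (auto simp: E_def sum_nonneg divide_simps)

text \<open>The covariance is the normalised inner product of the centred \<open>f\<close> with
  \<open>g\<close>. As \<open>P k\<close> fixes \<open>g\<close>, it can be moved onto the centred
  \<open>f\<close>, where \<open>norm_P_le\<close> applies.\<close>

lemma covariance_bound:
  assumes k: "k \<in> {0..<d}"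
    and f: "\<And>\<sigma>. \<sigma> \<in> \<Omega> \<Longrightarrow> 0 \<le> f \<sigma> \<and> f \<sigma> \<le> 1" and g: "\<And>\<sigma>. \<sigma> \<in> \<Omega> \<Longrightarrow> 0 \<le> g \<sigma> \<and> g \<sigma> \<le> 1"
    and finv: "\<And>i \<sigma>. i \<in> {0..<d} \<Longrightarrow> i \<noteq> k \<Longrightarrow> \<sigma> \<in> \<Omega> \<Longrightarrow> P i f \<sigma> = f \<sigma>"
    and ginv: "\<And>\<sigma>. \<sigma> \<in> \<Omega> \<Longrightarrow> P k g \<sigma> = g \<sigma>"
  shows "\<bar>E (\<lambda>\<sigma>. f \<sigma> * g \<sigma>) - E f * E g\<bar> \<le> 2 / sqrt (real q)"
proof -
  interpret projection_system \<Omega> "{0..<d}" P adjn "real q / (real q + 1)\<^sup>2" by (rule P_system)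
  define n where "n = real (card \<Omega>)"
  have n: "n > 0" using card_\<Omega>_pos by (simp add: n_def)
  define h where "h = (\<lambda>\<sigma>. f \<sigma> - E f)"
  have Ef: "0 \<le> E f" "E f \<le> 1" using E_bounds[OF f] by auto
  have hb: "\<bar>h \<sigma>\<bar> \<le> 1" if "\<sigma> \<in> \<Omega>" for \<sigma> using f[OF that] Ef by (auto simp: h_def)
  have h0: "(\<Sum>\<sigma>\<in>\<Omega>. h \<sigma>) = 0" using n by (simp add: h_def sum_subtractf E_def n_def)
  have one: "P i (\<lambda>_. E f * 1) \<sigma> = E f" if "i \<in> {0..<d}" "\<sigma> \<in> \<Omega>" for i \<sigma>
    unfolding linop_mult[OF lin[OF that(1)]] using P_one[OF that] by simp
  have hinv: "P i h \<sigma> = h \<sigma>" if "i \<in> {0..<d}" "i \<noteq> k" "\<sigma> \<in> \<Omega>" for i \<sigma>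
    using finv[OF that] one[OF that(1,3)] that(1) by (simp add: h_def linop_diff[OF lin])
  have norm: "ip \<Omega> u u \<le> n" if "\<And>\<sigma>. \<sigma> \<in> \<Omega> \<Longrightarrow> \<bar>u \<sigma>\<bar> \<le> 1" for u
  proof -
    have "u \<sigma> * u \<sigma> \<le> 1" if "\<sigma> \<in> \<Omega>" for \<sigma>
      using \<open>\<And>\<sigma>. \<sigma> \<in> \<Omega> \<Longrightarrow> \<bar>u \<sigma>\<bar> \<le> 1\<close>[OF that] by (metis abs_square_le_1 power2_eq_square)
    then show ?thesis using sum_bounded_above[of \<Omega> "\<lambda>\<sigma>. u \<sigma> * u \<sigma>" 1] by (simp add: ip_def n_def)
  qed
  have "ip \<Omega> h g = ip \<Omega> h (P k g)" using ginv by (intro ip_cong) auto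
  also have "\<dots> = ip \<Omega> (P k h) g" using sa[OF k] by simp
  finally have "(ip \<Omega> h g)\<^sup>2 \<le> ip \<Omega> (P k h) (P k h) * ip \<Omega> g g" using ip_Cauchy_Schwarz by metis
  also have "\<dots> \<le> (4 * (real q / (real q + 1)\<^sup>2) * ip \<Omega> h h) * n"
    using norm_P_le[OF k hinv h0] g by (intro mult_mono norm) (auto intro!: ip_nonneg divide_nonneg_nonneg mult_nonneg_nonneg)
  also have "\<dots> \<le> (4 * (real q / (real q + 1)\<^sup>2) * n) * n"
    using norm[OF hb] n by (intro mult_right_mono mult_left_mono) auto
  also have "\<dots> \<le> (4 / real q * n) * n"
  proof -
    \<comment> \<open>For \<open>q = 0\<close> both sides are 0, because division by 0 yields
      0.\<close>
    have "real q / (real q + 1)\<^sup>2 \<le> 1 / real q"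
    proof (cases "q = 0")
      case False
      then have "real q / (real q + 1)\<^sup>2 \<le> real q / (real q)\<^sup>2"
        by (intro divide_left_mono power_mono) auto
      with False show ?thesis by (simp add: power2_eq_square)
    qed simp
    then show ?thesis using n by (intro mult_right_mono) auto
  qed
  finally have "(ip \<Omega> h g)\<^sup>2 \<le> 4 / real q * n\<^sup>2" by (simp add: power2_eq_square)
  then have "(ip \<Omega> h g / n)\<^sup>2 \<le> 4 / real q" using n by (simp add: power_divide pos_divide_le_eq)
  then have "\<bar>ip \<Omega> h g / n\<bar> \<le> sqrt (4 / real q)" by (metis real_sqrt_abs real_sqrt_le_mono)
  moreover have "ip \<Omega> h g / n = E (\<lambda>\<sigma>. f \<sigma> * g \<sigma>) - E f * E g"
  proof -
    have "ip \<Omega> h g = (\<Sum>\<sigma>\<in>\<Omega>. f \<sigma> * g \<sigma>) - E f * (\<Sum>\<sigma>\<in>\<Omega>. g \<sigma>)"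
      by (simp add: ip_def h_def left_diff_distrib sum_subtractf sum_distrib_left)
    then show ?thesis by (simp add: E_def n_def diff_divide_distrib)
  qed
  ultimately show ?thesis by (simp add: real_sqrt_divide)
qed

text \<open>Splitting off the factor \<open>f k\<close> costs one covariance; the error already made
  on \<open>J\<close> is multiplied by \<open>E (f k)\<close>, which is at most 1, so the errors
  merely add up.\<close>

lemma E_prod_bound:
  assumes f: "\<And>j \<sigma>. j \<in> {0..<d} \<Longrightarrow> \<sigma> \<in> \<Omega> \<Longrightarrow> 0 \<le> f j \<sigma> \<and> f j \<sigma> \<le> (1::real)"
    and dep: "\<And>j \<sigma> \<sigma>'. j \<in> {0..<d} \<Longrightarrow> \<sigma> \<in> \<Omega> \<Longrightarrow> \<sigma>' \<in> \<Omega> \<Longrightarrow> vx j \<sigma> = vx j \<sigma>' \<Longrightarrow> f j \<sigma> = f j \<sigma>'"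
    and J: "J \<subseteq> {0..<d}"
  shows "\<bar>E (\<lambda>\<sigma>. \<Prod>j\<in>J. f j \<sigma>) - (\<Prod>j\<in>J. E (f j))\<bar> \<le> real (card J) * (2 / sqrt (real q))"
proof -
  have "finite J" using J finite_subset by blast
  then show ?thesis using J
  proof (induction J rule: finite_induct)
    case empty
    then show ?case using card_\<Omega>_pos by (simp add: E_def)
  next
    case (insert k J)
    define g where "g = (\<lambda>\<sigma>. \<Prod>j\<in>J. f j \<sigma>)"
    have k: "k \<in> {0..<d}" and Jd: "J \<subseteq> {0..<d}" using insert.prems by auto
    have cov: "\<bar>E (\<lambda>\<sigma>. f k \<sigma> * g \<sigma>) - E (f k) * E g\<bar> \<le> 2 / sqrt (real q)"
    proof (rule covariance_bound[OF k])
      show "0 \<le> g \<sigma> \<and> g \<sigma> \<le> 1" if "\<sigma> \<in> \<Omega>" for \<sigma>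
        using f that Jd unfolding g_def by (auto intro!: prod_nonneg prod_le_1)
      show "P i (f k) \<sigma> = f k \<sigma>" if "i \<in> {0..<d}" "i \<noteq> k" "\<sigma> \<in> \<Omega>" for i \<sigma>
        using that k by (intro P_invariant dep) (auto simp: xpanel_def)
      show "P k g \<sigma> = g \<sigma>" if "\<sigma> \<in> \<Omega>" for \<sigma>
      proof (rule P_invariant[OF k that])
        fix \<sigma>' assume "\<sigma>' \<in> xpanel k \<sigma>"
        then show "g \<sigma>' = g \<sigma>"
          unfolding g_def using Jd insert.hyps that by (intro prod.cong refl dep) (auto simp: xpanel_def)
      qed
    qed (use f k in auto)
    have "E (f k) * E g - (\<Prod>j\<in>insert k J. E (f j)) = E (f k) * (E g - (\<Prod>j\<in>J. E (f j)))"
      using insert.hyps by (simp add: algebra_simps)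
    moreover have "\<bar>E (f k)\<bar> \<le> 1" using E_bounds[of "f k"] f k by auto
    ultimately have "\<bar>E (f k) * E g - (\<Prod>j\<in>insert k J. E (f j))\<bar> \<le> 1 * \<bar>E g - (\<Prod>j\<in>J. E (f j))\<bar>"
      unfolding abs_mult[symmetric] by (simp only: abs_mult) (intro mult_right_mono, auto)
    also have "\<dots> \<le> real (card J) * (2 / sqrt (real q))" using insert.IH[OF Jd] by (simp add: g_def)
    finally have "\<bar>E (\<lambda>\<sigma>. f k \<sigma> * g \<sigma>) - (\<Prod>j\<in>insert k J. E (f j))\<bar> \<le> 2 / sqrt (real q) + real (card J) * (2 / sqrt (real q))"
      using cov by linarith
    then show ?case using insert.hyps by (simp add: g_def algebra_simps add_divide_distrib)
  qed
qed

theorem mixing: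
  assumes W: "\<And>i. i \<in> {0..<d} \<Longrightarrow> W i \<subseteq> V i"
  shows "\<bar>real (card {\<sigma> \<in> \<Omega>. \<forall>i\<in>{0..<d}. card (\<sigma> \<inter> W i) = 1}) / real (card \<Omega>)
          - (\<Prod>i\<in>{0..<d}. real (card (W i)) / real (card (V i)))\<bar> \<le> 2 * real_of_int d / sqrt (real q)"
proof -
  define f where "f i \<sigma> = (if vx i \<sigma> \<in> W i then 1 else (0::real))" for i \<sigma>
  have finV: "finite (V i)" for i using finite_X_vertices by (simp add: V_def)
  \<comment> \<open>Every vertex of type \<open>i\<close> lies in the same number \<open>N\<close>
    of cells, so a uniformly random cell has a uniformly random vertex of type
    \<open>i\<close>.\<close>
  have Ef: "E (f i) = real (card (W i)) / real (card (V i))" if i: "i \<in> {0..<d}" for i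
  proof -
    obtain N where N: "N > 0" "\<And>x. x \<in> V i \<Longrightarrow> card {\<sigma>\<in>\<Omega>. vx i \<sigma> = x} = N" using card_star[OF i] by blast
    have cnt: "card {\<sigma>\<in>\<Omega>. vx i \<sigma> \<in> U} = card U * N" if U: "U \<subseteq> V i" for U
    proof -
      have "{\<sigma>\<in>\<Omega>. vx i \<sigma> \<in> U} = (\<Union>x\<in>U. {\<sigma>\<in>\<Omega>. vx i \<sigma> = x})" by auto
      then have "card {\<sigma>\<in>\<Omega>. vx i \<sigma> \<in> U} = (\<Sum>x\<in>U. card {\<sigma>\<in>\<Omega>. vx i \<sigma> = x})"
        using finite_subset[OF U finV] finite_\<Omega> by (simp add: card_UN_disjoint disjoint_family_on_def)
          (subst card_UN_disjoint, auto)
      then show ?thesis using N(2) U by (simp add: subset_iff)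
    qed
    have "vx i \<sigma> \<in> V i" if \<sigma>: "\<sigma> \<in> \<Omega>" for \<sigma>
    proof -
      obtain L where L: "chain L" "\<sigma> = cell L" using \<Omega>_cases[OF \<sigma>] .
      have "orb (L i) \<in> cell L \<inter> V i" using cell_Int_V[OF L(1) i] by simp
      then show ?thesis using L i by (simp add: vx_cell)
    qed
    then have "{\<sigma>\<in>\<Omega>. vx i \<sigma> \<in> V i} = \<Omega>" by auto
    then have "card \<Omega> = card (V i) * N" using cnt[of "V i"] by simp
    moreover have "(\<Sum>\<sigma>\<in>\<Omega>. f i \<sigma>) = real (card (W i) * N)"
      using cnt[OF W[OF i]] finite_\<Omega> by (simp add: f_def sum.If_cases Int_def)
    ultimately show ?thesis using N(1) by (simp add: E_def)
  qed
  \<comment> \<open>A cell has a single vertex of type \<open>i\<close>, and \<open>W i\<close>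
    contains no others, so the cardinality condition is an event about that vertex.\<close>
  have one: "card (\<sigma> \<inter> W i) = 1 \<longleftrightarrow> vx i \<sigma> \<in> W i" if \<sigma>: "\<sigma> \<in> \<Omega>" and i: "i \<in> {0..<d}" for \<sigma> i
  proof -
    obtain L where L: "chain L" "\<sigma> = cell L" using \<Omega>_cases[OF \<sigma>] .
    have "\<sigma> \<inter> W i = (\<sigma> \<inter> V i) \<inter> W i" using W[OF i] by auto
    also have "\<sigma> \<inter> V i = {vx i \<sigma>}" using L i by (simp add: cell_Int_V vx_cell)
    finally show ?thesis by auto
  qed
  have pr: "(\<Prod>i\<in>{0..<d}. f i \<sigma>) = (if \<forall>i\<in>{0..<d}. card (\<sigma> \<inter> W i) = 1 then 1 else 0)" if \<sigma>: "\<sigma> \<in> \<Omega>" for \<sigma>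
  proof (cases "\<forall>i\<in>{0..<d}. card (\<sigma> \<inter> W i) = 1")
    case True
    then have "\<forall>i\<in>{0..<d}. f i \<sigma> = 1" using one[OF \<sigma>] by (auto simp: f_def)
    then show ?thesis using True by simp
  next
    case False
    then obtain i where "i \<in> {0..<d}" "f i \<sigma> = 0" using one[OF \<sigma>] by (auto simp: f_def)
    then show ?thesis using False by (subst prod_zero) auto
  qed
  have "E (\<lambda>\<sigma>. \<Prod>i\<in>{0..<d}. f i \<sigma>) = real (card {\<sigma> \<in> \<Omega>. \<forall>i\<in>{0..<d}. card (\<sigma> \<inter> W i) = 1}) / real (card \<Omega>)"
    unfolding E_def using finite_\<Omega> by (simp add: pr sum.If_cases Int_def cong: sum.cong)
  moreover have "\<bar>E (\<lambda>\<sigma>. \<Prod>i\<in>{0..<d}. f i \<sigma>) - (\<Prod>i\<in>{0..<d}. E (f i))\<bar> \<le> real (card {0..<d}) * (2 / sqrt (real q))"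
    by (rule E_prod_bound) (auto simp: f_def)
  moreover have "(\<Prod>i\<in>{0..<d}. E (f i)) = (\<Prod>i\<in>{0..<d}. real (card (W i)) / real (card (V i)))"
    by (intro prod.cong) (auto simp: Ef)
  moreover have "real (card {0..<d}) = real_of_int d" using d3 by simp
  ultimately show ?thesis by (simp add: mult_ac)
qed

end

theorem theorem1p3:
  fixes \<nu> :: "'a::field \<Rightarrow> int" and \<pi> :: 'a and q :: nat
    and \<Gamma> :: "('a^'n::finite^'n) set"
    and W :: "int \<Rightarrow> ('a^'n) set set set set"
  assumes F: "nonarch_local_field \<nu> \<pi> q"
    and q_odd: "odd q"
    and d: "CARD('n) \<ge> 3"
    and lat: "cocompact_lattice \<nu> \<Gamma>"
    and tp: "type_preserving \<nu> \<Gamma>"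
    and inj: "inj_radius_ge \<nu> \<pi> \<Gamma> 2"
    and W: "\<forall>i\<in>{0..<int CARD('n)}. W i \<subseteq> {x \<in> X_vertices \<nu> \<Gamma>. X_type \<nu> x = i}"
  shows "\<bar>real (card (X_E \<nu> \<pi> \<Gamma> W)) / real (card (X_top_cells \<nu> \<pi> \<Gamma>))
           - (\<Prod>i\<in>{0..<int CARD('n)}.
                real (card (W i)) / real (card {x \<in> X_vertices \<nu> \<Gamma>. X_type \<nu> x = i}))\<bar>
         \<le> 2 * real CARD('n) / sqrt (real q)"
proof -
  interpret building_quotient \<nu> \<pi> q "TYPE('n)" \<Gamma>
    using F d lat tp inj by unfold_locales (auto simp: nonarch_local_field_def)
  show ?thesis
    using mixing[of W] W unfolding X_E_def \<Omega>_def V_def d_def by simp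
qed

end
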